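(* Any definable bounded distributive lattice $(H,\sqsubseteq)$ of dimension one embeds definably into a definable join-irreducibly generated bounded distributive lattice of dimension one.
   Context: Fix an o-minimal structure $R$ expanding a real-closed field. "Definable" means definable in $R$ with parameters; a definable lattice is a lattice whose underlying set is a definable subset of some $R^n$ and whose order relation is definable; its dimension is the o-minimal dimension of its underlying set. A definable embedding of bounded distributive lattices is a definable injective map preserving binary meets, binary joins, the least element and the greatest element. A distributive lattice $(G,\sqsubseteq)$ is join-irreducibly generated (jig) if for every $x\in G$ there are finitely many join-irreducible elements $i_1,\dots,i_n\in G$ with $x=i_1\sqcup\dots\sqcup i_n$; $n=0$ is allowed, the empty join being the least element $\bot$. By convention $\bot$ is not join-irreducible. *)

theory Defs
  imports
    "HOL-Computational_Algebra.Polynomial"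
    "HOL-Library.Extended_Real"
    "HOL-Algebra.Lattice"
begin

section \<open>First-order structures expanding an ordered field\<close>

definition real_closed :: "'a::linordered_field itself \<Rightarrow> bool" where
  "real_closed _ \<longleftrightarrow>
     (\<forall>a::'a. a > 0 \<longrightarrow> (\<exists>b. b\<^sup>2 = a)) \<and>
     (\<forall>p::'a poly. odd (degree p) \<longrightarrow> (\<exists>x. poly p x = 0))"

text \<open>The language consists of the symbols of ordered fields, with their standard
  interpretation, together with arbitrary extra function symbols \<open>'f\<close> and relation symbols \<open>'r\<close>.
  An extra symbol may be applied to argument lists of any length, so it stands for one symbol of
  each arity. A symbol of a fixed arity is obtained by interpreting it trivially on lists of any
  other length, which adds no definable sets.\<close>

datatype 'f tm =
    Var nat
  | Zero
  | One
  | Plus "'f tm" "'f tm"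
  | Minus "'f tm"
  | Times "'f tm" "'f tm"
  | Fn 'f "'f tm list"

datatype ('f, 'r) fm =
    Eq "'f tm" "'f tm"
  | Less "'f tm" "'f tm"
  | Rel 'r "'f tm list"
  | Neg "('f, 'r) fm"
  | Conj "('f, 'r) fm" "('f, 'r) fm"
  | Exi nat "('f, 'r) fm"

record ('f, 'r, 'a) expansion =
  fn :: "'f \<Rightarrow> 'a list \<Rightarrow> 'a"
  rl :: "'r \<Rightarrow> 'a list \<Rightarrow> bool"

primrec tm_val :: "('f, 'r, 'a::linordered_field) expansion \<Rightarrow> (nat \<Rightarrow> 'a) \<Rightarrow> 'f tm \<Rightarrow> 'a" where
  "tm_val M v (Var i) = v i"
| "tm_val M v Zero = 0"
| "tm_val M v One = 1"
| "tm_val M v (Plus s t) = tm_val M v s + tm_val M v t"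
| "tm_val M v (Minus t) = - tm_val M v t"
| "tm_val M v (Times s t) = tm_val M v s * tm_val M v t"
| "tm_val M v (Fn f ts) = fn M f (map (tm_val M v) ts)"

primrec sat :: "('f, 'r, 'a::linordered_field) expansion \<Rightarrow> (nat \<Rightarrow> 'a) \<Rightarrow> ('f, 'r) fm \<Rightarrow> bool" where
  "sat M v (Eq s t) \<longleftrightarrow> tm_val M v s = tm_val M v t"
| "sat M v (Less s t) \<longleftrightarrow> tm_val M v s < tm_val M v t"
| "sat M v (Rel r ts) \<longleftrightarrow> rl M r (map (tm_val M v) ts)"
| "sat M v (Neg \<phi>) \<longleftrightarrow> \<not> sat M v \<phi>"
| "sat M v (Conj \<phi> \<psi>) \<longleftrightarrow> sat M v \<phi> \<and> sat M v \<psi>"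
| "sat M v (Exi i \<phi>) \<longleftrightarrow> (\<exists>a. sat M (v(i := a)) \<phi>)"

text \<open>Points of $R^n$ are lists of length \<open>n\<close>. The variables below \<open>n\<close> range over the coordinates
  of the point; the values under \<open>c\<close> of the free variables from \<open>n\<close> on are the parameters.\<close>

definition definable :: "('f, 'r, 'a::linordered_field) expansion \<Rightarrow> nat \<Rightarrow> 'a list set \<Rightarrow> bool" where
  "definable M n X \<longleftrightarrow>
     (\<exists>\<phi> c. X = {xs. length xs = n \<and> sat M (\<lambda>i. if i < n then xs ! i else c i) \<phi>})"

definition definable_map ::
  "('f, 'r, 'a::linordered_field) expansion \<Rightarrow> nat \<Rightarrow> nat \<Rightarrow> 'a list set \<Rightarrow> ('a list \<Rightarrow> 'a list) \<Rightarrow> bool"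
  where
  "definable_map M n m X f \<longleftrightarrow>
     (\<forall>x\<in>X. length x = n \<and> length (f x) = m) \<and> definable M (n + m) {x @ f x | x. x \<in> X}"

definition point_or_interval :: "'a::linorder set \<Rightarrow> bool" where
  "point_or_interval I \<longleftrightarrow>
     (\<exists>a. I = {a}) \<or> (\<exists>a b. I = {a<..<b}) \<or> (\<exists>a. I = {a<..}) \<or> (\<exists>b. I = {..<b}) \<or> I = UNIV"

definition o_minimal :: "('f, 'r, 'a::linordered_field) expansion \<Rightarrow> bool" where
  "o_minimal M \<longleftrightarrow>
     (\<forall>X. definable M 1 X \<longrightarrow>
        (\<exists>\<I>. finite \<I> \<and> (\<forall>I\<in>\<I>. point_or_interval I) \<and> {a. [a] \<in> X} = \<Union>\<I>))"

section \<open>Cells and o-minimal dimension\<close>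

definition list_continuous_on :: "'a::linordered_field list set \<Rightarrow> ('a list \<Rightarrow> 'a) \<Rightarrow> bool" where
  "list_continuous_on X f \<longleftrightarrow>
     (\<forall>x\<in>X. \<forall>e>0. \<exists>d>0. \<forall>y\<in>X. (\<forall>i<length x. \<bar>y ! i - x ! i\<bar> < d) \<longrightarrow> \<bar>f y - f x\<bar> < e)"

definition cell_function ::
  "('f, 'r, 'a::linordered_field) expansion \<Rightarrow> nat \<Rightarrow> 'a list set \<Rightarrow> ('a list \<Rightarrow> 'a) \<Rightarrow> bool" where
  "cell_function M n C f \<longleftrightarrow> definable_map M n 1 C (\<lambda>x. [f x]) \<and> list_continuous_on C f"

text \<open>\<open>cell M d C\<close> says that \<open>C\<close> is a $(d_1,\dots,d_n)$-cell in $R^n$. The recursion starts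
  from the one-point space $R^0$, so that the cells in $R^1$ are the points and the nonempty open
  intervals. A lower bound \<open>None\<close> stands for $-\infty$ and an upper bound \<open>None\<close> for $+\infty$.\<close>

inductive cell ::
  "('f, 'r, 'a::linordered_field) expansion \<Rightarrow> nat list \<Rightarrow> 'a list set \<Rightarrow> bool" for M where
  cell_nil: "cell M [] {[]}"
| cell_graph:
    "cell M d C \<Longrightarrow> cell_function M (length d) C f \<Longrightarrow> cell M (d @ [0]) {x @ [f x] | x. x \<in> C}"
| cell_band:
    "cell M d C \<Longrightarrow>
     \<forall>f\<in>set_option F. cell_function M (length d) C f \<Longrightarrow>
     \<forall>g\<in>set_option G. cell_function M (length d) C g \<Longrightarrow>
     \<forall>f\<in>set_option F. \<forall>g\<in>set_option G. \<forall>x\<in>C. f x < g x \<Longrightarrow>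
     cell M (d @ [1])
       {x @ [t] | x t. x \<in> C \<and> (\<forall>f\<in>set_option F. f x < t) \<and> (\<forall>g\<in>set_option G. t < g x)}"

text \<open>The supremum is taken in \<^typ>\<open>ereal\<close>, so the empty set has dimension $-\infty$.\<close>

definition o_dim :: "('f, 'r, 'a::linordered_field) expansion \<Rightarrow> 'a list set \<Rightarrow> ereal" where
  "o_dim M X = Sup {ereal (real (sum_list d)) | d. \<exists>C. cell M d C \<and> C \<subseteq> X}"

section \<open>Definable lattices\<close>

locale bounded_distributive_lattice = Lattice.bounded_lattice L for L (structure) +
  assumes meet_join_distrib:
    "\<lbrakk>x \<in> carrier L; y \<in> carrier L; z \<in> carrier L\<rbrakk> \<Longrightarrow> x \<sqinter> (y \<squnion> z) = (x \<sqinter> y) \<squnion> (x \<sqinter> z)"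

definition definable_order ::
  "('f, 'r, 'a::linordered_field) expansion \<Rightarrow> nat \<Rightarrow> 'a list gorder \<Rightarrow> bool" where
  "definable_order M n L \<longleftrightarrow>
     definable M n (carrier L) \<and>
     definable M (n + n) {x @ y | x y. x \<in> carrier L \<and> y \<in> carrier L \<and> x \<sqsubseteq>\<^bsub>L\<^esub> y}"

definition definable_bdl ::
  "('f, 'r, 'a::linordered_field) expansion \<Rightarrow> nat \<Rightarrow> 'a list gorder \<Rightarrow> bool" where
  "definable_bdl M n L \<longleftrightarrow> definable_order M n L \<and> bounded_distributive_lattice L"

definition join_irreducible :: "'b gorder \<Rightarrow> 'b \<Rightarrow> bool" where
  "join_irreducible L i \<longleftrightarrow>
     i \<in> carrier L \<and> i \<noteq> \<bottom>\<^bsub>L\<^esub> \<and>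
     (\<forall>a\<in>carrier L. \<forall>b\<in>carrier L. i = a \<squnion>\<^bsub>L\<^esub> b \<longrightarrow> i = a \<or> i = b)"

definition jig :: "'b gorder \<Rightarrow> bool" where
  "jig L \<longleftrightarrow>
     (\<forall>x\<in>carrier L. \<exists>js. (\<forall>i\<in>set js. join_irreducible L i) \<and> x = foldr (join L) js \<bottom>\<^bsub>L\<^esub>)"

definition definable_bdl_embedding ::
  "('f, 'r, 'a::linordered_field) expansion \<Rightarrow> nat \<Rightarrow> 'a list gorder \<Rightarrow> nat \<Rightarrow> 'a list gorder
    \<Rightarrow> ('a list \<Rightarrow> 'a list) \<Rightarrow> bool" where
  "definable_bdl_embedding M n H m G h \<longleftrightarrow>
     h \<in> carrier H \<rightarrow> carrier G \<and>
     definable_map M n m (carrier H) h \<and>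
     inj_on h (carrier H) \<and>
     (\<forall>x\<in>carrier H. \<forall>y\<in>carrier H. h (x \<sqinter>\<^bsub>H\<^esub> y) = h x \<sqinter>\<^bsub>G\<^esub> h y) \<and>
     (\<forall>x\<in>carrier H. \<forall>y\<in>carrier H. h (x \<squnion>\<^bsub>H\<^esub> y) = h x \<squnion>\<^bsub>G\<^esub> h y) \<and>
     h \<bottom>\<^bsub>H\<^esub> = \<bottom>\<^bsub>G\<^esub> \<and>
     h \<top>\<^bsub>H\<^esub> = \<top>\<^bsub>G\<^esub>"

end

theory Submission
  imports Defs
begin

text \<open>A definable set without two-dimensional cells embeds definably into $(0,1)$, so the lattice may
  be taken to live on a subset of the line. Every definable filter is then either principal or
  generated by the points immediately to the left or to the right of some \<open>c\<close>; hence the definable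
  filters, ordered by reverse inclusion, form a definable distributive lattice on a subset of the
  line, into which the given lattice embeds by principal filters. Prime filters are join-irreducible
  in it, and each definable filter \<open>f\<close> is a finite intersection of definable prime filters: a maximal
  set \<open>C\<close> of irreducible elements that pairwise join into \<open>f\<close> provides the prime filters
  \<open>{y. y \<squnion> c \<in> f}\<close> with \<open>c \<in> C\<close>. Such a set \<open>C\<close> is finite, because otherwise \<open>(a, b) \<mapsto> a \<sqinter> b\<close> would
  be injective on a definable box of pairs, modulo the congruence collapsing \<open>f\<close>, which is impossible
  in dimension one.\<close>

section \<open>A calculus of definable predicates\<close>

text \<open>Join-irreducible parts can be missing because they sit at a limit. In (0,1] x {0,1} with
  a new least element adjoined, (s,1) is the join of (s,0) and (t,1) for every t < s, so only the
  elements (s,0) are join-irreducible and (s,1) is no finite join of them. The missing part is the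
  filter of all (t,1), which is definable and prime but not principal. A definable filter is
  determined by a point of the line and possibly a side, which keeps the dimension at one.

  The obstacle in the decomposition is that cliques come from Zorn's lemma or from an endless
  splitting, so they are arbitrary sets to which o-minimality does not apply. They are therefore
  traced on the definable relation "the join lies in f": an infinite clique gives it infinitely many
  infinite fibres, and this alone yields a box. On the box the mixed pairs are related as well, and
  modulo f they allow cancellation: if a meet b = a' meet b' while a join b' and a' join b are top,
  then a = a' and b = b'.\<close>

primrec fv_tm :: "'f tm \<Rightarrow> nat set" where
  "fv_tm (Var i) = {i}"
| "fv_tm Zero = {}"
| "fv_tm One = {}"
| "fv_tm (Plus s t) = fv_tm s \<union> fv_tm t"
| "fv_tm (Minus t) = fv_tm t"
| "fv_tm (Times s t) = fv_tm s \<union> fv_tm t"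
| "fv_tm (Fn f ts) = \<Union>(set (map fv_tm ts))"

primrec fv :: "('f, 'r) fm \<Rightarrow> nat set" where
  "fv (Eq s t) = fv_tm s \<union> fv_tm t"
| "fv (Less s t) = fv_tm s \<union> fv_tm t"
| "fv (Rel r ts) = \<Union>(set (map fv_tm ts))"
| "fv (Neg \<phi>) = fv \<phi>"
| "fv (Conj \<phi> \<psi>) = fv \<phi> \<union> fv \<psi>"
| "fv (Exi i \<phi>) = fv \<phi> - {i}"

primrec rename_tm :: "(nat \<Rightarrow> nat) \<Rightarrow> 'f tm \<Rightarrow> 'f tm" where
  "rename_tm \<rho> (Var i) = Var (\<rho> i)"
| "rename_tm \<rho> Zero = Zero"
| "rename_tm \<rho> One = One"
| "rename_tm \<rho> (Plus s t) = Plus (rename_tm \<rho> s) (rename_tm \<rho> t)"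
| "rename_tm \<rho> (Minus t) = Minus (rename_tm \<rho> t)"
| "rename_tm \<rho> (Times s t) = Times (rename_tm \<rho> s) (rename_tm \<rho> t)"
| "rename_tm \<rho> (Fn f ts) = Fn f (map (rename_tm \<rho>) ts)"

text \<open>The bound variable moves beyond the images of all free variables of the body, so nothing
  is captured even when the renaming is not injective.\<close>

primrec rename_fm :: "('f, 'r) fm \<Rightarrow> (nat \<Rightarrow> nat) \<Rightarrow> ('f, 'r) fm" where
  "rename_fm (Eq s t) \<rho> = Eq (rename_tm \<rho> s) (rename_tm \<rho> t)"
| "rename_fm (Less s t) \<rho> = Less (rename_tm \<rho> s) (rename_tm \<rho> t)"
| "rename_fm (Rel r ts) \<rho> = Rel r (map (rename_tm \<rho>) ts)"
| "rename_fm (Neg \<phi>) \<rho> = Neg (rename_fm \<phi> \<rho>)"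
| "rename_fm (Conj \<phi> \<psi>) \<rho> = Conj (rename_fm \<phi> \<rho>) (rename_fm \<psi> \<rho>)"
| "rename_fm (Exi i \<phi>) \<rho> =
     Exi (Suc (Max (insert 0 (\<rho> ` fv \<phi>)))) (rename_fm \<phi> (\<rho>(i := Suc (Max (insert 0 (\<rho> ` fv \<phi>))))))"

lemma finite_fv_tm [simp]: "finite (fv_tm t)"
  by (induction t) auto

lemma finite_fv [simp]: "finite (fv \<phi>)"
  by (induction \<phi>) auto

lemma tm_val_cong: "(\<And>i. i \<in> fv_tm t \<Longrightarrow> v i = w i) \<Longrightarrow> tm_val M v t = tm_val M w t"
proof (induction t)
  case (Fn f ts)
  have "map (tm_val M v) ts = map (tm_val M w) ts"
    using Fn by (intro map_cong) auto
  then show ?case by (simp only: tm_val.simps)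
qed (simp_all)

lemma tm_val_map_cong:
  "(\<And>i. i \<in> \<Union>(set (map fv_tm ts)) \<Longrightarrow> v i = w i) \<Longrightarrow> map (tm_val M v) ts = map (tm_val M w) ts"
  by (intro map_cong) (auto intro: tm_val_cong)

lemma sat_cong: "(\<And>i. i \<in> fv \<phi> \<Longrightarrow> v i = w i) \<Longrightarrow> sat M v \<phi> = sat M w \<phi>"
proof (induction \<phi> arbitrary: v w)
  case (Eq s t)
  then have "tm_val M v s = tm_val M w s" "tm_val M v t = tm_val M w t"
    by (auto intro: tm_val_cong)
  then show ?case by simp
next
  case (Less s t)
  then have "tm_val M v s = tm_val M w s" "tm_val M v t = tm_val M w t"
    by (auto intro: tm_val_cong)
  then show ?case by simp
next
  case (Rel r ts)
  then have "map (tm_val M v) ts = map (tm_val M w) ts"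
    by (intro tm_val_map_cong) auto
  then show ?case by (simp only: sat.simps)
next
  case (Neg \<phi>)
  have "sat M v \<phi> = sat M w \<phi>" using Neg.prems by (intro Neg.IH) auto
  then show ?case by simp
next
  case (Conj \<phi> \<psi>)
  have "sat M v \<phi> = sat M w \<phi>" using Conj.prems by (intro Conj.IH(1)) auto
  moreover have "sat M v \<psi> = sat M w \<psi>" using Conj.prems by (intro Conj.IH(2)) auto
  ultimately show ?case by simp
next
  case (Exi i \<phi>)
  have "sat M (v(i := a)) \<phi> = sat M (w(i := a)) \<phi>" for a
    using Exi.prems by (intro Exi.IH) auto
  then show ?case by simp
qed

lemma tm_val_rename: "tm_val M v (rename_tm \<rho> t) = tm_val M (\<lambda>i. v (\<rho> i)) t"
proof (induction t)
  case (Fn f ts)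
  then have "map (tm_val M v) (map (rename_tm \<rho>) ts) = map (tm_val M (\<lambda>i. v (\<rho> i))) ts"
    by simp
  then show ?case by (simp only: tm_val.simps rename_tm.simps)
qed simp_all

lemma sat_rename: "sat M v (rename_fm \<phi> \<rho>) = sat M (\<lambda>i. v (\<rho> i)) \<phi>"
proof (induction \<phi> arbitrary: v \<rho>)
  case (Rel r ts)
  have "map (tm_val M v) (map (rename_tm \<rho>) ts) = map (tm_val M (\<lambda>i. v (\<rho> i))) ts"
    by (simp add: tm_val_rename)
  then show ?case by (simp only: sat.simps rename_fm.simps)
next
  case (Exi i \<phi>)
  define j where "j = Suc (Max (insert 0 (\<rho> ` fv \<phi>)))"
  have fresh: "\<rho> x \<noteq> j" if "x \<in> fv \<phi>" for x
  proof -
    have "\<rho> x \<le> Max (insert 0 (\<rho> ` fv \<phi>))" using that by (intro Max_ge) auto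
    then show ?thesis by (simp add: j_def)
  qed
  have "sat M (v(j := a)) (rename_fm \<phi> (\<rho>(i := j))) = sat M ((\<lambda>i. v (\<rho> i))(i := a)) \<phi>" for a
  proof -
    have "sat M (v(j := a)) (rename_fm \<phi> (\<rho>(i := j))) = sat M (\<lambda>x. (v(j := a)) ((\<rho>(i := j)) x)) \<phi>"
      by (rule Exi.IH)
    also have "\<dots> = sat M ((\<lambda>i. v (\<rho> i))(i := a)) \<phi>"
      by (rule sat_cong) (auto simp: fresh)
    finally show ?thesis .
  qed
  then show ?case by (simp add: j_def[symmetric])
qed (simp_all add: tm_val_rename)

text \<open>The map \<open>e\<close> sends each variable of the formula to a coordinate of the assignment or to a
  parameter. Bound variables are treated in de Bruijn style: under a quantifier coordinate \<open>0\<close> is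
  the bound variable and the coordinates of the outer assignment are shifted by one.\<close>

definition D :: "('f, 'r, 'a::linordered_field) expansion \<Rightarrow> ((nat \<Rightarrow> 'a) \<Rightarrow> bool) \<Rightarrow> bool" where
  "D M P \<longleftrightarrow> (\<exists>\<phi> e. \<forall>v. P v \<longleftrightarrow> sat M (\<lambda>i. case e i of Inl j \<Rightarrow> v j | Inr a \<Rightarrow> a) \<phi>)"

text \<open>Definability of the graph rather than by a term of the language, so that division,
  infima and choices can be substituted like terms. Coordinate 0 carries the value.\<close>

definition DT :: "('f, 'r, 'a::linordered_field) expansion \<Rightarrow> ((nat \<Rightarrow> 'a) \<Rightarrow> 'a) \<Rightarrow> bool" where
  "DT M t \<longleftrightarrow> D M (\<lambda>v. v 0 = t (\<lambda>i. v (Suc i)))"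

section \<open>Closure of definable predicates under connectives and quantifiers\<close>

lemma D_subst: "D M P \<Longrightarrow> D M (\<lambda>v. P (\<lambda>i. case e i of Inl j \<Rightarrow> v j | Inr a \<Rightarrow> a))"
proof -
  assume "D M P"
  then obtain \<phi> e' where P: "\<And>v. P v \<longleftrightarrow> sat M (\<lambda>i. case e' i of Inl j \<Rightarrow> v j | Inr a \<Rightarrow> a) \<phi>"
    unfolding D_def by blast
  define e'' where "e'' i = (case e' i of Inl j \<Rightarrow> e j | Inr a \<Rightarrow> Inr a)" for i
  have "(\<lambda>i. case e' i of Inl j \<Rightarrow> (case e j of Inl j \<Rightarrow> v j | Inr a \<Rightarrow> a) | Inr a \<Rightarrow> a)
     = (\<lambda>i. case e'' i of Inl j \<Rightarrow> v j | Inr a \<Rightarrow> a)" for v :: "nat \<Rightarrow> 'c"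
    by (auto simp: e''_def split: sum.splits)
  then show ?thesis unfolding D_def P by metis
qed

lemma D_ren: "D M P \<Longrightarrow> D M (\<lambda>v. P (\<lambda>i. v (\<rho> i)))"
  using D_subst[of M P "\<lambda>i. Inl (\<rho> i)"] by simp

lemma DT_ren: assumes "DT M t" shows "DT M (\<lambda>v. t (\<lambda>i. v (\<rho> i)))"
  unfolding DT_def
  using D_ren[OF assms[unfolded DT_def], of "\<lambda>i. case i of 0 \<Rightarrow> 0 | Suc j \<Rightarrow> Suc (\<rho> j)"]
  by simp

lemma D_not: "D M P \<Longrightarrow> D M (\<lambda>v. \<not> P v)"
  unfolding D_def
proof (elim exE)
  fix \<phi> e assume "\<forall>v. P v \<longleftrightarrow> sat M (\<lambda>i. case e i of Inl j \<Rightarrow> v j | Inr a \<Rightarrow> a) \<phi>"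
  then show "\<exists>\<phi> e. \<forall>v. (\<not> P v) \<longleftrightarrow> sat M (\<lambda>i. case e i of Inl j \<Rightarrow> v j | Inr a \<Rightarrow> a) \<phi>"
    by (intro exI[of _ "Neg \<phi>"] exI[of _ e]) simp
qed

lemma D_conj:
  assumes "D M P" "D M Q" shows "D M (\<lambda>v. P v \<and> Q v)"
proof -
  obtain \<phi> e where P: "\<And>v. P v \<longleftrightarrow> sat M (\<lambda>i. case e i of Inl j \<Rightarrow> v j | Inr a \<Rightarrow> a) \<phi>"
    using assms(1) unfolding D_def by blast
  obtain \<psi> e' where Q: "\<And>v. Q v \<longleftrightarrow> sat M (\<lambda>i. case e' i of Inl j \<Rightarrow> v j | Inr a \<Rightarrow> a) \<psi>"
    using assms(2) unfolding D_def by blast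
  show ?thesis unfolding D_def
  proof (intro exI allI)
    \<comment> \<open>The two formulas come with different variable maps; sending their variables to
      even and odd numbers lets one map serve both.\<close>
    show "(P v \<and> Q v) = sat M (\<lambda>i. case (if even i then e (i div 2) else e' (i div 2)) of Inl j \<Rightarrow> v j | Inr a \<Rightarrow> a)
       (Conj (rename_fm \<phi> (\<lambda>i. 2 * i)) (rename_fm \<psi> (\<lambda>i. 2 * i + 1)))" for v
      by (simp add: sat_rename P Q)
  qed
qed

lemma D_ex:
  assumes "D M (\<lambda>v. P (\<lambda>i. v (Suc i)) (v 0))" shows "D M (\<lambda>v. \<exists>a. P v a)"
proof -
  obtain \<phi> e where P: "\<And>v. P (\<lambda>i. v (Suc i)) (v 0) \<longleftrightarrow>
      sat M (\<lambda>i. case e i of Inl j \<Rightarrow> v j | Inr a \<Rightarrow> a) \<phi>"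
    using assms(1) unfolding D_def by blast
  \<comment> \<open>Several variables of the formula may read coordinate 0; all of them are merged
    into variable 0, which is then bound, and the others move up by one.\<close>
  define \<rho> where "\<rho> i = (if e i = Inl 0 then 0 else Suc i)" for i
  define e' where "e' i = (case i of 0 \<Rightarrow> Inl 0 | Suc i \<Rightarrow>
      (case e i of Inl j \<Rightarrow> Inl (j - 1) | Inr a \<Rightarrow> Inr a))" for i
  have "P v a \<longleftrightarrow> sat M ((\<lambda>i. case e' i of Inl j \<Rightarrow> v j | Inr a \<Rightarrow> a)(0 := a)) (rename_fm \<phi> \<rho>)" for v a
  proof -
    have "P v a \<longleftrightarrow> sat M (\<lambda>i. case e i of Inl j \<Rightarrow> case_nat a v j | Inr a \<Rightarrow> a) \<phi>"
      using P[of "case_nat a v"] by simp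
    also have "(\<lambda>i. case e i of Inl j \<Rightarrow> case_nat a v j | Inr a \<Rightarrow> a) =
       (\<lambda>i. ((\<lambda>i. case e' i of Inl j \<Rightarrow> v j | Inr a \<Rightarrow> a)(0 := a)) (\<rho> i))"
      by (auto simp: \<rho>_def e'_def fun_eq_iff split: sum.splits nat.splits)
    finally show ?thesis by (simp add: sat_rename)
  qed
  then have "(\<exists>a. P v a) \<longleftrightarrow> sat M (\<lambda>i. case e' i of Inl j \<Rightarrow> v j | Inr a \<Rightarrow> a) (Exi 0 (rename_fm \<phi> \<rho>))" for v
    by simp
  then show ?thesis unfolding D_def by blast
qed

lemma D_const: "D M (\<lambda>v. b)"
proof -
  have "D M (\<lambda>v. True)" unfolding D_def
    by (rule exI[of _ "Eq Zero Zero"]) simp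
  then show ?thesis using D_not[of M "\<lambda>_. True"] by (cases b) simp_all
qed

lemma D_disj: assumes "D M P" "D M Q" shows "D M (\<lambda>v. P v \<or> Q v)"
proof -
  have "D M (\<lambda>v. \<not> (\<not> P v \<and> \<not> Q v))" by (rule D_not, rule D_conj; rule D_not, fact)
  then show ?thesis by simp
qed

lemma D_imp: assumes "D M P" "D M Q" shows "D M (\<lambda>v. P v \<longrightarrow> Q v)"
proof -
  have "D M (\<lambda>v. \<not> P v \<or> Q v)" by (rule D_disj[OF D_not[OF assms(1)] assms(2)])
  then show ?thesis by simp
qed

lemma D_iff: assumes "D M P" "D M Q" shows "D M (\<lambda>v. P v \<longleftrightarrow> Q v)"
proof -
  have "D M (\<lambda>v. (P v \<longrightarrow> Q v) \<and> (Q v \<longrightarrow> P v))"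
    by (rule D_conj[OF D_imp[OF assms] D_imp[OF assms(2,1)]])
  then show ?thesis by (simp only: iff_conv_conj_imp)
qed

lemma D_all: assumes "D M (\<lambda>v. P (\<lambda>i. v (Suc i)) (v 0))" shows "D M (\<lambda>v. \<forall>a. P v a)"
proof -
  have "D M (\<lambda>v. \<not> (\<exists>a. \<not> P v a))" by (rule D_not, rule D_ex, rule D_not, rule assms)
  then show ?thesis by simp
qed

lemma D_ex1:
  assumes "D M (\<lambda>v. P (\<lambda>i. v (Suc i)) (v 0))" shows "D M (\<lambda>v. \<exists>!a. P v a)"
proof -
  have "D M (\<lambda>v. \<exists>a. P v a \<and> (\<forall>b. P v b \<longrightarrow> b = a))"
  proof (rule D_ex, rule D_conj[OF assms], rule D_all, rule D_imp)
    show "D M (\<lambda>v. P (\<lambda>i. v (Suc (Suc i))) (v 0))"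
      using D_ren[OF assms, of "case_nat 0 (\<lambda>i. Suc (Suc i))"] by simp
    show "D M (\<lambda>v. v 0 = v (Suc 0))"
      unfolding D_def
      by (rule exI[of _ "Eq (Var 0) (Var 1)"], rule exI[of _ "Inl"]) simp
  qed
  then show ?thesis unfolding Ex1_def .
qed

lemma D_fin_all:
  assumes "finite A" "\<And>i. i \<in> A \<Longrightarrow> D M (P i)" shows "D M (\<lambda>v. \<forall>i\<in>A. P i v)"
  using assms
proof (induction A rule: finite_induct)
  case (insert x F)
  then have "D M (\<lambda>v. P x v \<and> (\<forall>i\<in>F. P i v))" by (intro D_conj) auto
  then show ?case by simp
qed (simp add: D_const)

lemma D_fin_ex:
  assumes "finite A" "\<And>i. i \<in> A \<Longrightarrow> D M (P i)" shows "D M (\<lambda>v. \<exists>i\<in>A. P i v)"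
proof -
  have "D M (\<lambda>v. \<not> (\<forall>i\<in>A. \<not> P i v))" by (rule D_not, rule D_fin_all[OF assms(1)], rule D_not, rule assms(2))
  then show ?thesis by simp
qed

lemma D_all_less: "(\<And>i. i < n \<Longrightarrow> D M (P i)) \<Longrightarrow> D M (\<lambda>v. \<forall>i<n. P i v)" for n :: nat
  using D_fin_all[of "{..<n}" M P] by (simp add: Ball_def)

lemma D_ex_less: "(\<And>i. i < n \<Longrightarrow> D M (P i)) \<Longrightarrow> D M (\<lambda>v. \<exists>i<n. P i v)" for n :: nat
  using D_fin_ex[of "{..<n}" M P] by (simp add: Bex_def)

section \<open>Substitution of definable functions\<close>

lemma D_app:
  assumes t: "DT M t" and P: "D M (\<lambda>v. P (v 0) (\<lambda>i. v (Suc i)))"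
  shows "D M (\<lambda>v. P (t v) v)"
proof -
  have "D M (\<lambda>v. \<exists>a. a = t v \<and> P a v)"
    by (rule D_ex, rule D_conj[OF t[unfolded DT_def] P])
  then show ?thesis by simp
qed

lemma D_app2:
  assumes t: "DT M t" and s: "DT M s" and P: "D M (\<lambda>v. P (v 0) (v 1))"
  shows "D M (\<lambda>v. P (t v) (s v))"
proof (rule D_app[OF t], rule D_app[of M "\<lambda>v. s (\<lambda>i. v (Suc i))" "\<lambda>b v. P (v 0) b"])
  show "DT M (\<lambda>v. s (\<lambda>i. v (Suc i)))" by (rule DT_ren[OF s])
  show "D M (\<lambda>v. P (v (Suc 0)) (v 0))"
    using D_ren[OF P, of "\<lambda>i. if i = 0 then Suc 0 else 0"] by simp
qed

lemma D_app3:
  assumes t: "DT M t" and s: "DT M s" and r: "DT M r" and P: "D M (\<lambda>v. P (v 0) (v 1) (v 2))"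
  shows "D M (\<lambda>v. P (t v) (s v) (r v))"
proof (rule D_app[OF t], rule D_app[of M "\<lambda>v. s (\<lambda>i. v (Suc i))" "\<lambda>b v. P (v 0) b (r (\<lambda>i. v (Suc i)))"])
  show "DT M (\<lambda>v. s (\<lambda>i. v (Suc i)))" by (rule DT_ren[OF s])
  show "D M (\<lambda>v. P (v (Suc 0)) (v 0) (r (\<lambda>i. v (Suc (Suc i)))))"
  proof (rule D_app[of M "\<lambda>v. r (\<lambda>i. v (Suc (Suc i)))" "\<lambda>b v. P (v (Suc 0)) (v 0) b"])
    show "DT M (\<lambda>v. r (\<lambda>i. v (Suc (Suc i))))" by (rule DT_ren[OF r])
    show "D M (\<lambda>v. P (v (Suc (Suc 0))) (v (Suc 0)) (v 0))"
      using D_ren[OF P, of "\<lambda>i. if i = 0 then Suc (Suc 0) else if i = 1 then Suc 0 else 0"] by simp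
  qed
qed

lemma DT_var: "DT M (\<lambda>v. v k)"
  unfolding DT_def D_def
  by (rule exI[of _ "Eq (Var 0) (Var 1)"], rule exI[of _ "\<lambda>i. if i = 0 then Inl 0 else Inl (Suc k)"]) simp

lemma DT_const: "DT M (\<lambda>v. c)"
  unfolding DT_def D_def
  by (rule exI[of _ "Eq (Var 0) (Var 1)"], rule exI[of _ "\<lambda>i. if i = 0 then Inl 0 else Inr c"]) simp

lemma D_eq:
  assumes "DT M t" "DT M s" shows "D M (\<lambda>v. t v = s v)"
proof (rule D_app2[OF assms])
  show "D M (\<lambda>v. v 0 = v 1)" unfolding D_def
    by (rule exI[of _ "Eq (Var 0) (Var 1)"], rule exI[of _ Inl]) simp
qed

lemma D_less:
  assumes "DT M t" "DT M s" shows "D M (\<lambda>v. t v < s v)"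
proof (rule D_app2[OF assms])
  show "D M (\<lambda>v. v 0 < v 1)" unfolding D_def
    by (rule exI[of _ "Less (Var 0) (Var 1)"], rule exI[of _ Inl]) simp
qed

lemma D_le: "DT M t \<Longrightarrow> DT M s \<Longrightarrow> D M (\<lambda>v. t v \<le> s v)"
  unfolding not_less[symmetric] by (rule D_not, rule D_less)

lemma DT_app2:
  assumes t: "DT M t" and s: "DT M s" and f: "D M (\<lambda>v. v 0 = f (v 1) (v 2))"
  shows "DT M (\<lambda>v. f (t v) (s v))"
  unfolding DT_def
  by (rule D_app3[of M "\<lambda>v. v 0" "\<lambda>v. t (\<lambda>i. v (Suc i))" "\<lambda>v. s (\<lambda>i. v (Suc i))" "\<lambda>a b c. a = f b c",
        OF DT_var DT_ren[OF t] DT_ren[OF s] f])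

lemma DT_app1:
  assumes t: "DT M t" and f: "D M (\<lambda>v. v 0 = f (v 1))"
  shows "DT M (\<lambda>v. f (t v))"
  unfolding DT_def
  by (rule D_app2[of M "\<lambda>v. v 0" "\<lambda>v. t (\<lambda>i. v (Suc i))" "\<lambda>a b. a = f b",
        OF DT_var DT_ren[OF t] f])

lemma DT_plus:
  assumes "DT M t" "DT M s" shows "DT M (\<lambda>v. t v + s v)"
proof (rule DT_app2[OF assms])
  show "D M (\<lambda>v. v 0 = v 1 + v 2)" unfolding D_def
    by (rule exI[of _ "Eq (Var 0) (Plus (Var 1) (Var 2))"], rule exI[of _ Inl]) simp
qed

lemma DT_times:
  assumes "DT M t" "DT M s" shows "DT M (\<lambda>v. t v * s v)"
proof (rule DT_app2[OF assms])
  show "D M (\<lambda>v. v 0 = v 1 * v 2)" unfolding D_def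
    by (rule exI[of _ "Eq (Var 0) (Times (Var 1) (Var 2))"], rule exI[of _ Inl]) simp
qed

lemma DT_minus:
  assumes "DT M t" shows "DT M (\<lambda>v. - t v)"
proof (rule DT_app1[OF assms])
  show "D M (\<lambda>v. v 0 = - v 1)" unfolding D_def
    by (rule exI[of _ "Eq (Var 0) (Minus (Var 1))"], rule exI[of _ Inl]) simp
qed

lemma DT_diff: "DT M t \<Longrightarrow> DT M s \<Longrightarrow> DT M (\<lambda>v. t v - s v)"
  unfolding diff_conv_add_uminus by (rule DT_plus[OF _ DT_minus])

lemma DT_if:
  assumes P: "D M P" and t: "DT M t" and s: "DT M s"
  shows "DT M (\<lambda>v. if P v then t v else s v)"
proof -
  have "D M (\<lambda>v. (P (\<lambda>i. v (Suc i)) \<and> v 0 = t (\<lambda>i. v (Suc i))) \<or> (\<not> P (\<lambda>i. v (Suc i)) \<and> v 0 = s (\<lambda>i. v (Suc i))))"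
    by (intro D_disj D_conj D_not D_ren[OF P] t[unfolded DT_def] s[unfolded DT_def])
  then show ?thesis unfolding DT_def by (rule back_subst[of "D M"]) auto
qed

lemma DT_abs: "DT M t \<Longrightarrow> DT M (\<lambda>v. \<bar>t v\<bar>)"
  unfolding abs_if by (intro DT_if D_less DT_minus DT_const)

lemma DT_divide:
  assumes "DT M t" "DT M s" shows "DT M (\<lambda>v. t v / s v)"
proof (rule DT_app2[OF assms])
  \<comment> \<open>Division by zero has the value 0, so its graph needs a separate case.\<close>
  have "D M (\<lambda>v. if v 2 = 0 then v 0 = 0 else v 0 * v 2 = v 1)"
    unfolding if_bool_eq_disj by (intro D_disj D_conj D_not D_eq DT_times DT_var DT_const)
  then show "D M (\<lambda>v. v 0 = v 1 / v 2)" by (rule back_subst[of "D M"]) (auto simp: field_simps)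
qed

lemmas dintros = D_not D_conj D_disj D_imp D_iff D_ex D_all D_ex1 D_all_less D_ex_less
  D_eq D_less D_le DT_var DT_plus DT_times DT_minus DT_diff DT_if DT_abs DT_divide D_const DT_const

definition def1 :: "('f, 'r, 'a::linordered_field) expansion \<Rightarrow> ('a \<Rightarrow> bool) \<Rightarrow> bool" where
  "def1 M S \<longleftrightarrow> D M (\<lambda>v. S (v 0))"

definition def2 :: "('f, 'r, 'a::linordered_field) expansion \<Rightarrow> ('a \<Rightarrow> 'a \<Rightarrow> bool) \<Rightarrow> bool" where
  "def2 M S \<longleftrightarrow> D M (\<lambda>v. S (v 0) (v 1))"

definition def3 :: "('f, 'r, 'a::linordered_field) expansion \<Rightarrow> ('a \<Rightarrow> 'a \<Rightarrow> 'a \<Rightarrow> bool) \<Rightarrow> bool" where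
  "def3 M S \<longleftrightarrow> D M (\<lambda>v. S (v 0) (v 1) (v 2))"

definition dfn1 :: "('f, 'r, 'a::linordered_field) expansion \<Rightarrow> ('a \<Rightarrow> 'a) \<Rightarrow> bool" where
  "dfn1 M f \<longleftrightarrow> DT M (\<lambda>v. f (v 0))"

definition dfn2 :: "('f, 'r, 'a::linordered_field) expansion \<Rightarrow> ('a \<Rightarrow> 'a \<Rightarrow> 'a) \<Rightarrow> bool" where
  "dfn2 M f \<longleftrightarrow> DT M (\<lambda>v. f (v 0) (v 1))"

lemma def1D: "def1 M S \<Longrightarrow> DT M t \<Longrightarrow> D M (\<lambda>v. S (t v))"
  unfolding def1_def by (rule D_app)

lemma def2D: "def2 M S \<Longrightarrow> DT M t \<Longrightarrow> DT M s \<Longrightarrow> D M (\<lambda>v. S (t v) (s v))"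
  unfolding def2_def by (rule D_app2)

lemma def3D: "def3 M S \<Longrightarrow> DT M t \<Longrightarrow> DT M s \<Longrightarrow> DT M r \<Longrightarrow> D M (\<lambda>v. S (t v) (s v) (r v))"
  unfolding def3_def by (rule D_app3)

lemma dfn1D: "dfn1 M f \<Longrightarrow> DT M t \<Longrightarrow> DT M (\<lambda>v. f (t v))"
  unfolding dfn1_def by (erule DT_app1) (simp add: DT_def)

lemma dfn2D: "dfn2 M f \<Longrightarrow> DT M t \<Longrightarrow> DT M s \<Longrightarrow> DT M (\<lambda>v. f (t v) (s v))"
  unfolding dfn2_def by (erule (1) DT_app2) (simp add: DT_def numeral_2_eq_2)

text \<open>A quantifier over a point is n quantifiers over the field. In the premise the point
  occupies the first n coordinates, and the outer assignment is shifted behind it.\<close>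

lemma D_list_ex:
  assumes "D M (\<lambda>v. P (\<lambda>i. v (i + n)) (map v [0..<n]))"
  shows "D M (\<lambda>v. \<exists>y. length y = n \<and> P v y)"
  using assms
proof (induction n arbitrary: P)
  case 0
  then show ?case by simp
next
  case (Suc n)
  have "D M (\<lambda>v. \<exists>y. length y = n \<and> (\<exists>a. P v (a # y)))"
  proof (rule Suc.IH, rule D_ex)
    have *: "(\<lambda>i. v (i + Suc n)) = (\<lambda>i. v (Suc (i + n)))"
         "map v [0..<Suc n] = v 0 # map (\<lambda>i. v (Suc i)) [0..<n]" for v :: "nat \<Rightarrow> 'c"
      by (simp_all add: map_upt_Suc del: upt_Suc)
    show "D M (\<lambda>v. P (\<lambda>i. v (Suc (i + n))) (v 0 # map (\<lambda>i. v (Suc i)) [0..<n]))"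
      using Suc.prems unfolding * .
  qed
  then show ?case by (rule back_subst[of "D M"]) (auto simp: length_Suc_conv fun_eq_iff)
qed

lemma D_list_app:
  assumes P: "D M (\<lambda>v. P (map v [0..<n]) (\<lambda>i. v (i + n)))" and t: "\<And>i. i < n \<Longrightarrow> DT M (t i)"
  shows "D M (\<lambda>v. P (map (\<lambda>i. t i v) [0..<n]) v)"
proof -
  have "D M (\<lambda>v. \<exists>y. length y = n \<and> ((\<forall>i<n. y ! i = t i v) \<and> P y v))"
  proof (rule D_list_ex, rule D_conj)
    have "D M (\<lambda>v. \<forall>i<n. v i = t i (\<lambda>j. v (j + n)))"
      by (intro D_all_less D_eq DT_var DT_ren[OF t])
    then show "D M (\<lambda>v. \<forall>i<n. map v [0..<n] ! i = t i (\<lambda>j. v (j + n)))"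
      by (rule back_subst[of "D M"]) simp
  qed (rule P)
  moreover have "(\<exists>y. length y = n \<and> (\<forall>i<n. y ! i = t i v) \<and> P y v) = P (map (\<lambda>i. t i v) [0..<n]) v" for v
  proof -
    have "y = map (\<lambda>i. t i v) [0..<n]" if "length y = n" "\<forall>i<n. y ! i = t i v" for y
      using that by (intro nth_equalityI) auto
    then show ?thesis by (auto intro!: exI[of _ "map (\<lambda>i. t i v) [0..<n]"])
  qed
  ultimately show ?thesis by simp
qed

definition defl :: "('f, 'r, 'a::linordered_field) expansion \<Rightarrow> nat \<Rightarrow> ('a list \<Rightarrow> bool) \<Rightarrow> bool" where
  "defl M n P \<longleftrightarrow> D M (\<lambda>v. P (map v [0..<n]))"

lemma deflD: "defl M n P \<Longrightarrow> (\<And>i. i < n \<Longrightarrow> DT M (t i)) \<Longrightarrow> D M (\<lambda>v. P (map (\<lambda>i. t i v) [0..<n]))"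
  unfolding defl_def by (rule D_list_app[of M "\<lambda>y v. P y"])

lemma definable_iff_defl:
  "definable M n X \<longleftrightarrow> (\<forall>x\<in>X. length x = n) \<and> defl M n (\<lambda>x. x \<in> X)"
proof
  assume "definable M n X"
  then obtain \<phi> c where X: "X = {xs. length xs = n \<and> sat M (\<lambda>i. if i < n then xs ! i else c i) \<phi>}"
    unfolding definable_def by blast
  have "map v [0..<n] \<in> X \<longleftrightarrow>
      sat M (\<lambda>i. case (if i < n then Inl i else Inr (c i)) of Inl j \<Rightarrow> v j | Inr a \<Rightarrow> a) \<phi>" for v :: "nat \<Rightarrow> 'c"
  proof -
    have "sat M (\<lambda>i. if i < n then map v [0..<n] ! i else c i) \<phi> =
        sat M (\<lambda>i. case (if i < n then Inl i else Inr (c i)) of Inl j \<Rightarrow> v j | Inr a \<Rightarrow> a) \<phi>"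
      by (rule sat_cong) simp
    then show ?thesis unfolding X by simp
  qed
  then have "defl M n (\<lambda>x. x \<in> X)" unfolding defl_def D_def
    by (intro exI[of _ \<phi>] exI[of _ "\<lambda>i. if i < n then Inl i else Inr (c i)"]) simp
  then show "(\<forall>x\<in>X. length x = n) \<and> defl M n (\<lambda>x. x \<in> X)" by (auto simp: X)
next
  assume *: "(\<forall>x\<in>X. length x = n) \<and> defl M n (\<lambda>x. x \<in> X)"
  then obtain \<phi> e where e: "\<And>v. map v [0..<n] \<in> X \<longleftrightarrow>
      sat M (\<lambda>i. case e i of Inl j \<Rightarrow> v j | Inr a \<Rightarrow> a) \<phi>"
    unfolding defl_def D_def by blast
  \<comment> \<open>Coordinates below n keep their place. Coordinates from n on cannot influence
    membership; they go to even offsets, where \<open>c\<close> is 0, and the parameters go to odd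
    offsets.\<close>
  define \<rho> where "\<rho> i = (case e i of Inl j \<Rightarrow> if j < n then j else n + 2 * j | Inr a \<Rightarrow> n + 2 * i + 1)" for i
  define c where "c k = (if even (k - n) then 0 else case e ((k - n) div 2) of Inl j \<Rightarrow> 0 | Inr a \<Rightarrow> a)" for k
  have "X = {xs. length xs = n \<and> sat M (\<lambda>i. if i < n then xs ! i else c i) (rename_fm \<phi> \<rho>)}"
  proof (rule Set.set_eqI)
    fix xs
    have "xs \<in> X \<longleftrightarrow> sat M (\<lambda>i. if i < n then xs ! i else c i) (rename_fm \<phi> \<rho>)" if "length xs = n"
    proof -
      define v where "v i = (if i < n then xs ! i else 0)" for i
      have xs: "xs = map v [0..<n]" using that by (intro nth_equalityI) (auto simp: v_def)
      have "xs \<in> X \<longleftrightarrow> sat M (\<lambda>i. case e i of Inl j \<Rightarrow> v j | Inr a \<Rightarrow> a) \<phi>" unfolding xs by (rule e)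
      also have "(\<lambda>i. case e i of Inl j \<Rightarrow> v j | Inr a \<Rightarrow> a) = (\<lambda>i. if \<rho> i < n then xs ! \<rho> i else c (\<rho> i))"
        by (auto simp: \<rho>_def c_def v_def fun_eq_iff split: sum.splits)
      finally show ?thesis by (simp add: sat_rename)
    qed
    then show "xs \<in> X \<longleftrightarrow> xs \<in> {xs. length xs = n \<and> sat M (\<lambda>i. if i < n then xs ! i else c i) (rename_fm \<phi> \<rho>)}"
      using * by auto
  qed
  then show "definable M n X" unfolding definable_def by blast
qed

section \<open>Definable choice\<close>

text \<open>Where uniqueness fails, \<open>THE\<close> would return an unspecified value; the
  default 0 keeps the graph definable at every argument.\<close>

definition dthe :: "('a::zero \<Rightarrow> bool) \<Rightarrow> 'a" where
  "dthe Q = (if \<exists>!y. Q y then THE y. Q y else 0)"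

lemma dthe_eq: "Q x \<Longrightarrow> (\<And>y. Q y \<Longrightarrow> y = x) \<Longrightarrow> dthe Q = x"
  unfolding dthe_def by (metis the_equality)

lemma DT_dthe:
  assumes "D M (\<lambda>v. Q (\<lambda>i. v (Suc i)) (v 0))" shows "DT M (\<lambda>v. dthe (Q v))"
proof -
  have "D M (\<lambda>v. \<exists>!y. Q v y)" by (rule D_ex1[OF assms])
  from D_ren[OF this, of Suc] have 1: "D M (\<lambda>v. \<exists>!y. Q (\<lambda>i. v (Suc i)) y)" .
  have "D M (\<lambda>v. ((\<exists>!y. Q (\<lambda>i. v (Suc i)) y) \<and> Q (\<lambda>i. v (Suc i)) (v 0)) \<or>
      (\<not> (\<exists>!y. Q (\<lambda>i. v (Suc i)) y) \<and> v 0 = 0))"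
    by (rule D_disj[OF D_conj[OF 1 assms] D_conj[OF D_not[OF 1] D_eq[OF DT_var DT_const]]])
  moreover have "((\<exists>!y. R y) \<and> R x \<or> \<not> (\<exists>!y. R y) \<and> x = 0) = (x = dthe R)" for R and x :: 'c
    unfolding dthe_def by (auto intro: the_equality[symmetric] theI')
  ultimately show ?thesis unfolding DT_def by simp
qed

definition glb :: "('a::linorder \<Rightarrow> bool) \<Rightarrow> 'a \<Rightarrow> bool" where
  "glb S s \<longleftrightarrow> (\<forall>x. S x \<longrightarrow> s \<le> x) \<and> (\<forall>u. (\<forall>x. S x \<longrightarrow> u \<le> x) \<longrightarrow> u \<le> s)"

definition dinf :: "('a::linordered_field \<Rightarrow> bool) \<Rightarrow> 'a" where
  "dinf S = dthe (glb S)"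

text \<open>Meant for sets bounded below by 0. If the infimum is missed, the set contains an
  interval just to its right. The lengths of such intervals, capped by 1 so that they have a
  supremum, enter with negative sign because only infima are available; half of the extremal length
  is added to the infimum.\<close>

definition choice_ge0 :: "('a::linordered_field \<Rightarrow> bool) \<Rightarrow> 'a" where
  "choice_ge0 S = (if S (dinf S) then dinf S
     else dinf S - dinf (\<lambda>d. -1 \<le> d \<and> d < 0 \<and> (\<forall>x. dinf S < x \<and> x < dinf S - d \<longrightarrow> S x)) / 2)"

text \<open>The value depends only on the set and not on a formula for it. Equal sets thus receive
  equal choices, which later yields representatives of congruence classes and unique codes of
  filters.\<close>

definition choice :: "('a::linordered_field \<Rightarrow> bool) \<Rightarrow> 'a" where
  "choice S = (if \<exists>x. S x \<and> 0 \<le> x then choice_ge0 (\<lambda>x. S x \<and> 0 \<le> x)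
     else - choice_ge0 (\<lambda>x. S (- x) \<and> 0 \<le> x))"

lemma DT_dinf:
  assumes "D M (\<lambda>v. P (\<lambda>i. v (Suc i)) (v 0))" shows "DT M (\<lambda>v. dinf (P v))"
proof -
  have 1: "D M (\<lambda>v. P (\<lambda>i. v (Suc (Suc i))) (v 0))"
    using D_ren[OF assms, of "case_nat 0 (\<lambda>i. Suc (Suc i))"] by simp
  have 2: "D M (\<lambda>v. P (\<lambda>i. v (Suc (Suc (Suc i)))) (v 0))"
    using D_ren[OF assms, of "case_nat 0 (\<lambda>i. Suc (Suc (Suc i)))"] by simp
  show ?thesis unfolding dinf_def glb_def by (rule DT_dthe) (intro dintros 1 2)
qed

lemma DT_choice_ge0:
  assumes "D M (\<lambda>v. P (\<lambda>i. v (Suc i)) (v 0))" shows "DT M (\<lambda>v. choice_ge0 (P v))"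
proof -
  have i: "DT M (\<lambda>v. dinf (P v))" by (rule DT_dinf[OF assms])
  have 1: "DT M (\<lambda>v. dinf (P (\<lambda>i. v (Suc i))))"  by (rule DT_ren[OF i])
  have 2: "DT M (\<lambda>v. dinf (P (\<lambda>i. v (Suc (Suc i)))))" by (rule DT_ren[OF i])
  have 3: "D M (\<lambda>v. P (\<lambda>i. v (Suc (Suc i))) (v 0))"
    using D_ren[OF assms, of "case_nat 0 (\<lambda>i. Suc (Suc i))"] by simp
  have 4: "D M (\<lambda>v. P v (dinf (P v)))" by (rule D_app[OF i assms])
  show ?thesis unfolding choice_ge0_def
    by (intro DT_if DT_dinf dintros i 1 2 3 4)
qed

lemma DT_choice:
  assumes "D M (\<lambda>v. P (\<lambda>i. v (Suc i)) (v 0))" shows "DT M (\<lambda>v. choice (P v))"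
proof -
  have "D M (\<lambda>v. P (\<lambda>i. v (Suc i)) (- v 0))"
    by (rule D_app[of M "\<lambda>v. - v 0" "\<lambda>a v. P (\<lambda>i. v (Suc i)) a"])
      (use D_ren[OF assms, of "case_nat 0 (\<lambda>i. Suc (Suc i))"] in \<open>auto intro: dintros\<close>)
  then show ?thesis unfolding choice_def
    by (intro DT_if DT_choice_ge0 dintros assms)
qed

lemmas dints = DT_dthe DT_dinf DT_choice dintros

section \<open>Definable sets and functions in one variable\<close>

lemma point_or_interval_right:
  fixes c :: "'a::linordered_field"
  assumes "point_or_interval I"
  shows "(\<exists>d>c. \<forall>x. c < x \<and> x < d \<longrightarrow> x \<in> I) \<or> (\<exists>d>c. \<forall>x. c < x \<and> x < d \<longrightarrow> x \<notin> I)"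
    (is "?in I \<or> ?out I")
proof -
  have pos: "\<exists>d>c. d \<le> a" if "c < a" for a using that by blast
  have one: "\<exists>d. c < d" by (rule gt_ex)
  have L: "?in {a<..} \<or> ?out {a<..}" for a
    using one pos[of a] by (cases "c < a") (auto simp: not_less intro: order.strict_trans1)
  have R: "?in {..<b} \<or> ?out {..<b}" for b
    using one pos[of b] by (cases "c < b") (auto simp: not_less intro: order.strict_trans)
  have int: "?in (A \<inter> B) \<or> ?out (A \<inter> B)" if "?in A \<or> ?out A" "?in B \<or> ?out B" for A B
  proof -
    have "?in (A \<inter> B)" if "?in A" "?in B"
    proof -
      from that obtain d d' where "d > c" "\<forall>x. c < x \<and> x < d \<longrightarrow> x \<in> A" "d' > c" "\<forall>x. c < x \<and> x < d' \<longrightarrow> x \<in> B"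
        by blast
      then show ?thesis by (intro exI[of _ "min d d'"]) auto
    qed
    then show ?thesis using that by blast
  qed
  have pt: "?out {a}" for a
    using one pos[of a] by (cases "c < a") auto
  have eq: "{a<..<b} = {a<..} \<inter> {..<b}" for a b :: 'a by auto
  show ?thesis
    using assms unfolding point_or_interval_def
    apply (elim disjE exE)
    subgoal using pt by blast
    subgoal for a b using int[OF L[of a] R[of b]] unfolding eq by blast
    subgoal using L by blast
    subgoal using R by blast
    subgoal using one by auto
    done
qed

lemma point_or_interval_glb:
  fixes I :: "'a::linordered_field set"
  assumes "point_or_interval I" "I \<noteq> {}" "\<forall>x\<in>I. l \<le> x"
  shows "\<exists>s. glb (\<lambda>x. x \<in> I) s"
proof -
  have below: False if "\<And>x. x < b \<Longrightarrow> l \<le> x" for b :: 'a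
  proof -
    obtain x where "x < min b l" using lt_ex by blast
    then show False using that[of x] by auto
  qed
  have inter: "glb (\<lambda>x. x \<in> J) a" if "\<And>x. x \<in> J \<Longrightarrow> a < x" "\<And>x. a < x \<Longrightarrow> x < b \<Longrightarrow> x \<in> J" "a < b" for J and a b :: 'a
    unfolding glb_def
  proof (intro conjI allI impI)
    fix u assume u: "\<forall>x. x \<in> J \<longrightarrow> u \<le> x"
    show "u \<le> a"
    proof (rule ccontr)
      assume "\<not> u \<le> a"
      then obtain x where "a < x" "x < min u b" using dense[of a "min u b"] \<open>a < b\<close> by auto
      then show False using u that(2)[of x] by auto
    qed
  qed (use that(1) in \<open>auto intro: less_imp_le\<close>)
  from assms(1) consider a where "I = {a}" | a b where "I = {a<..<b}" | a where "I = {a<..}" | b where "I = {..<b}" | "I = UNIV"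
    unfolding point_or_interval_def by blast
  then show ?thesis
  proof cases
    case 1 then show ?thesis by (auto simp: glb_def)
  next
    case (2 a b) then show ?thesis using inter[of I a b] assms(2) by (cases "a < b") auto
  next
    case (3 a) then show ?thesis using inter[of I a "a + 1"] by auto
  next
    case (4 b) then show ?thesis using below[of b] assms(3) by auto
  next
    case 5 then show ?thesis using below[of 0] assms(3) by auto
  qed
qed

lemma point_or_interval_infinite:
  fixes I :: "'a::linordered_field set"
  assumes "point_or_interval I" "infinite I"
  shows "\<exists>a b. a < b \<and> {a<..<b} \<subseteq> I"
proof -
  have lu: "\<exists>x. b < x" "\<exists>x. x < b" for b :: 'a by (rule gt_ex, rule lt_ex)
  from assms(1) consider a where "I = {a}" | a b where "I = {a<..<b}" | a where "I = {a<..}" | b where "I = {..<b}" | "I = UNIV"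
    unfolding point_or_interval_def by blast
  then show ?thesis
  proof cases
    case 1 then show ?thesis using assms(2) by auto
  next
    case (2 a b) 
    then have "a < b" using assms(2) by (cases "a < b") auto
    then show ?thesis using 2 by blast
  next
    case (3 a)
    obtain x where "a < x" using lu(1)[of a] by blast
    with 3 show ?thesis by (intro exI[of _ a] exI[of _ x]) auto
  next
    case (4 b)
    obtain x where "x < b" using lu(2)[of b] by blast
    with 4 show ?thesis by (intro exI[of _ x] exI[of _ b]) auto
  next
    case 5 then show ?thesis using lu(1)[of 0] by auto
  qed
qed

lemma infinite_interval_cases:
  fixes a b :: "'a::linordered_field"
  assumes "a < b" "\<And>x. a < x \<Longrightarrow> x < b \<Longrightarrow> P x \<or> Q x"
  shows "infinite {x. a < x \<and> x < b \<and> P x} \<or> infinite {x. a < x \<and> x < b \<and> Q x}"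
proof (rule ccontr)
  assume "\<not> ?thesis"
  then have "finite ({x. a < x \<and> x < b \<and> P x} \<union> {x. a < x \<and> x < b \<and> Q x})" by simp
  moreover have "{a<..<b} \<subseteq> {x. a < x \<and> x < b \<and> P x} \<union> {x. a < x \<and> x < b \<and> Q x}"
  proof
    fix x assume "x \<in> {a<..<b}"
    then show "x \<in> {x. a < x \<and> x < b \<and> P x} \<union> {x. a < x \<and> x < b \<and> Q x}" using assms(2)[of x] by simp
  qed
  ultimately show False using infinite_Ioo[OF \<open>a < b\<close>] finite_subset by blast
qed

locale ominimal =
  fixes M :: "('f, 'r, 'a::linordered_field) expansion"
  assumes omin: "o_minimal M"
begin

lemma pieces:
  assumes "def1 M S"
  shows "\<exists>\<I>. finite \<I> \<and> (\<forall>I\<in>\<I>. point_or_interval I) \<and> {x. S x} = \<Union>\<I>"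
proof -
  have "definable M 1 {[a] | a. S a}"
    unfolding definable_iff_defl defl_def
    using assms by (auto simp: def1_def)
  then have "\<exists>\<I>. finite \<I> \<and> (\<forall>I\<in>\<I>. point_or_interval I) \<and> {a. [a] \<in> {[a] | a. S a}} = \<Union>\<I>"
    using omin unfolding o_minimal_def by blast
  moreover have "{a. [a] \<in> {[a] | a. S a}} = {x. S x}" by auto
  ultimately show ?thesis by simp
qed

lemma germ_right:
  assumes "def1 M S"
  shows "(\<exists>d>c. \<forall>x. c < x \<and> x < d \<longrightarrow> S x) \<or> (\<exists>d>c. \<forall>x. c < x \<and> x < d \<longrightarrow> \<not> S x)"
proof -
  obtain \<I> where \<I>: "finite \<I>" "\<forall>I\<in>\<I>. point_or_interval I" "{x. S x} = \<Union>\<I>" using pieces[OF assms] by blast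
  have "(\<exists>d>c. \<forall>x. c < x \<and> x < d \<longrightarrow> x \<in> \<Union>\<I>) \<or> (\<exists>d>c. \<forall>x. c < x \<and> x < d \<longrightarrow> x \<notin> \<Union>\<I>)"
    using \<I>(1,2)
  proof (induction \<I> rule: finite_induct)
    case empty
    then show ?case using gt_ex[of c] by auto
  next
    case (insert I \<I>)
    have I: "(\<exists>d>c. \<forall>x. c < x \<and> x < d \<longrightarrow> x \<in> I) \<or> (\<exists>d>c. \<forall>x. c < x \<and> x < d \<longrightarrow> x \<notin> I)"
      using insert.prems by (intro point_or_interval_right) auto
    have IH: "(\<exists>d>c. \<forall>x. c < x \<and> x < d \<longrightarrow> x \<in> \<Union>\<I>) \<or> (\<exists>d>c. \<forall>x. c < x \<and> x < d \<longrightarrow> x \<notin> \<Union>\<I>)"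
      using insert by auto
    show ?case
    proof (cases "(\<exists>d>c. \<forall>x. c < x \<and> x < d \<longrightarrow> x \<in> I) \<or> (\<exists>d>c. \<forall>x. c < x \<and> x < d \<longrightarrow> x \<in> \<Union>\<I>)")
      case True
      then show ?thesis by (metis Union_iff insertCI)
    next
      case False
      then obtain d d' where "d > c" "\<forall>x. c < x \<and> x < d \<longrightarrow> x \<notin> I" "d' > c" "\<forall>x. c < x \<and> x < d' \<longrightarrow> x \<notin> \<Union>\<I>"
        using I IH by blast
      then have "\<exists>d>c. \<forall>x. c < x \<and> x < d \<longrightarrow> x \<notin> \<Union>(insert I \<I>)"
        by (intro exI[of _ "min d d'"]) auto
      then show ?thesis by blast
    qed
  qed
  then show ?thesis unfolding \<I>(3)[symmetric] by simp
qed

lemma germ_left: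
  assumes "def1 M S"
  shows "(\<exists>d<c. \<forall>x. d < x \<and> x < c \<longrightarrow> S x) \<or> (\<exists>d<c. \<forall>x. d < x \<and> x < c \<longrightarrow> \<not> S x)"
proof -
  have "def1 M (\<lambda>x. S (- x))" unfolding def1_def by (intro def1D[OF assms] dintros)
  from germ_right[OF this, of "- c"] show ?thesis
  proof (elim disjE exE conjE)
    fix d assume "d > - c" "\<forall>x. - c < x \<and> x < d \<longrightarrow> S (- x)"
    then have "- d < c \<and> (\<forall>x. - d < x \<and> x < c \<longrightarrow> S x)"
      by (metis minus_less_iff neg_less_iff_less minus_minus)
    then show ?thesis by blast
  next
    fix d assume "d > - c" "\<forall>x. - c < x \<and> x < d \<longrightarrow> \<not> S (- x)"
    then have "- d < c \<and> (\<forall>x. - d < x \<and> x < c \<longrightarrow> \<not> S x)"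
      by (metis minus_less_iff neg_less_iff_less minus_minus)
    then show ?thesis by blast
  qed
qed

lemma infinite_contains_interval:
  assumes "def1 M S" "infinite {x. S x}"
  obtains a b where "a < b" "\<And>x. a < x \<Longrightarrow> x < b \<Longrightarrow> S x"
proof -
  obtain \<I> where \<I>: "finite \<I>" "\<forall>I\<in>\<I>. point_or_interval I" "{x. S x} = \<Union>\<I>" using pieces[OF assms(1)] by blast
  then obtain I where "I \<in> \<I>" "infinite I" using assms(2) finite_Union[of \<I>] by auto
  with \<I> obtain a b where "a < b" "{a<..<b} \<subseteq> I" using point_or_interval_infinite by blast
  moreover have "S x" if "x \<in> I" for x using \<I>(3) \<open>I \<in> \<I>\<close> that by blast
  ultimately show ?thesis by (intro that[of a b]) auto
qed

text \<open>Definable completeness: the field itself may lack infima, but the finitely many points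
  and intervals that make up a nonempty definable set bounded below each have one, and the least of
  these serves.\<close>

lemma glb_ex:
  assumes "def1 M S" "S x" "\<And>x. S x \<Longrightarrow> l \<le> x"
  shows "\<exists>s. glb S s"
proof -
  obtain \<I> where \<I>: "finite \<I>" "\<forall>I\<in>\<I>. point_or_interval I" "{x. S x} = \<Union>\<I>" using pieces[OF assms(1)] by blast
  have "\<Union>\<I> \<noteq> {} \<longrightarrow> (\<forall>x\<in>\<Union>\<I>. l \<le> x) \<longrightarrow> (\<exists>s. glb (\<lambda>x. x \<in> \<Union>\<I>) s)"
    using \<I>(1,2)
  proof (induction \<I> rule: finite_induct)
    case (insert I \<I>)
    show ?case
    proof (intro impI)
      assume ne: "\<Union>(insert I \<I>) \<noteq> {}" and bd: "\<forall>x\<in>\<Union>(insert I \<I>). l \<le> x"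
      show "\<exists>s. glb (\<lambda>x. x \<in> \<Union>(insert I \<I>)) s"
      proof (cases "I = {} \<or> \<Union>\<I> = {}")
        case True
        then have "(\<Union>(insert I \<I>) = I \<and> I \<noteq> {}) \<or> (\<Union>(insert I \<I>) = \<Union>\<I> \<and> \<Union>\<I> \<noteq> {})"
          using ne by auto
        then show ?thesis
        proof (elim disjE conjE)
          assume "\<Union>(insert I \<I>) = I" "I \<noteq> {}"
          then show ?thesis using point_or_interval_glb[of I l] insert.prems bd by simp
        next
          assume "\<Union>(insert I \<I>) = \<Union>\<I>" "\<Union>\<I> \<noteq> {}"
          then show ?thesis using insert.IH insert.prems bd by simp
        qed
      next
        case False
        then obtain s where s: "glb (\<lambda>x. x \<in> I) s" using point_or_interval_glb[of I l] insert.prems bd by auto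
        from False obtain t where t: "glb (\<lambda>x. x \<in> \<Union>\<I>) t" using insert.IH insert.prems bd by auto
        have "glb (\<lambda>x. x \<in> \<Union>(insert I \<I>)) (min s t)"
          using s t unfolding glb_def by (auto simp: min_le_iff_disj)
        then show ?thesis by blast
      qed
    qed
  qed auto
  moreover have "\<Union>\<I> \<noteq> {}" "\<forall>x\<in>\<Union>\<I>. l \<le> x"
    using assms(2,3) unfolding \<I>(3)[symmetric] by auto
  ultimately have "\<exists>s. glb (\<lambda>x. x \<in> \<Union>\<I>) s" by blast
  then show ?thesis unfolding \<I>(3)[symmetric] by simp
qed

lemma glb_dinf: "glb S s \<Longrightarrow> glb S (dinf S)"
  unfolding dinf_def
  by (rule back_subst[of "glb S" s], assumption, rule dthe_eq[symmetric]) (auto simp: glb_def intro!: antisym)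

lemma dinf_props:
  assumes "def1 M S" "S x" "\<And>x. S x \<Longrightarrow> l \<le> x"
  shows "S y \<Longrightarrow> dinf S \<le> y" "dinf S < u \<Longrightarrow> \<exists>z<u. S z"
proof -
  have "glb S (dinf S)" using glb_ex[OF assms] glb_dinf by blast
  then show "S y \<Longrightarrow> dinf S \<le> y" "dinf S < u \<Longrightarrow> \<exists>z<u. S z"
    unfolding glb_def by (auto simp: not_le dest!: spec[of _ u])
qed

lemma choice_ge0_works:
  assumes S: "def1 M S" and x: "S x" and ge: "\<And>x. S x \<Longrightarrow> 0 \<le> x"
  shows "S (choice_ge0 S)"
proof (cases "S (dinf S)")
  case True
  then show ?thesis by (simp add: choice_ge0_def)
next
  case False
  define s where "s = dinf S"
  define T where "T d \<longleftrightarrow> -1 \<le> d \<and> d < 0 \<and> (\<forall>x. s < x \<and> x < s - d \<longrightarrow> S x)" for d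
  have s: "S y \<Longrightarrow> s \<le> y" "s < u \<Longrightarrow> \<exists>z<u. S z" for y u
    using dinf_props[of S, OF assms(1,2)] ge unfolding s_def by blast+
  have "\<exists>d>s. \<forall>x. s < x \<and> x < d \<longrightarrow> S x"
  proof (rule ccontr)
    assume "\<not> ?thesis"
    then obtain d where d: "d > s" "\<forall>x. s < x \<and> x < d \<longrightarrow> \<not> S x" using germ_right[OF S, of s] by blast
    then obtain z where "z < d" "S z" using s(2) by blast
    then show False using s(1)[of z] False d unfolding s_def by (metis order_le_less)
  qed
  then obtain d where d: "d > s" "\<forall>x. s < x \<and> x < d \<longrightarrow> S x" by blast
  have T0: "T (- min 1 (d - s))" using d by (auto simp: T_def)
  have defT: "def1 M T" unfolding T_def def1_def by (intro dintros def1D[OF S])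
  have Tlow: "-1 \<le> d" if "T d" for d using that by (simp add: T_def)
  have T: "T y \<Longrightarrow> dinf T \<le> y" "dinf T < u \<Longrightarrow> \<exists>z<u. T z" for y u
    using dinf_props[of T, OF defT T0] Tlow by blast+
  have "dinf T < 0" using T(1)[OF T0] d by (auto simp: min_def split: if_splits)
  \<comment> \<open>\<open>dinf T\<close> is negative, so halving increases it; some admissible
    \<open>e\<close> lies below the half, and its interval reaches beyond the chosen point.\<close>
  then have "dinf T < dinf T / 2" by (simp add: field_simps)
  then obtain e where e: "e < dinf T / 2" "T e" using T(2) by blast
  have "S (s - dinf T / 2)" using e \<open>dinf T < 0\<close> unfolding T_def by auto
  moreover have "choice_ge0 S = s - dinf T / 2"
    using False unfolding choice_ge0_def s_def[symmetric] T_def by simp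
  ultimately show ?thesis by simp
qed

lemma choice_works:
  assumes S: "def1 M S" and x: "S x"
  shows "S (choice S)"
proof (cases "\<exists>x. S x \<and> 0 \<le> x")
  case True
  have "def1 M (\<lambda>x. S x \<and> 0 \<le> x)" unfolding def1_def by (intro dintros def1D[OF S])
  then have "S (choice_ge0 (\<lambda>x. S x \<and> 0 \<le> x))" using choice_ge0_works[of "\<lambda>x. S x \<and> 0 \<le> x"] True by blast
  then show ?thesis using True by (simp add: choice_def)
next
  case False
  have "def1 M (\<lambda>x. S (- x) \<and> 0 \<le> x)" unfolding def1_def by (intro dintros def1D[OF S])
  moreover have "S (- (- x)) \<and> 0 \<le> - x" using False x by (metis minus_minus neg_0_le_iff_le linear)
  ultimately have "S (- choice_ge0 (\<lambda>x. S (- x) \<and> 0 \<le> x))"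
    using choice_ge0_works[of "\<lambda>x. S (- x) \<and> 0 \<le> x" "- x"] by blast
  then show ?thesis using False unfolding choice_def by (simp only: if_False)
qed

lemma infinite_sub:
  assumes "def1 M S" "infinite {x. a < x \<and> x < b \<and> S x}"
  obtains a' b' where "a \<le> a'" "a' < b'" "b' \<le> b" "\<And>x. a' < x \<Longrightarrow> x < b' \<Longrightarrow> S x"
proof -
  have "def1 M (\<lambda>x. a < x \<and> x < b \<and> S x)" unfolding def1_def by (intro dintros def1D[OF assms(1)])
  from infinite_contains_interval[OF this assms(2)]
  obtain a' b' where *: "a' < b'" "\<And>x. a' < x \<Longrightarrow> x < b' \<Longrightarrow> a < x \<and> x < b \<and> S x" by metis
  show ?thesis
  proof (rule that[OF _ *(1)])
    show "a \<le> a'"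
    proof (rule dense_ge_bounded[OF *(1)])
      fix w assume "a' < w" "w < b'" then show "a \<le> w" using *(2)[of w] by simp
    qed
    show "b' \<le> b"
    proof (rule dense_le_bounded[OF *(1)])
      fix w assume "a' < w" "w < b'" then show "w \<le> b" using *(2)[of w] by simp
    qed
  qed (use *(2) in blast)
qed

text \<open>Turns infinitude into a first-order condition, so that it may occur inside definable
  predicates.\<close>

lemma infinite_iff_interval:
  assumes "def1 M S"
  shows "infinite {x. S x} \<longleftrightarrow> (\<exists>a b. a < b \<and> (\<forall>x. a < x \<and> x < b \<longrightarrow> S x))"
proof
  assume "infinite {x. S x}"
  then show "\<exists>a b. a < b \<and> (\<forall>x. a < x \<and> x < b \<longrightarrow> S x)"
    using infinite_contains_interval[OF assms] by metis
next
  assume "\<exists>a b. a < b \<and> (\<forall>x. a < x \<and> x < b \<longrightarrow> S x)"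
  then obtain a b where "a < b" "\<forall>x. a < x \<and> x < b \<longrightarrow> S x" by blast
  then have ab: "a < b" "{a<..<b} \<subseteq> {x. S x}" by auto
  then show "infinite {x. S x}" using infinite_Ioo[OF ab(1)] finite_subset by blast
qed

text \<open>If no \<open>e\<close> works, then the fibres of \<open>\<delta>\<close> are finite, so its image contains an interval; but
  then the set where \<open>\<delta>\<close> exceeds the midpoint of that interval is infinite.\<close>

lemma positive_bounded_below:
  assumes \<delta>: "dfn1 M \<delta>" and "a < b" and pos: "\<And>x. a < x \<Longrightarrow> x < b \<Longrightarrow> 0 < \<delta> x"
  obtains e a' b' where "0 < e" "a \<le> a'" "a' < b'" "b' \<le> b" "\<And>x. a' < x \<Longrightarrow> x < b' \<Longrightarrow> e < \<delta> x"
proof (cases "\<exists>e>0. infinite {x. a < x \<and> x < b \<and> e < \<delta> x}")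
  case True
  then obtain e where e: "e > 0" "infinite {x. a < x \<and> x < b \<and> e < \<delta> x}" by blast
  have "def1 M (\<lambda>x. e < \<delta> x)" unfolding def1_def by (intro dintros dfn1D[OF \<delta>])
  from infinite_sub[OF this e(2)] e(1) that show ?thesis by metis
next
  case False
  let ?J = "{a<..<b}"
  have fib: "finite {x \<in> ?J. \<delta> x = v}" for v
  proof (cases "v > 0")
    case True
    then have "0 < v / 2" by simp
    then have "finite {x. a < x \<and> x < b \<and> v / 2 < \<delta> x}" using False by blast
    then show ?thesis by (rule rev_finite_subset) (use True in auto)
  next
    case f: False
    have "{x \<in> ?J. \<delta> x = v} = {}" using f pos by force
    then show ?thesis by (simp only: finite.emptyI)
  qed
  have inf: "infinite (\<delta> ` ?J)"
  proof
    assume "finite (\<delta> ` ?J)"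
    then have "finite (\<Union>v\<in>\<delta> ` ?J. {x \<in> ?J. \<delta> x = v})" using fib by blast
    moreover have "?J \<subseteq> (\<Union>v\<in>\<delta> ` ?J. {x \<in> ?J. \<delta> x = v})" by blast
    ultimately show False using infinite_Ioo[OF \<open>a < b\<close>] finite_subset by blast
  qed
  have im: "\<delta> ` ?J = {y. \<exists>x. a < x \<and> x < b \<and> y = \<delta> x}" by auto
  have "def1 M (\<lambda>y. \<exists>x. a < x \<and> x < b \<and> y = \<delta> x)" unfolding def1_def by (intro dintros dfn1D[OF \<delta>])
  from iffD1[OF infinite_iff_interval[OF this] inf[unfolded im]]
  obtain e1 e2 where e: "e1 < e2" "\<And>y. e1 < y \<Longrightarrow> y < e2 \<Longrightarrow> \<exists>x. a < x \<and> x < b \<and> y = \<delta> x"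
    by blast
  have "e1 \<ge> 0"
  proof (rule dense_ge_bounded[OF e(1)])
    fix w assume "e1 < w" "w < e2" then show "0 \<le> w" using e(2)[of w] pos by (metis less_imp_le)
  qed
  obtain m where m: "e1 < m" "m < e2" using dense[OF e(1)] by blast
  have "{m<..<e2} \<subseteq> \<delta> ` {x. a < x \<and> x < b \<and> m < \<delta> x}"
  proof
    fix y assume "y \<in> {m<..<e2}"
    then show "y \<in> \<delta> ` {x. a < x \<and> x < b \<and> m < \<delta> x}" using e(2)[of y] m by auto
  qed
  then have "infinite {x. a < x \<and> x < b \<and> m < \<delta> x}" using infinite_Ioo[OF m(2)] finite_surj by blast
  then show ?thesis using False m \<open>e1 \<ge> 0\<close> by auto
qed

section \<open>Continuity in one variable\<close>

definition cont :: "('a \<Rightarrow> 'a) \<Rightarrow> 'a \<Rightarrow> bool" where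
  "cont f x \<longleftrightarrow> (\<forall>e>0. \<exists>d>0. \<forall>y. \<bar>y - x\<bar> < d \<longrightarrow> \<bar>f y - f x\<bar> < e)"

lemma D_cont:
  assumes "dfn1 M f" shows "def1 M (cont f)"
  unfolding def1_def cont_def by (intro dints dfn1D[OF assms])

text \<open>The lengths of the neighbourhoods can be chosen definably and then exceed some
  \<open>e\<close> on a subinterval. In a piece of length at most \<open>e\<close> every y to the
  right of x lies within the reach of x.\<close>

lemma germ_right_uniform:
  assumes Q: "def2 M Q" and "a < b"
    and "\<And>x. a < x \<Longrightarrow> x < b \<Longrightarrow> \<exists>d>x. \<forall>y. x < y \<and> y < d \<longrightarrow> Q x y"
  obtains a' b' where "a \<le> a'" "a' < b'" "b' \<le> b" "\<And>x y. a' < x \<Longrightarrow> x < y \<Longrightarrow> y < b' \<Longrightarrow> Q x y"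
proof -
  define \<delta> where "\<delta> x = choice (\<lambda>d. 0 < d \<and> (\<forall>y. x < y \<and> y < x + d \<longrightarrow> Q x y))" for x
  have d: "dfn1 M \<delta>" unfolding dfn1_def \<delta>_def by (intro dints def2D[OF Q])
  have \<delta>: "0 < \<delta> x \<and> (\<forall>y. x < y \<and> y < x + \<delta> x \<longrightarrow> Q x y)" if x: "a < x" "x < b" for x
  proof -
    obtain d where "d > x" "\<forall>y. x < y \<and> y < d \<longrightarrow> Q x y" using assms(3)[OF x] by blast
    then have "0 < d - x \<and> (\<forall>y. x < y \<and> y < x + (d - x) \<longrightarrow> Q x y)" by simp
    moreover have "def1 M (\<lambda>d. 0 < d \<and> (\<forall>y. x < y \<and> y < x + d \<longrightarrow> Q x y))"
      unfolding def1_def by (intro dints def2D[OF Q])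
    ultimately show ?thesis unfolding \<delta>_def
      using choice_works[of "\<lambda>d. 0 < d \<and> (\<forall>y. x < y \<and> y < x + d \<longrightarrow> Q x y)"] by blast
  qed
  from positive_bounded_below[OF d \<open>a < b\<close>] \<delta>
  obtain e a' b' where e: "0 < e" "a \<le> a'" "a' < b'" "b' \<le> b" "\<And>x. a' < x \<Longrightarrow> x < b' \<Longrightarrow> e < \<delta> x" by metis
  show ?thesis
  proof (rule that[of a' "min b' (a' + e)"])
    fix x y assume "a' < x" "x < y" "y < min b' (a' + e)"
    then have "x < b'" "a < x" "x < b" "y < x + \<delta> x" using e(1-4) e(5)[of x] by auto
    then show "Q x y" using \<delta>[of x] \<open>x < y\<close> by auto
  qed (use e in auto)
qed

lemma germ_left_uniform:
  assumes Q: "def2 M Q" and "a < b"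
    and "\<And>x. a < x \<Longrightarrow> x < b \<Longrightarrow> \<exists>d<x. \<forall>y. d < y \<and> y < x \<longrightarrow> Q x y"
  obtains a' b' where "a \<le> a'" "a' < b'" "b' \<le> b" "\<And>x y. a' < y \<Longrightarrow> y < x \<Longrightarrow> x < b' \<Longrightarrow> Q x y"
proof -
  have Q': "def2 M (\<lambda>x y. Q (- x) (- y))" unfolding def2_def by (intro dints def2D[OF Q])
  have "\<exists>d>x. \<forall>y. x < y \<and> y < d \<longrightarrow> Q (- x) (- y)" if x: "- b < x" "x < - a" for x
  proof -
    obtain d where "d < - x" "\<forall>y. d < y \<and> y < - x \<longrightarrow> Q (- x) y" using assms(3)[of "- x"] x by auto
    then show ?thesis by (intro exI[of _ "- d"]) auto
  qed
  from germ_right_uniform[OF Q' _ this] \<open>a < b\<close> obtain a' b' where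
    *: "- b \<le> a'" "a' < b'" "b' \<le> - a" "\<And>x y. a' < x \<Longrightarrow> x < y \<Longrightarrow> y < b' \<Longrightarrow> Q (- x) (- y)"
    by (metis neg_less_iff_less)
  show ?thesis
  proof (rule that[of "- b'" "- a'"])
    fix x y assume "- b' < y" "y < x" "x < - a'"
    then show "Q x y" using *(4)[of "- x" "- y"] by auto
  qed (use * in auto)
qed

text \<open>Separated values make f injective, so its image is infinite and contains an interval,
  which has two points closer than \<open>e\<close>.\<close>

lemma no_discrete_image:
  assumes f: "dfn1 M f" and "a < b" "0 < e"
    and "\<And>x y. a < x \<Longrightarrow> x < y \<Longrightarrow> y < b \<Longrightarrow> e \<le> \<bar>f x - f y\<bar>"
  shows False
proof -
  have sep: "e \<le> \<bar>f x - f y\<bar>" if "a < x" "x < b" "a < y" "y < b" "x \<noteq> y" for x y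
    using assms(4)[of x y] assms(4)[of y x] that by (auto simp: abs_minus_commute neq_iff)
  have "inj_on f {a<..<b}" using sep \<open>0 < e\<close> by (intro inj_onI) (metis abs_zero cancel_comm_monoid_add_class.diff_cancel greaterThanLessThan_iff not_less)
  then have inf: "infinite (f ` {a<..<b})" using infinite_Ioo[OF \<open>a < b\<close>] finite_imageD by blast
  have im: "f ` {a<..<b} = {y. \<exists>x. a < x \<and> x < b \<and> y = f x}" by auto
  have "def1 M (\<lambda>y. \<exists>x. a < x \<and> x < b \<and> y = f x)" unfolding def1_def by (intro dints dfn1D[OF f])
  from iffD1[OF infinite_iff_interval[OF this] inf[unfolded im]]
  obtain u w where uw: "u < w" "\<And>y. u < y \<Longrightarrow> y < w \<Longrightarrow> \<exists>x. a < x \<and> x < b \<and> y = f x"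
    by blast
  define h where "h = min w (u + e)"
  have "u < h" using uw \<open>0 < e\<close> by (simp add: h_def)
  then obtain y1 where y1: "u < y1" "y1 < h" using dense by blast
  obtain y2 where y2: "y1 < y2" "y2 < h" using dense y1 by blast
  obtain x1 where x1: "a < x1" "x1 < b" "y1 = f x1" using uw(2)[of y1] y1 h_def by auto
  obtain x2 where x2: "a < x2" "x2 < b" "y2 = f x2" using uw(2)[of y2] y1 y2 h_def by auto
  have "e \<le> \<bar>y1 - y2\<bar>" using sep[of x1 x2] x1 x2 y2 by auto
  then show False using y1 y2 by (auto simp: h_def)
qed

text \<open>If \<open>f\<close> is discontinuous everywhere, then on some interval its values at any two points differ
  by at least a fixed \<open>e\<close>, although its image contains an interval.\<close>

lemma continuous_somewhere:
  assumes f: "dfn1 M f" and "a < b"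
  obtains a' b' where "a \<le> a'" "a' < b'" "b' \<le> b" "\<And>x. a' < x \<Longrightarrow> x < b' \<Longrightarrow> cont f x"
proof (cases "infinite {x. a < x \<and> x < b \<and> cont f x}")
  case True
  from infinite_sub[OF D_cont[OF f] this] that show ?thesis by blast
next
  case False
  have nc: "def1 M (\<lambda>x. \<not> cont f x)" unfolding def1_def by (intro dints def1D[OF D_cont[OF f]])
  have "infinite {x. a < x \<and> x < b \<and> \<not> cont f x}"
    using False infinite_interval_cases[OF \<open>a < b\<close>, of "cont f" "\<lambda>x. \<not> cont f x"] by blast
  from infinite_sub[OF nc this] obtain a1 b1 where 1: "a1 < b1" "\<And>x. a1 < x \<Longrightarrow> x < b1 \<Longrightarrow> \<not> cont f x" by metis
  define P where "P x e \<longleftrightarrow> 0 < e \<and> (\<forall>d>0. \<exists>y. \<bar>y - x\<bar> < d \<and> e \<le> \<bar>f y - f x\<bar>)" for x e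
  define \<epsilon> where "\<epsilon> x = choice (P x)" for x
  have d: "dfn1 M \<epsilon>" unfolding dfn1_def \<epsilon>_def P_def by (intro dints dfn1D[OF f])
  have P: "P x (\<epsilon> x)" if "a1 < x" "x < b1" for x
  proof -
    have "\<exists>e. P x e" using 1(2)[OF that] unfolding cont_def P_def by (metis not_less)
    moreover have "def1 M (P x)" unfolding def1_def P_def by (intro dints dfn1D[OF f])
    ultimately show ?thesis unfolding \<epsilon>_def using choice_works[of "P x"] by blast
  qed
  have "0 < \<epsilon> x" if "a1 < x" "x < b1" for x using P[OF that] by (simp add: P_def)
  from positive_bounded_below[OF d 1(1) this]
  obtain e a2 b2 where 2: "0 < e" "a1 \<le> a2" "a2 < b2" "b2 \<le> b1" "\<And>x. a2 < x \<Longrightarrow> x < b2 \<Longrightarrow> e < \<epsilon> x" by metis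
  define Q where "Q x y \<longleftrightarrow> e \<le> \<bar>f x - f y\<bar>" for x y
  have Q: "def2 M Q" unfolding def2_def Q_def by (intro dints dfn1D[OF f])
  define R where "R x \<longleftrightarrow> (\<exists>d>x. \<forall>y. x < y \<and> y < d \<longrightarrow> Q x y)" for x
  define L where "L x \<longleftrightarrow> (\<exists>d<x. \<forall>y. d < y \<and> y < x \<longrightarrow> Q x y)" for x
  have dR: "def1 M R" and dL: "def1 M L" unfolding def1_def R_def L_def by (intro dints def2D[OF Q])+
  \<comment> \<open>O-minimality decides \<open>Q x\<close> on each side of x. If it failed on both
    sides, no point close to x could realise the jump of at least
    \<open>\<epsilon> x\<close>.\<close>
  have RL: "R x \<or> L x" if x: "a2 < x" "x < b2" for x
  proof (rule ccontr)
    assume n: "\<not> (R x \<or> L x)"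
    have Qx: "def1 M (Q x)" unfolding def1_def by (intro dints def2D[OF Q])
    obtain d1 where d1: "d1 > x" "\<forall>y. x < y \<and> y < d1 \<longrightarrow> \<not> Q x y"
      using germ_right[OF Qx, of x] n unfolding R_def by blast
    obtain d2 where d2: "d2 < x" "\<forall>y. d2 < y \<and> y < x \<longrightarrow> \<not> Q x y"
      using germ_left[OF Qx, of x] n unfolding L_def by blast
    have "P x (\<epsilon> x)" "e < \<epsilon> x" using P[of x] 2 x by auto
    moreover have "0 < min (d1 - x) (x - d2)" using d1 d2 by simp
    ultimately obtain y where y: "\<bar>y - x\<bar> < min (d1 - x) (x - d2)" "\<epsilon> x \<le> \<bar>f y - f x\<bar>"
      unfolding P_def by blast
    have "Q x y" using y(2) \<open>e < \<epsilon> x\<close> by (simp add: Q_def abs_minus_commute)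
    moreover have "y \<noteq> x" using y(2) \<open>e < \<epsilon> x\<close> \<open>0 < e\<close> by auto
    ultimately show False using d1 d2 y(1) by (auto simp: abs_less_iff neq_iff)
  qed
  from infinite_interval_cases[OF 2(3) RL]
 have False
  proof
    assume "infinite {x. a2 < x \<and> x < b2 \<and> R x}"
    from infinite_sub[OF dR this] obtain a3 b3 where "a3 < b3" "\<And>x. a3 < x \<Longrightarrow> x < b3 \<Longrightarrow> R x" by metis
    from germ_right_uniform[OF Q this[unfolded R_def]]
    obtain a4 b4 where "a4 < b4" "\<And>x y. a4 < x \<Longrightarrow> x < y \<Longrightarrow> y < b4 \<Longrightarrow> Q x y" by metis
    then show False using no_discrete_image[OF f _ 2(1)] unfolding Q_def by blast
  next
    assume "infinite {x. a2 < x \<and> x < b2 \<and> L x}"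
    from infinite_sub[OF dL this] obtain a3 b3 where "a3 < b3" "\<And>x. a3 < x \<Longrightarrow> x < b3 \<Longrightarrow> L x" by metis
    from germ_left_uniform[OF Q this[unfolded L_def]]
    obtain a4 b4 where "a4 < b4" "\<And>x y. a4 < y \<Longrightarrow> y < x \<Longrightarrow> x < b4 \<Longrightarrow> Q x y" by metis
    then show False using no_discrete_image[OF f _ 2(1)] unfolding Q_def by (metis abs_minus_commute)
  qed
  then show ?thesis ..
qed

end

section \<open>Definable sets and functions in two variables\<close>

lemma subinterval_bounds:
  fixes a b c d :: "'a::linordered_field"
  assumes "c < d" "\<And>y. c < y \<Longrightarrow> y < d \<Longrightarrow> a < y \<and> y < b"
  shows "a \<le> c" "d \<le> b"
  using dense_ge_bounded[OF assms(1), of a] dense_le_bounded[OF assms(1), of b] assms(2)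
  by (blast intro: less_imp_le)+

context ominimal
begin

lemma D_infinite:
  assumes "def2 M E" shows "def1 M (\<lambda>x. infinite {y. E x y})"
proof -
  have *: "def1 M (E x)" for x unfolding def1_def by (intro dints def2D[OF assms])
  show ?thesis unfolding infinite_iff_interval[OF *] unfolding def1_def by (intro dints def2D[OF assms])
qed

text \<open>The ends l x < r x of an interval in the fibre are chosen definably and are both
  continuous on some subinterval. Near a point m of it they move by less than a third of r m - l m,
  so the middle third lies in all nearby fibres.\<close>

lemma box_in_infinite_fibres:
  assumes E: "def2 M E" and "a < b" and inf: "\<And>x. a < x \<Longrightarrow> x < b \<Longrightarrow> infinite {y. E x y}"
  shows "\<exists>a' b' c d. a \<le> a' \<and> a' < b' \<and> b' \<le> b \<and> c < d \<and>
    (\<forall>x y. a' < x \<and> x < b' \<and> c < y \<and> y < d \<longrightarrow> E x y)"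
proof -
  define l where "l x = choice (\<lambda>l. \<exists>r>l. \<forall>y. l < y \<and> y < r \<longrightarrow> E x y)" for x
  define r where "r x = choice (\<lambda>r. l x < r \<and> (\<forall>y. l x < y \<and> y < r \<longrightarrow> E x y))" for x
  have dl: "dfn1 M l" unfolding dfn1_def l_def by (intro dints def2D[OF E])
  have dr: "dfn1 M r" unfolding dfn1_def r_def by (intro dints def2D[OF E] dfn1D[OF dl])
  have r: "l x < r x \<and> (\<forall>y. l x < y \<and> y < r x \<longrightarrow> E x y)" if x: "a < x" "x < b" for x
  proof -
    have "def1 M (E x)" unfolding def1_def by (intro dints def2D[OF E])
    from iffD1[OF infinite_iff_interval[OF this] inf[OF x]]
    have ex: "\<exists>l. \<exists>r>l. \<forall>y. l < y \<and> y < r \<longrightarrow> E x y" .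
    have "def1 M (\<lambda>l. \<exists>r>l. \<forall>y. l < y \<and> y < r \<longrightarrow> E x y)" unfolding def1_def by (intro dints def2D[OF E])
    from choice_works[OF this] ex have 1: "\<exists>r>l x. \<forall>y. l x < y \<and> y < r \<longrightarrow> E x y" unfolding l_def by blast
    have "def1 M (\<lambda>r. l x < r \<and> (\<forall>y. l x < y \<and> y < r \<longrightarrow> E x y))" unfolding def1_def by (intro dints def2D[OF E])
    from choice_works[OF this] 1 show ?thesis unfolding r_def by blast
  qed
  obtain a1 b1 where 1: "a \<le> a1" "a1 < b1" "b1 \<le> b" "\<And>x. a1 < x \<Longrightarrow> x < b1 \<Longrightarrow> cont l x"
    using continuous_somewhere[OF dl \<open>a < b\<close>] by metis
  obtain a2 b2 where 2: "a1 \<le> a2" "a2 < b2" "b2 \<le> b1" "\<And>x. a2 < x \<Longrightarrow> x < b2 \<Longrightarrow> cont r x"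
    using continuous_somewhere[OF dr 1(2)] by metis
  obtain m where m: "a2 < m" "m < b2" using dense[OF 2(2)] by blast
  define e where "e = (r m - l m) / 3"
  have "l m < r m" using r[of m] 1 2 m by auto
  then have e: "0 < e" by (simp add: e_def)
  obtain d1 where d1: "0 < d1" "\<And>y. \<bar>y - m\<bar> < d1 \<Longrightarrow> \<bar>l y - l m\<bar> < e"
    using 1(4)[of m] 2 m e unfolding cont_def by force
  obtain d2 where d2: "0 < d2" "\<And>y. \<bar>y - m\<bar> < d2 \<Longrightarrow> \<bar>r y - r m\<bar> < e"
    using 2(4)[of m] m e unfolding cont_def by force
  let ?a = "max a2 (m - min d1 d2)" and ?b = "min b2 (m + min d1 d2)"
  have Exy: "E x y" if "?a < x" "x < ?b" "l m + e < y" "y < r m - e" for x y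
  proof -
    have "\<bar>x - m\<bar> < d1" "\<bar>x - m\<bar> < d2" "a < x" "x < b" using that 1 2 by (auto simp: abs_less_iff)
    then have "l x < l m + e" "r m - e < r x" using d1(2)[of x] d2(2)[of x] by (auto simp: abs_less_iff)
    then show ?thesis using r[OF \<open>a < x\<close> \<open>x < b\<close>] that by auto
  qed
  show ?thesis
  proof (rule exI[of _ ?a], rule exI[of _ ?b], rule exI[of _ "l m + e"], rule exI[of _ "r m - e"], intro conjI allI impI)
    show "l m + e < r m - e" "?a < ?b" "a \<le> ?a" "?b \<le> b"
      using e 1 2 m d1 d2 by (auto simp: e_def field_simps)
  qed (use Exy in blast)
qed

lemma box_in_infinite_fibres_within:
  assumes E: "def2 M E" and "a < b" and inf: "\<And>x. a < x \<Longrightarrow> x < b \<Longrightarrow> infinite {y. c < y \<and> y < d \<and> E x y}"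
  shows "\<exists>a' b' c' d'. a \<le> a' \<and> a' < b' \<and> b' \<le> b \<and> c \<le> c' \<and> c' < d' \<and> d' \<le> d \<and>
    (\<forall>x y. a' < x \<and> x < b' \<and> c' < y \<and> y < d' \<longrightarrow> E x y)"
proof -
  have "def2 M (\<lambda>x y. c < y \<and> y < d \<and> E x y)" unfolding def2_def by (intro dints def2D[OF E])
  from box_in_infinite_fibres[OF this \<open>a < b\<close> inf]
  obtain a' b' c' d' where *: "a \<le> a'" "a' < b'" "b' \<le> b" "c' < d'"
    "\<And>x y. a' < x \<and> x < b' \<and> c' < y \<and> y < d' \<Longrightarrow> c < y \<and> y < d \<and> E x y" by blast
  obtain x where "a' < x" "x < b'" using dense[OF *(2)] by blast
  then have "c \<le> c'" "d' \<le> d" using subinterval_bounds[OF *(4), of c d] *(5)[of x] by blast+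
  with * show ?thesis by blast
qed

text \<open>The images of the vertical segments are infinite subsets of one line, so over some
  subinterval of x they share a whole interval of values; two different x with a common value
  contradict injectivity.\<close>

lemma no_box_injection:
  assumes g: "dfn2 M g" and "a < b" "c < d"
    and inj: "\<And>x y x' y'. a < x \<Longrightarrow> x < b \<Longrightarrow> c < y \<Longrightarrow> y < d \<Longrightarrow> a < x' \<Longrightarrow> x' < b \<Longrightarrow> c < y' \<Longrightarrow> y' < d \<Longrightarrow>
        g x y = g x' y' \<Longrightarrow> x = x' \<and> y = y'"
  shows False
proof -
  have E: "def2 M (\<lambda>x z. \<exists>y. c < y \<and> y < d \<and> z = g x y)" unfolding def2_def by (intro dints dfn2D[OF g])
  have "infinite {z. \<exists>y. c < y \<and> y < d \<and> z = g x y}" if x: "a < x" "x < b" for x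
  proof -
    have "inj_on (g x) {c<..<d}" using inj[OF x _ _ x] by (intro inj_onI) auto
    then have "infinite (g x ` {c<..<d})" using infinite_Ioo[OF \<open>c < d\<close>] finite_imageD by blast
    moreover have "g x ` {c<..<d} = {z. \<exists>y. c < y \<and> y < d \<and> z = g x y}" by auto
    ultimately show ?thesis by simp
  qed
  from box_in_infinite_fibres[OF E \<open>a < b\<close> this] obtain a' b' c' d' where
    *: "a \<le> a'" "a' < b'" "b' \<le> b" "c' < d'"
    "\<And>x z. a' < x \<and> x < b' \<and> c' < z \<and> z < d' \<Longrightarrow> \<exists>y. c < y \<and> y < d \<and> z = g x y" by blast
  obtain z where z: "c' < z" "z < d'" using dense[OF *(4)] by blast
  obtain x where x: "a' < x" "x < b'" using dense[OF *(2)] by blast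
  obtain x' where x': "x < x'" "x' < b'" using dense[OF x(2)] by blast
  obtain y where y: "c < y" "y < d" "z = g x y" using *(5)[of x z] x z by blast
  obtain y' where y': "c < y'" "y' < d" "z = g x' y'" using *(5)[of x' z] x x' z by auto
  show False using inj[of x y x' y'] x x' y y' *(1-3) by auto
qed

text \<open>The one-variable statement is applied on each vertical segment and then to the bounds
  chosen there. The subintervals still vary with x, and \<open>box_in_infinite_fibres_within\<close>
  replaces them by one box.\<close>

lemma positive_bounded_below_box:
  assumes \<delta>: "dfn2 M \<delta>" and "a < b" "c < d"
    and pos: "\<And>x y. a < x \<Longrightarrow> x < b \<Longrightarrow> c < y \<Longrightarrow> y < d \<Longrightarrow> 0 < \<delta> x y"
  shows "\<exists>e a' b' c' d'. 0 < e \<and> a \<le> a' \<and> a' < b' \<and> b' \<le> b \<and> c \<le> c' \<and> c' < d' \<and> d' \<le> d \<and>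
    (\<forall>x y. a' < x \<and> x < b' \<and> c' < y \<and> y < d' \<longrightarrow> e < \<delta> x y)"
proof -
  define P where "P x e \<longleftrightarrow> 0 < e \<and> (\<exists>c' d'. c \<le> c' \<and> c' < d' \<and> d' \<le> d \<and> (\<forall>y. c' < y \<and> y < d' \<longrightarrow> e < \<delta> x y))" for x e
  define \<epsilon> where "\<epsilon> x = choice (P x)" for x
  have P: "def2 M P" unfolding def2_def P_def by (intro dints dfn2D[OF \<delta>])
  have d: "dfn1 M \<epsilon>" unfolding dfn1_def \<epsilon>_def by (intro dints def2D[OF P])
  have e: "P x (\<epsilon> x)" if x: "a < x" "x < b" for x
  proof -
    have dx: "dfn1 M (\<delta> x)" unfolding dfn1_def by (intro dints dfn2D[OF \<delta>])
    obtain e c' d' where "0 < e" "c \<le> c'" "c' < d'" "d' \<le> d" "\<And>y. c' < y \<Longrightarrow> y < d' \<Longrightarrow> e < \<delta> x y"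
      using positive_bounded_below[OF dx \<open>c < d\<close> pos[OF x]] by metis
    then have "P x e" unfolding P_def by blast
    moreover have "def1 M (P x)" unfolding def1_def by (intro dints def2D[OF P])
    ultimately show ?thesis unfolding \<epsilon>_def using choice_works by blast
  qed
  have "0 < \<epsilon> x" if "a < x" "x < b" for x using e[OF that] by (simp add: P_def)
  from positive_bounded_below[OF d \<open>a < b\<close> this] obtain e a' b' where
    1: "0 < e" "a \<le> a'" "a' < b'" "b' \<le> b" "\<And>x. a' < x \<Longrightarrow> x < b' \<Longrightarrow> e < \<epsilon> x" by metis
  have E: "def2 M (\<lambda>x y. e < \<delta> x y)" unfolding def2_def by (intro dints dfn2D[OF \<delta>])
  have "infinite {y. c < y \<and> y < d \<and> e < \<delta> x y}" if x: "a' < x" "x < b'" for x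
  proof -
    have "P x (\<epsilon> x)" "e < \<epsilon> x" using e[of x] 1 x by auto
    then obtain c' d' where c': "c \<le> c'" "c' < d'" "d' \<le> d" "\<forall>y. c' < y \<and> y < d' \<longrightarrow> \<epsilon> x < \<delta> x y"
      unfolding P_def by blast
    then have "{c'<..<d'} \<subseteq> {y. c < y \<and> y < d \<and> e < \<delta> x y}" using \<open>e < \<epsilon> x\<close> by auto
    then show ?thesis using infinite_Ioo[OF c'(2)] finite_subset by blast
  qed
  from box_in_infinite_fibres_within[OF E 1(3) this]
  obtain a2 b2 c' d' where 2: "a' \<le> a2" "a2 < b2" "b2 \<le> b'" "c \<le> c'" "c' < d'" "d' \<le> d"
    "\<forall>x y. a2 < x \<and> x < b2 \<and> c' < y \<and> y < d' \<longrightarrow> e < \<delta> x y"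
    by blast
  have "a \<le> a2" "b2 \<le> b" using 1 2 by auto
  with 1(1) 2(2,4-) show ?thesis by blast
qed

text \<open>Either E or its complement has infinite fibres over infinitely many points of (a, b). As
  infinitude is definable, these points contain an interval, over which a box is found.\<close>

lemma box_dichotomy:
  assumes E: "def2 M E" and "a < b" "c < d"
  shows "\<exists>a' b' c' d'. a \<le> a' \<and> a' < b' \<and> b' \<le> b \<and> c \<le> c' \<and> c' < d' \<and> d' \<le> d \<and>
    ((\<forall>x y. a' < x \<and> x < b' \<and> c' < y \<and> y < d' \<longrightarrow> E x y) \<or>
     (\<forall>x y. a' < x \<and> x < b' \<and> c' < y \<and> y < d' \<longrightarrow> \<not> E x y))"
proof -
  have nE: "def2 M (\<lambda>x y. \<not> E x y)" unfolding def2_def by (intro dints def2D[OF E])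
  have *: "\<exists>a' b' c' d'. a \<le> a' \<and> a' < b' \<and> b' \<le> b \<and> c \<le> c' \<and> c' < d' \<and> d' \<le> d \<and>
     (\<forall>x y. a' < x \<and> x < b' \<and> c' < y \<and> y < d' \<longrightarrow> F x y)"
    if F: "def2 M F" and inf: "infinite {x. a < x \<and> x < b \<and> infinite {y. c < y \<and> y < d \<and> F x y}}" for F
  proof -
    have "def2 M (\<lambda>x y. c < y \<and> y < d \<and> F x y)" unfolding def2_def by (intro dints def2D[OF F])
    from infinite_sub[OF D_infinite[OF this] inf] obtain a1 b1 where
      1: "a \<le> a1" "a1 < b1" "b1 \<le> b" "\<And>x. a1 < x \<Longrightarrow> x < b1 \<Longrightarrow> infinite {y. c < y \<and> y < d \<and> F x y}" by metis
    from box_in_infinite_fibres_within[OF F 1(2,4)]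
    obtain a2 b2 c' d' where 2: "a1 \<le> a2" "a2 < b2" "b2 \<le> b1" "c \<le> c'" "c' < d'" "d' \<le> d"
      "\<forall>x y. a2 < x \<and> x < b2 \<and> c' < y \<and> y < d' \<longrightarrow> F x y"
      by blast
    have "a \<le> a2" "b2 \<le> b" using 1 2 by auto
    with 2(2,4-) show ?thesis by blast
  qed
  have "infinite {x. a < x \<and> x < b \<and> infinite {y. c < y \<and> y < d \<and> E x y}} \<or>
     infinite {x. a < x \<and> x < b \<and> infinite {y. c < y \<and> y < d \<and> \<not> E x y}}"
    by (rule infinite_interval_cases[OF \<open>a < b\<close>], rule infinite_interval_cases[OF \<open>c < d\<close>]) blast
  then show ?thesis
  proof
    assume "infinite {x. a < x \<and> x < b \<and> infinite {y. c < y \<and> y < d \<and> E x y}}"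
    from *[OF E this] show ?thesis by blast
  next
    assume "infinite {x. a < x \<and> x < b \<and> infinite {y. c < y \<and> y < d \<and> \<not> E x y}}"
    from *[OF nE this] show ?thesis by blast
  qed
qed

section \<open>Continuity in two variables\<close>

definition cont2 :: "('a \<Rightarrow> 'a \<Rightarrow> 'a) \<Rightarrow> 'a \<Rightarrow> 'a \<Rightarrow> bool" where
  "cont2 f x y \<longleftrightarrow> (\<forall>e>0. \<exists>d>0. \<forall>x' y'. \<bar>x' - x\<bar> < d \<and> \<bar>y' - y\<bar> < d \<longrightarrow> \<bar>f x' y' - f x y\<bar> < e)"

text \<open>After shrinking the box, \<open>f\<close> is separately continuous. If it is jointly discontinuous
  everywhere, then the oscillation is at least a fixed \<open>e\<close> on some box, on which the moduli of
  separate continuity for \<open>e / 2\<close> are bounded below.\<close>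

lemma continuous_on_subbox:
  assumes f: "dfn2 M f" and "a < b" "c < d"
  shows "\<exists>a' b' c' d'. a \<le> a' \<and> a' < b' \<and> b' \<le> b \<and> c \<le> c' \<and> c' < d' \<and> d' \<le> d \<and>
    (\<forall>x y. a' < x \<and> x < b' \<and> c' < y \<and> y < d' \<longrightarrow> cont2 f x y)"
proof -
  have Cy: "def2 M (\<lambda>x y. cont (f x) y)" and Cx: "def2 M (\<lambda>x y. cont (\<lambda>x. f x y) x)"
    unfolding def2_def cont_def by (intro dints dfn2D[OF f])+
  have C2: "def2 M (cont2 f)" unfolding def2_def cont2_def by (intro dints dfn2D[OF f])
  obtain a1 b1 c1 d1 where 1: "a \<le> a1" "a1 < b1" "b1 \<le> b" "c \<le> c1" "c1 < d1" "d1 \<le> d"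
    "(\<forall>x y. a1 < x \<and> x < b1 \<and> c1 < y \<and> y < d1 \<longrightarrow> cont (f x) y) \<or>
     (\<forall>x y. a1 < x \<and> x < b1 \<and> c1 < y \<and> y < d1 \<longrightarrow> \<not> cont (f x) y)"
    using box_dichotomy[OF Cy assms(2,3)] by blast
  \<comment> \<open>The negative alternative is excluded on a single vertical segment, where
    \<open>f x\<close> is continuous somewhere.\<close>
  have 1: "a \<le> a1" "a1 < b1" "b1 \<le> b" "c \<le> c1" "c1 < d1" "d1 \<le> d"
    "\<And>x y. a1 < x \<and> x < b1 \<and> c1 < y \<and> y < d1 \<Longrightarrow> cont (f x) y"
  proof -
    obtain x where x: "a1 < x" "x < b1" using dense[OF 1(2)] by blast
    have "dfn1 M (f x)" unfolding dfn1_def by (intro dints dfn2D[OF f])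
    from continuous_somewhere[OF this 1(5)] obtain c' d' where
      "c1 \<le> c'" "c' < d'" "d' \<le> d1" "\<And>y. c' < y \<Longrightarrow> y < d' \<Longrightarrow> cont (f x) y" by metis
    then have "\<exists>y. c1 < y \<and> y < d1 \<and> cont (f x) y" using dense[of c' d'] by (meson le_less_trans less_le_trans)
    then show "\<And>x y. a1 < x \<and> x < b1 \<and> c1 < y \<and> y < d1 \<Longrightarrow> cont (f x) y" using 1(7) x by blast
  qed (use 1 in auto)
  obtain a2 b2 c2 d2 where 2: "a1 \<le> a2" "a2 < b2" "b2 \<le> b1" "c1 \<le> c2" "c2 < d2" "d2 \<le> d1"
    "(\<forall>x y. a2 < x \<and> x < b2 \<and> c2 < y \<and> y < d2 \<longrightarrow> cont (\<lambda>x. f x y) x) \<or>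
     (\<forall>x y. a2 < x \<and> x < b2 \<and> c2 < y \<and> y < d2 \<longrightarrow> \<not> cont (\<lambda>x. f x y) x)"
    using box_dichotomy[OF Cx 1(2,5)] by blast
  have 2: "a1 \<le> a2" "a2 < b2" "b2 \<le> b1" "c1 \<le> c2" "c2 < d2" "d2 \<le> d1"
    "\<And>x y. a2 < x \<and> x < b2 \<and> c2 < y \<and> y < d2 \<Longrightarrow> cont (\<lambda>x. f x y) x"
  proof -
    obtain y where y: "c2 < y" "y < d2" using dense[OF 2(5)] by blast
    have "dfn1 M (\<lambda>x. f x y)" unfolding dfn1_def by (intro dints dfn2D[OF f])
    from continuous_somewhere[OF this 2(2)] obtain a' b' where
      "a2 \<le> a'" "a' < b'" "b' \<le> b2" "\<And>x. a' < x \<Longrightarrow> x < b' \<Longrightarrow> cont (\<lambda>x. f x y) x" by metis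
    then have "\<exists>x. a2 < x \<and> x < b2 \<and> cont (\<lambda>x. f x y) x" using dense[of a' b'] by (meson le_less_trans less_le_trans)
    then show "\<And>x y. a2 < x \<and> x < b2 \<and> c2 < y \<and> y < d2 \<Longrightarrow> cont (\<lambda>x. f x y) x" using 2(7) y by blast
  qed (use 2 in auto)
  obtain a3 b3 c3 d3 where 3: "a2 \<le> a3" "a3 < b3" "b3 \<le> b2" "c2 \<le> c3" "c3 < d3" "d3 \<le> d2"
    "(\<forall>x y. a3 < x \<and> x < b3 \<and> c3 < y \<and> y < d3 \<longrightarrow> cont2 f x y) \<or>
     (\<forall>x y. a3 < x \<and> x < b3 \<and> c3 < y \<and> y < d3 \<longrightarrow> \<not> cont2 f x y)"
    using box_dichotomy[OF C2 2(2,5)] by blast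
  from 3(7) show ?thesis
  proof
    assume "\<forall>x y. a3 < x \<and> x < b3 \<and> c3 < y \<and> y < d3 \<longrightarrow> cont2 f x y"
    moreover have "a \<le> a3" "b3 \<le> b" "c \<le> c3" "d3 \<le> d" using 1 2 3 by auto
    ultimately show ?thesis using 3(2,5) by blast
  next
    assume nc: "\<forall>x y. a3 < x \<and> x < b3 \<and> c3 < y \<and> y < d3 \<longrightarrow> \<not> cont2 f x y"
    define P where "P x y e \<longleftrightarrow> 0 < e \<and> (\<forall>d>0. \<exists>x' y'. \<bar>x' - x\<bar> < d \<and> \<bar>y' - y\<bar> < d \<and> e \<le> \<bar>f x' y' - f x y\<bar>)" for x y e
    have P: "def3 M P" unfolding def3_def P_def by (intro dints dfn2D[OF f])
    define \<epsilon> where "\<epsilon> x y = choice (P x y)" for x y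
    have d\<epsilon>: "dfn2 M \<epsilon>" unfolding dfn2_def \<epsilon>_def by (intro dints def3D[OF P])
    have \<epsilon>: "P x y (\<epsilon> x y)" if "a3 < x" "x < b3" "c3 < y" "y < d3" for x y
    proof -
      have "\<not> cont2 f x y" using nc that by blast
      then have "\<exists>e. P x y e" unfolding cont2_def P_def by (metis not_less)
      moreover have "def1 M (P x y)" unfolding def1_def by (intro dints def3D[OF P])
      ultimately show ?thesis unfolding \<epsilon>_def using choice_works by blast
    qed
    have "0 < \<epsilon> x y" if "a3 < x" "x < b3" "c3 < y" "y < d3" for x y using \<epsilon>[OF that] by (simp add: P_def)
    from positive_bounded_below_box[OF d\<epsilon> 3(2,5) this]
    obtain e a4 b4 c4 d4 where 4: "0 < e" "a3 \<le> a4" "a4 < b4" "b4 \<le> b3" "c3 \<le> c4" "c4 < d4" "d4 \<le> d3"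
      "\<And>x y. a4 < x \<and> x < b4 \<and> c4 < y \<and> y < d4 \<Longrightarrow> e < \<epsilon> x y" by blast
    define Qy where "Qy x y d \<longleftrightarrow> 0 < d \<and> (\<forall>y'. \<bar>y' - y\<bar> < d \<longrightarrow> \<bar>f x y' - f x y\<bar> < e / 2)" for x y d
    define Qx where "Qx x y d \<longleftrightarrow> 0 < d \<and> (\<forall>x'. \<bar>x' - x\<bar> < d \<longrightarrow> \<bar>f x' y - f x y\<bar> < e / 2)" for x y d
    have Qy: "def3 M Qy" and Qx: "def3 M Qx" unfolding def3_def Qy_def Qx_def by (intro dints dfn2D[OF f])+
    define \<delta>y where "\<delta>y x y = choice (Qy x y)" for x y
    define \<delta>x where "\<delta>x x y = choice (Qx x y)" for x y
    have d\<delta>y: "dfn2 M \<delta>y" and d\<delta>x: "dfn2 M \<delta>x"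
      unfolding dfn2_def \<delta>y_def \<delta>x_def by (intro dints def3D[OF Qy] def3D[OF Qx])+
    have e2: "0 < e / 2" using 4(1) by simp
    have \<delta>: "Qy x y (\<delta>y x y)" "Qx x y (\<delta>x x y)" if "a4 < x" "x < b4" "c4 < y" "y < d4" for x y
    proof -
      have "cont (f x) y" "cont (\<lambda>x. f x y) x" using 1(7)[of x y] 2(7)[of x y] 2 3 4 that by auto
      then have "\<exists>d. Qy x y d" "\<exists>d. Qx x y d" unfolding cont_def Qy_def Qx_def using e2 by blast+
      moreover have "def1 M (Qy x y)" "def1 M (Qx x y)" unfolding def1_def
        by (intro dints def3D[OF Qy], intro dints def3D[OF Qx])
      ultimately show "Qy x y (\<delta>y x y)" "Qx x y (\<delta>x x y)" unfolding \<delta>y_def \<delta>x_def using choice_works by blast+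
    qed
    have "0 < \<delta>y x y" if "a4 < x" "x < b4" "c4 < y" "y < d4" for x y using \<delta>(1)[OF that] by (simp add: Qy_def)
    from positive_bounded_below_box[OF d\<delta>y 4(3,6) this]
    obtain e1 a5 b5 c5 d5 where 5: "0 < e1" "a4 \<le> a5" "a5 < b5" "b5 \<le> b4" "c4 \<le> c5" "c5 < d5" "d5 \<le> d4"
      "\<And>x y. a5 < x \<and> x < b5 \<and> c5 < y \<and> y < d5 \<Longrightarrow> e1 < \<delta>y x y" by blast
    have "0 < \<delta>x x y" if "a5 < x" "x < b5" "c5 < y" "y < d5" for x y
      using \<delta>(2)[of x y] 5 that by (auto simp: Qx_def)
    from positive_bounded_below_box[OF d\<delta>x 5(3,6) this]
    obtain e2 a6 b6 c6 d6 where 6: "0 < e2" "a5 \<le> a6" "a6 < b6" "b6 \<le> b5" "c5 \<le> c6" "c6 < d6" "d6 \<le> d5"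
      "\<And>x y. a6 < x \<and> x < b6 \<and> c6 < y \<and> y < d6 \<Longrightarrow> e2 < \<delta>x x y" by blast
    obtain x where x: "a6 < x" "x < b6" using dense[OF 6(3)] by blast
    obtain y where y: "c6 < y" "y < d6" using dense[OF 6(6)] by blast
    \<comment> \<open>The path runs vertically from (x, y) to (x, y') and then horizontally to (x',
      y'). The modulus of the second leg is taken at (x, y'), so it is y' that has to stay inside
      the box.\<close>
    define h where "h = min (min e1 e2) (min (y - c6) (d6 - y))"
    have "0 < h" using 5 6 y by (simp add: h_def)
    moreover have Pxy: "P x y (\<epsilon> x y)" "e < \<epsilon> x y" using \<epsilon>[of x y] 4(8)[of x y] 4 5 6 x y by auto
    ultimately obtain x' y' where x'y': "\<bar>x' - x\<bar> < h" "\<bar>y' - y\<bar> < h" "\<epsilon> x y \<le> \<bar>f x' y' - f x y\<bar>"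
      unfolding P_def by blast
    have y': "c6 < y'" "y' < d6" using x'y'(2) by (auto simp: h_def abs_less_iff)
    have "Qy x y (\<delta>y x y)" "e1 < \<delta>y x y" using \<delta>(1)[of x y] 5(8)[of x y] 5 6 x y by auto
    then have A: "\<bar>f x y' - f x y\<bar> < e / 2" using x'y'(2) unfolding Qy_def h_def by auto
    have "Qx x y' (\<delta>x x y')" "e2 < \<delta>x x y'" using \<delta>(2)[of x y'] 6(8)[of x y'] 5 6 x y' by auto
    then have "\<bar>f x' y' - f x y'\<bar> < e / 2" using x'y'(1) unfolding Qx_def h_def by auto
    then have "\<bar>(f x' y' - f x y') + (f x y' - f x y)\<bar> < e / 2 + e / 2"
      using A abs_triangle_ineq[of "f x' y' - f x y'" "f x y' - f x y"] by (meson add_strict_mono le_less_trans)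
    then have "\<bar>f x' y' - f x y\<bar> < e" by simp
    then show ?thesis using x'y'(3) Pxy(2) by simp
  qed
qed

end

section \<open>Uniform finiteness\<close>

text \<open>At least k points of S beyond t, as k nested quantifiers: for each fixed k a bound on
  the size of a fibre becomes definable.\<close>

primrec above :: "('a::linorder \<Rightarrow> bool) \<Rightarrow> nat \<Rightarrow> 'a \<Rightarrow> bool" where
  "above S 0 t = True"
| "above S (Suc k) t = (\<exists>y>t. S y \<and> above S k y)"

lemma above_iff_card:
  assumes "finite {y. S y}"
  shows "above S k t \<longleftrightarrow> k \<le> card {y. S y \<and> t < y}"
proof (induction k arbitrary: t)
  case (Suc k)
  have fin: "finite {y. S y \<and> u < y}" for u using assms by (rule rev_finite_subset) auto
  show ?case
  proof
    assume "above S (Suc k) t"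
    then obtain y where y: "t < y" "S y" "k \<le> card {z. S z \<and> y < z}" using Suc.IH by auto
    have "card (insert y {z. S z \<and> y < z}) \<le> card {z. S z \<and> t < z}"
      by (intro card_mono fin) (use y in auto)
    then show "Suc k \<le> card {y. S y \<and> t < y}" using y(3) fin[of y] by simp
  next
    assume k: "Suc k \<le> card {y. S y \<and> t < y}"
    let ?A = "{y. S y \<and> t < y}"
    have "?A \<noteq> {}" using k by (metis card.empty not_less_eq_eq zero_le)
    with fin[of t] have m: "Min ?A \<in> ?A" "\<And>z. z \<in> ?A \<Longrightarrow> Min ?A \<le> z"
      by (rule Min_in, intro Min_le fin)
    have "?A \<subseteq> insert (Min ?A) {z. S z \<and> Min ?A < z}" using m by (auto simp: order.strict_iff_order)
    then have "card ?A \<le> card (insert (Min ?A) {z. S z \<and> Min ?A < z})" by (intro card_mono finite.insertI fin)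
    also have "\<dots> = Suc (card {z. S z \<and> Min ?A < z})" using fin by simp
    finally have "k \<le> card {z. S z \<and> Min ?A < z}" using k by simp
    then have "above S k (Min ?A)" using Suc.IH by blast
    then show "above S (Suc k) t" using m(1) by auto
  qed
qed simp

lemma finite_positive_lower_bound:
  fixes f :: "'b \<Rightarrow> 'a::linordered_field"
  assumes "finite A" "\<And>x. x \<in> A \<Longrightarrow> 0 < f x"
  shows "\<exists>k>0. \<forall>x\<in>A. k \<le> f x"
  using assms
proof (induction A rule: finite_induct)
  case empty
  show ?case by (rule exI[of _ 1]) simp
next
  case (insert x A)
  then obtain k where "0 < k" "\<forall>x\<in>A. k \<le> f x" by auto
  then show ?case using insert.prems[of x] by (intro exI[of _ "min k (f x)"]) (auto simp: min_le_iff_disj)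
qed

lemma D_above:
  assumes "def2 M E" shows "def2 M (\<lambda>x t. above (E x) k t)"
proof (induction k)
  case 0
  show ?case unfolding def2_def by (simp add: D_const)
next
  case (Suc k)
  show ?case unfolding def2_def above.simps by (intro dints def2D[OF assms] def2D[OF Suc])
qed

text \<open>Integer and fractional part: a tag i and a point of (0,1) can be read off from their
  sum, which allows finitely many copies of (0,1) to be laid side by side.\<close>

lemma of_nat_add_unique:
  fixes x y :: "'a::linordered_field"
  assumes "of_nat i + x = of_nat j + y" "0 < x" "x < 1" "0 < y" "y < 1"
  shows "i = j" "x = y"
proof -
  have lt: "\<not> i < j" if "of_nat i + x = of_nat j + y" "0 < y" "x < 1" for i j :: nat and x y :: 'a
  proof
    assume "i < j"
    then have "of_nat i + 1 \<le> (of_nat j :: 'a)" by (metis Suc_eq_plus1 Suc_leI of_nat_Suc of_nat_mono add.commute)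
    then show False using that by linarith
  qed
  show "i = j" using lt[OF assms(1)] lt[OF assms(1)[symmetric]] assms by (metis linorder_neqE_nat)
  then show "x = y" using assms(1) by simp
qed

text \<open>The count drops strictly on passing to a larger point of the set, so the rank labels the
  points of a finite set.\<close>

lemma card_above_inj:
  fixes y y' :: "'a::linorder"
  assumes "finite {y. S y}" "S y" "S y'" "card {z. S z \<and> y < z} = card {z. S z \<and> y' < z}"
  shows "y = y'"
proof -
  have lt: "card {z. S z \<and> y' < z} < card {z. S z \<and> y < z}" if "y < y'" "S y'" for y y'
    by (rule psubset_card_mono) (use assms(1) that in \<open>auto intro: rev_finite_subset\<close>)
  show ?thesis using lt[of y y'] lt[of y' y] assms by (cases y y' rule: linorder_cases) auto
qed

context ominimal
begin

text \<open>Definable connectedness of a closed interval: if the truth value changed, local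
  constancy would fail at the infimum of the points where it differs from the value at p.\<close>

lemma locally_constant:
  assumes S: "def1 M S" and "p < q"
    and loc: "\<And>x. p \<le> x \<Longrightarrow> x \<le> q \<Longrightarrow> \<exists>e>0. \<forall>y. \<bar>y - x\<bar> < e \<longrightarrow> (S y \<longleftrightarrow> S x)"
  shows "S p \<longleftrightarrow> S q"
proof (rule ccontr)
  assume neq: "\<not> (S p \<longleftrightarrow> S q)"
  define T where "T t \<longleftrightarrow> p \<le> t \<and> t \<le> q \<and> \<not> (S t \<longleftrightarrow> S p)" for t
  have T: "def1 M T" unfolding def1_def T_def by (intro dints def1D[OF S])
  have Tq: "T q" using neq \<open>p < q\<close> by (auto simp: T_def)
  have low: "p \<le> t" if "T t" for t using that by (simp add: T_def)
  define s where "s = dinf T"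
  have s: "T y \<Longrightarrow> s \<le> y" "s < u \<Longrightarrow> \<exists>z<u. T z" for y u
    using dinf_props[of T, OF T Tq] low unfolding s_def by blast+
  have "p \<le> s"
  proof (rule ccontr)
    assume "\<not> p \<le> s"
    then show False using s(2)[of p] low by force
  qed
  moreover have "s \<le> q" using s(1)[OF Tq] .
  ultimately obtain e where e: "0 < e" "\<And>y. \<bar>y - s\<bar> < e \<Longrightarrow> S y \<longleftrightarrow> S s" using loc by blast
  obtain t where t: "t < s + e" "T t" using s(2)[of "s + e"] e by auto
  have ts: "S t \<longleftrightarrow> S s" using e(2)[of t] t s(1)[OF t(2)] by (auto simp: abs_less_iff)
  have "S s \<longleftrightarrow> S p"
  proof (cases "s = p")
    case False
    define y where "y = max p (s - e / 2)"
    have y: "p \<le> y" "y < s" "\<bar>y - s\<bar> < e" using False \<open>p \<le> s\<close> e(1) by (auto simp: y_def field_simps abs_less_iff max_def)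
    then have "\<not> T y" using s(1)[of y] by auto
    then have "S y \<longleftrightarrow> S p" using y \<open>s \<le> q\<close> by (auto simp: T_def)
    then show ?thesis using e(2)[OF y(3)] by blast
  qed simp
  then show False using t(2) ts by (simp add: T_def)
qed

text \<open>Near (a, b) the relation is empty, or it is, within height h of b, the graph of a
  function that is continuous at a with value b; unique existence for every k up to h is the
  epsilon-delta form of the latter.\<close>

definition normal :: "('a \<Rightarrow> 'a \<Rightarrow> bool) \<Rightarrow> 'a \<Rightarrow> 'a \<Rightarrow> bool" where
  "normal E a b \<longleftrightarrow>
     (\<exists>e>0. \<forall>x y. \<bar>x - a\<bar> < e \<and> \<bar>y - b\<bar> < e \<longrightarrow> \<not> E x y) \<or>
     (\<exists>h>0. \<forall>k. 0 < k \<and> k \<le> h \<longrightarrow> (\<exists>e>0. \<forall>x. \<bar>x - a\<bar> < e \<longrightarrow> (\<exists>!y. \<bar>y - b\<bar> < k \<and> E x y)))"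

lemma D_normal: "def2 M E \<Longrightarrow> def2 M (normal E)"
  unfolding def2_def[of M "normal E"] normal_def by (intro dints; rule def2D; (assumption | intro dints))

text \<open>If the vertical line through every point of an interval contained a point \<open>\<beta> x\<close> that is not
  normal, then \<open>\<beta>\<close> could be taken continuous and at distance at least \<open>g\<close> from the other points of
  its fibre, which makes its graph normal.\<close>

lemma finite_not_normal:
  assumes E: "def2 M E" and fin: "\<And>x. finite {y. E x y}"
  shows "finite {x. \<exists>b. \<not> normal E x b}"
proof (rule ccontr)
  note N = D_normal[OF E]
  assume inf: "infinite {x. \<exists>b. \<not> normal E x b}"
  have "def1 M (\<lambda>x. \<exists>b. \<not> normal E x b)" unfolding def1_def by (intro dints def2D[OF N])
  from iffD1[OF infinite_iff_interval[OF this] inf] obtain a0 b0 where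
    0: "a0 < b0" "\<And>x. a0 < x \<and> x < b0 \<Longrightarrow> \<exists>b. \<not> normal E x b" by blast
  define \<beta> where "\<beta> x = choice (\<lambda>b. \<not> normal E x b)" for x
  have d\<beta>: "dfn1 M \<beta>" unfolding dfn1_def \<beta>_def by (intro dints def2D[OF N])
  have \<beta>: "\<not> normal E x (\<beta> x)" if "a0 < x" "x < b0" for x
  proof -
    have "def1 M (\<lambda>b. \<not> normal E x b)" unfolding def1_def by (intro dints def2D[OF N])
    from choice_works[OF this] 0(2)[of x] that show ?thesis unfolding \<beta>_def by blast
  qed
  define P where "P x g \<longleftrightarrow> 0 < g \<and> (\<forall>y. E x y \<and> y \<noteq> \<beta> x \<longrightarrow> g \<le> \<bar>y - \<beta> x\<bar>)" for x g
  have P: "def2 M P" unfolding def2_def P_def by (intro dints def2D[OF E] dfn1D[OF d\<beta>])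
  define \<gamma> where "\<gamma> x = choice (P x)" for x
  have d\<gamma>: "dfn1 M \<gamma>" unfolding dfn1_def \<gamma>_def by (intro dints def2D[OF P])
  have \<gamma>: "P x (\<gamma> x)" for x
  proof -
    have "finite {y. E x y \<and> y \<noteq> \<beta> x}" using fin[of x] by (rule rev_finite_subset) auto
    from finite_positive_lower_bound[OF this, of "\<lambda>y. \<bar>y - \<beta> x\<bar>"] have "\<exists>g. P x g"
      unfolding P_def by auto
    moreover have "def1 M (P x)" unfolding def1_def by (intro dints def2D[OF P])
    ultimately show ?thesis unfolding \<gamma>_def using choice_works by blast
  qed
  have "0 < \<gamma> x" for x using \<gamma>[of x] by (simp add: P_def)
  from positive_bounded_below[OF d\<gamma> 0(1) this] obtain g a1 b1 where
    1: "0 < g" "a0 \<le> a1" "a1 < b1" "b1 \<le> b0" "\<And>x. a1 < x \<Longrightarrow> x < b1 \<Longrightarrow> g < \<gamma> x" by metis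
  from continuous_somewhere[OF d\<beta> 1(3)] obtain a2 b2 where
    2: "a1 \<le> a2" "a2 < b2" "b2 \<le> b1" "\<And>x. a2 < x \<Longrightarrow> x < b2 \<Longrightarrow> cont \<beta> x" by metis
  have dS: "def1 M (\<lambda>x. E x (\<beta> x))" "def1 M (\<lambda>x. \<not> E x (\<beta> x))"
    unfolding def1_def by (intro dints def2D[OF E] dfn1D[OF d\<beta>])+
  have "\<exists>a3 b3. a2 \<le> a3 \<and> a3 < b3 \<and> b3 \<le> b2 \<and>
     ((\<forall>x. a3 < x \<and> x < b3 \<longrightarrow> E x (\<beta> x)) \<or> (\<forall>x. a3 < x \<and> x < b3 \<longrightarrow> \<not> E x (\<beta> x)))"
  proof -
    have "infinite {x. a2 < x \<and> x < b2 \<and> E x (\<beta> x)} \<or> infinite {x. a2 < x \<and> x < b2 \<and> \<not> E x (\<beta> x)}"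
      by (rule infinite_interval_cases[OF 2(2)]) blast
    then show ?thesis
    proof
      assume "infinite {x. a2 < x \<and> x < b2 \<and> E x (\<beta> x)}"
      from infinite_sub[OF dS(1) this] show ?thesis by metis
    next
      assume "infinite {x. a2 < x \<and> x < b2 \<and> \<not> E x (\<beta> x)}"
      from infinite_sub[OF dS(2) this] show ?thesis by metis
    qed
  qed
  then obtain a3 b3 where 3: "a2 \<le> a3" "a3 < b3" "b3 \<le> b2"
     "(\<forall>x. a3 < x \<and> x < b3 \<longrightarrow> E x (\<beta> x)) \<or> (\<forall>x. a3 < x \<and> x < b3 \<longrightarrow> \<not> E x (\<beta> x))" by blast
  obtain a where a: "a3 < a" "a < b3" using dense[OF 3(2)] by blast
  have only: "y = \<beta> x" if "a3 < x" "x < b3" "E x y" "\<bar>y - \<beta> x\<bar> < g" for x y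
  proof (rule ccontr)
    assume "y \<noteq> \<beta> x"
    then have "\<gamma> x \<le> \<bar>y - \<beta> x\<bar>" using \<gamma>[of x] that by (simp add: P_def)
    moreover have "g < \<gamma> x" using 1(5)[of x] 1 2 3 that by auto
    ultimately show False using that by simp
  qed
  have c: "\<exists>d>0. \<forall>x. \<bar>x - a\<bar> < d \<longrightarrow> a3 < x \<and> x < b3 \<and> \<bar>\<beta> x - \<beta> a\<bar> < k" if k: "0 < k" for k
  proof -
    have "cont \<beta> a" using 2(4)[of a] a 3 by auto
    then obtain d where d: "0 < d" "\<And>x. \<bar>x - a\<bar> < d \<Longrightarrow> \<bar>\<beta> x - \<beta> a\<bar> < k" unfolding cont_def using k by blast
    show ?thesis
      by (rule exI[of _ "min d (min (a - a3) (b3 - a))"]) (use d a in \<open>auto simp: abs_less_iff\<close>)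
  qed
  have g2: "0 < g / 2" using 1(1) by simp
  have near: "\<bar>y - \<beta> x\<bar> < g" if "\<bar>\<beta> x - \<beta> a\<bar> < g / 2" "\<bar>y - \<beta> a\<bar> < g / 2" for x y
  proof -
    have "y - \<beta> x = (y - \<beta> a) - (\<beta> x - \<beta> a)" by simp
    then have "\<bar>y - \<beta> x\<bar> \<le> \<bar>y - \<beta> a\<bar> + \<bar>\<beta> x - \<beta> a\<bar>" by (metis abs_triangle_ineq4)
    also have "\<dots> < g / 2 + g / 2" using that by (intro add_strict_mono)
    finally show ?thesis by simp
  qed
  have "normal E a (\<beta> a)"
  proof (cases "\<forall>x. a3 < x \<and> x < b3 \<longrightarrow> E x (\<beta> x)")
    case True
    have "\<exists>e>0. \<forall>x. \<bar>x - a\<bar> < e \<longrightarrow> (\<exists>!y. \<bar>y - \<beta> a\<bar> < k \<and> E x y)" if k: "0 < k \<and> k \<le> g / 2" for k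
    proof -
      obtain d where d: "0 < d" "\<And>x. \<bar>x - a\<bar> < d \<Longrightarrow> a3 < x \<and> x < b3 \<and> \<bar>\<beta> x - \<beta> a\<bar> < k"
        using c[of k] k by blast
      have "\<exists>!y. \<bar>y - \<beta> a\<bar> < k \<and> E x y" if "\<bar>x - a\<bar> < d" for x
      proof (rule ex1I[of _ "\<beta> x"])
        show "\<bar>\<beta> x - \<beta> a\<bar> < k \<and> E x (\<beta> x)" using d(2)[OF that] True by blast
        show "y = \<beta> x" if "\<bar>y - \<beta> a\<bar> < k \<and> E x y" for y
          using only[of x y] near[of x y] d(2)[OF \<open>\<bar>x - a\<bar> < d\<close>] that k by auto
      qed
      then show ?thesis using d(1) by blast
    qed
    then show ?thesis unfolding normal_def using g2 by blast
  next
    case False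
    then have F: "\<And>x. a3 < x \<and> x < b3 \<Longrightarrow> \<not> E x (\<beta> x)" using 3(4) by blast
    obtain d where d: "0 < d" "\<And>x. \<bar>x - a\<bar> < d \<Longrightarrow> a3 < x \<and> x < b3 \<and> \<bar>\<beta> x - \<beta> a\<bar> < g / 2"
      using c[OF g2] by blast
    have "\<not> E x y" if "\<bar>x - a\<bar> < min d (g / 2) \<and> \<bar>y - \<beta> a\<bar> < min d (g / 2)" for x y
    proof
      assume "E x y"
      then have "y = \<beta> x" using only[of x y] near[of x y] d(2)[of x] that by auto
      then show False using F[of x] d(2)[of x] that \<open>E x y\<close> by auto
    qed
    moreover have "0 < min d (g / 2)" using d(1) g2 by simp
    ultimately show ?thesis unfolding normal_def by blast
  qed
  then show False using \<beta>[of a] a 1 2 3 by auto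
qed

text \<open>By normality each point over a continues to exactly one point over every nearby x. That
  no further points appear is usually a compactness argument; here definable completeness replaces
  it, applied to the heights t up to which the claim \<open>P t\<close> holds.\<close>

lemma card_fibre_locally_constant:
  assumes E: "def2 M E" and fin: "\<And>x. finite {y. E x y}"
    and range: "\<And>x y. E x y \<Longrightarrow> 0 < y \<and> y < 1" and norm: "\<And>b. normal E a b"
  shows "\<exists>e>0. \<forall>x. \<bar>x - a\<bar> < e \<longrightarrow> card {y. E x y} = card {y. E a y}"
proof -
  let ?F = "{y. E a y}"
  have "\<forall>b\<in>?F. \<exists>h>0. \<forall>k. 0 < k \<and> k \<le> h \<longrightarrow> (\<exists>e>0. \<forall>x. \<bar>x - a\<bar> < e \<longrightarrow> (\<exists>!y. \<bar>y - b\<bar> < k \<and> E x y))"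
  proof
    fix b assume "b \<in> ?F"
    then have "\<not> (\<exists>e>0. \<forall>x y. \<bar>x - a\<bar> < e \<and> \<bar>y - b\<bar> < e \<longrightarrow> \<not> E x y)" by force
    then show "\<exists>h>0. \<forall>k. 0 < k \<and> k \<le> h \<longrightarrow> (\<exists>e>0. \<forall>x. \<bar>x - a\<bar> < e \<longrightarrow> (\<exists>!y. \<bar>y - b\<bar> < k \<and> E x y))"
      using norm[of b, unfolded normal_def] by (simp only: simp_thms)
  qed
  from bchoice[OF this] obtain h where h: "\<And>b. E a b \<Longrightarrow> 0 < h b"
    "\<And>b k. E a b \<Longrightarrow> 0 < k \<and> k \<le> h b \<Longrightarrow> \<exists>e>0. \<forall>x. \<bar>x - a\<bar> < e \<longrightarrow> (\<exists>!y. \<bar>y - b\<bar> < k \<and> E x y)"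
    by blast
  obtain k1 where k1: "0 < k1" "\<And>b. E a b \<Longrightarrow> k1 \<le> h b"
    using finite_positive_lower_bound[of ?F h] fin h(1) by blast
  have "finite {p \<in> ?F \<times> ?F. fst p \<noteq> snd p}" using fin by auto
  then obtain k2 where k2: "0 < k2" "\<And>b b'. E a b \<Longrightarrow> E a b' \<Longrightarrow> b \<noteq> b' \<Longrightarrow> k2 \<le> \<bar>b - b'\<bar>"
    using finite_positive_lower_bound[of "{p \<in> ?F \<times> ?F. fst p \<noteq> snd p}" "\<lambda>p. \<bar>fst p - snd p\<bar>"] by fastforce
  \<comment> \<open>The bound \<open>k1\<close> makes normality applicable at every point of the
    fibre, and the half of the minimal distance \<open>k2\<close> keeps the windows around different
    points disjoint.\<close>
  define k where "k = min k1 (k2 / 2)"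
  have k: "0 < k" "\<And>b. E a b \<Longrightarrow> k \<le> h b" "k \<le> k2 / 2" using k1 k2 by (auto simp: k_def min_le_iff_disj)
  have "\<forall>b\<in>?F. \<exists>e>0. \<forall>x. \<bar>x - a\<bar> < e \<longrightarrow> (\<exists>!y. \<bar>y - b\<bar> < k \<and> E x y)"
    using h(2)[of _ k] k by blast
  from bchoice[OF this] obtain \<epsilon> where \<epsilon>: "\<And>b. E a b \<Longrightarrow> 0 < \<epsilon> b"
    "\<And>b x. E a b \<Longrightarrow> \<bar>x - a\<bar> < \<epsilon> b \<Longrightarrow> \<exists>!y. \<bar>y - b\<bar> < k \<and> E x y" by blast
  obtain e1 where e1: "0 < e1" "\<And>b. E a b \<Longrightarrow> e1 \<le> \<epsilon> b"
    using finite_positive_lower_bound[of ?F \<epsilon>] fin \<epsilon>(1) by blast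
  have one: "\<exists>!y. \<bar>y - b\<bar> < k \<and> E x y" if "E a b" "\<bar>x - a\<bar> < e1" for b x
    using \<epsilon>(2)[OF that(1), of x] e1(2)[OF that(1)] that(2) by auto

  define P where "P t \<longleftrightarrow> (\<exists>e>0. \<forall>x y. \<bar>x - a\<bar> < e \<and> E x y \<and> y \<le> t \<longrightarrow> (\<exists>b. E a b \<and> \<bar>y - b\<bar> < k))" for t
  have "P 1"
  proof (rule ccontr)
    assume "\<not> P 1"
    define T where "T t \<longleftrightarrow> 0 \<le> t \<and> \<not> P t" for t
    have T: "def1 M T" unfolding def1_def T_def P_def by (intro dints def2D[OF E])
    have T1: "T 1" using \<open>\<not> P 1\<close> by (simp add: T_def)
    have low: "0 \<le> t" if "T t" for t using that by (simp add: T_def)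
    define s where "s = dinf T"
    have s: "T y \<Longrightarrow> s \<le> y" "s < u \<Longrightarrow> \<exists>z<u. T z" for y u
      using dinf_props[of T, OF T T1] low unfolding s_def by blast+
    have "\<exists>e>0. \<forall>x y. \<bar>x - a\<bar> < e \<and> \<bar>y - s\<bar> < e \<and> E x y \<longrightarrow> (\<exists>b. E a b \<and> \<bar>y - b\<bar> < k)"
    proof (cases "E a s")
      case True
      then show ?thesis using k(1) by blast
    next
      case False
      \<comment> \<open>The graph alternative would put points of the fibre over a arbitrarily near
        s. As s itself is not in the fibre, two different ones would lie within h of s, against
        uniqueness.\<close>
      have "\<exists>e>0. \<forall>x y. \<bar>x - a\<bar> < e \<and> \<bar>y - s\<bar> < e \<longrightarrow> \<not> E x y"
      proof (rule ccontr)
        assume "\<not> ?thesis"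
        then obtain h where h: "0 < h" and
          uniq: "\<And>k. 0 < k \<and> k \<le> h \<Longrightarrow> \<exists>e>0. \<forall>x. \<bar>x - a\<bar> < e \<longrightarrow> (\<exists>!y. \<bar>y - s\<bar> < k \<and> E x y)"
          using norm[of s] unfolding normal_def by blast
        have u: "\<exists>!y. \<bar>y - s\<bar> < k \<and> E a y" if "0 < k" "k \<le> h" for k
          using uniq[of k] that by (metis abs_zero cancel_comm_monoid_add_class.diff_cancel)
        obtain y1 where y1: "\<bar>y1 - s\<bar> < h" "E a y1" using u[of h] h by blast
        then have "0 < \<bar>y1 - s\<bar>" using False by auto
        then obtain y2 where y2: "\<bar>y2 - s\<bar> < \<bar>y1 - s\<bar>" "E a y2" using u[of "\<bar>y1 - s\<bar>"] y1 by auto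
        have "\<exists>!y. \<bar>y - s\<bar> < h \<and> E a y" using u[of h] h by simp
        moreover have "\<bar>y2 - s\<bar> < h" using y1 y2 by simp
        ultimately have "y1 = y2" using y1 y2 by blast
        then show False using y2 by simp
      qed
      then show ?thesis by blast
    qed
    then obtain e where e: "0 < e"
      "\<And>x y. \<bar>x - a\<bar> < e \<Longrightarrow> \<bar>y - s\<bar> < e \<Longrightarrow> E x y \<Longrightarrow> \<exists>b. E a b \<and> \<bar>y - b\<bar> < k" by blast
    have "P (s - e / 2)"
    proof (cases "0 \<le> s - e / 2")
      case True
      then show ?thesis using s(1)[of "s - e / 2"] e(1) by (auto simp: T_def)
    next
      case False
      have "\<not> (E x y \<and> y \<le> s - e / 2)" for x y using range[of x y] False by auto
      then show ?thesis unfolding P_def using zero_less_one by blast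
    qed
    then obtain e' where e': "0 < e'"
      "\<And>x y. \<bar>x - a\<bar> < e' \<Longrightarrow> E x y \<Longrightarrow> y \<le> s - e / 2 \<Longrightarrow> \<exists>b. E a b \<and> \<bar>y - b\<bar> < k" unfolding P_def by blast
    have "\<exists>b. E a b \<and> \<bar>y - b\<bar> < k" if "\<bar>x - a\<bar> < min e e'" "E x y" "y < s + e" for x y
    proof (cases "y \<le> s - e / 2")
      case True
      then show ?thesis using e'(2)[of x y] that by auto
    next
      case False
      then have "\<bar>y - s\<bar> < e" using that e(1) by (auto simp: abs_less_iff field_simps)
      then show ?thesis using e(2)[of x y] that by auto
    qed
    moreover have "0 < min e e'" using e(1) e'(1) by simp
    ultimately have "P t" if "t < s + e" for t
      unfolding P_def using that by (meson le_less_trans)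
    moreover obtain t where "t < s + e" "T t" using s(2)[of "s + e"] e(1) by auto
    ultimately show False by (simp add: T_def)
  qed
  then obtain e2 where e2: "0 < e2"
    "\<And>x y. \<bar>x - a\<bar> < e2 \<Longrightarrow> E x y \<Longrightarrow> \<exists>b. E a b \<and> \<bar>y - b\<bar> < k"
    unfolding P_def using range by (metis less_imp_le)
  have "card {y. E x y} = card ?F" if x: "\<bar>x - a\<bar> < min e1 e2" for x
  proof -
    define w where "w b = (THE y. \<bar>y - b\<bar> < k \<and> E x y)" for b
    have w: "\<bar>w b - b\<bar> < k \<and> E x (w b)" if "E a b" for b
      unfolding w_def by (rule theI') (use one[OF that, of x] x in auto)
    have w_eq: "w b = y" if "E a b" "\<bar>y - b\<bar> < k" "E x y" for b y
      unfolding w_def by (rule the1_equality) (use one[OF that(1), of x] that x in auto)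
    have "bij_betw w ?F {y. E x y}"
    proof (rule bij_betwI')
      fix b b' assume "b \<in> ?F" "b' \<in> ?F"
      then have b: "E a b" "E a b'" by auto
      show "(w b = w b') = (b = b')"
      proof
        assume eq: "w b = w b'"
        show "b = b'"
        proof (rule ccontr)
          assume "b \<noteq> b'"
          then have "k2 \<le> \<bar>b - b'\<bar>" using k2(2) b by blast
          also have "b - b' = (w b' - b') - (w b - b)" using eq by simp
          also have "\<bar>(w b' - b') - (w b - b)\<bar> \<le> \<bar>w b' - b'\<bar> + \<bar>w b - b\<bar>" by (rule abs_triangle_ineq4)
          also have "\<dots> < k2 / 2 + k2 / 2"
            by (intro add_strict_mono) (use w[OF b(1)] w[OF b(2)] k(3) in auto)
          finally show False by simp
        qed
      qed simp
    next
      fix b assume "b \<in> ?F"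
      then show "w b \<in> {y. E x y}" using w by auto
    next
      fix y assume "y \<in> {y. E x y}"
      then have y: "E x y" by simp
      then obtain b where "E a b" "\<bar>y - b\<bar> < k" using e2(2)[of x y] x by auto
      then show "\<exists>b\<in>?F. y = w b" using w_eq[of b y] y by auto
    qed
    then show ?thesis by (simp add: bij_betw_same_card)
  qed
  moreover have "0 < min e1 e2" using e1(1) e2(1) by simp
  ultimately show ?thesis by blast
qed

text \<open>For all but finitely many x every point of the vertical line is normal. These x form
  finitely many points and intervals, and on each interval the cardinality is locally constant,
  hence constant.\<close>

lemma uniform_finiteness:
  assumes E: "def2 M E" and fin: "\<And>x. finite {y. E x y}"
    and range: "\<And>x y. E x y \<Longrightarrow> 0 < y \<and> y < 1"
  shows "\<exists>N. \<forall>x. card {y. E x y} \<le> N"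
proof -
  define K where "K x = card {y. E x y}" for x
  define G where "G x \<longleftrightarrow> \<not> (\<exists>b. \<not> normal E x b)" for x
  have "def1 M G" unfolding def1_def G_def by (intro dints def2D[OF D_normal[OF E]])
  from pieces[OF this] obtain \<I> where \<I>: "finite \<I>" "\<forall>I\<in>\<I>. point_or_interval I" "{x. G x} = \<Union>\<I>" by blast
  have Kab: "k \<le> K x \<longleftrightarrow> above (E x) k 0" for k x
  proof -
    have "{y. E x y \<and> 0 < y} = {y. E x y}" using range by auto
    then show ?thesis using above_iff_card[OF fin[of x], of k 0] by (simp add: K_def)
  qed
  have const: "K p = K q" if I: "I \<in> \<I>" "p \<in> I" "q \<in> I" "p < q" for I p q
  proof -
    have good: "G x" if "p \<le> x" "x \<le> q" for x
    proof -
      have "x \<in> I" using \<I>(2) I that unfolding point_or_interval_def by (auto dest!: bspec[OF _ I(1)])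
      then show ?thesis using \<I>(3) I(1) by blast
    qed
    \<comment> \<open>The cardinality is compared through its thresholds, because connectedness
      speaks about definable predicates, and each single threshold is one.\<close>
    have "k \<le> K p \<longleftrightarrow> k \<le> K q" for k
      unfolding Kab
    proof (rule locally_constant[OF _ \<open>p < q\<close>])
      show "def1 M (\<lambda>x. above (E x) k 0)" unfolding def1_def by (intro dints def2D[OF D_above[OF E]])
      fix x assume "p \<le> x" "x \<le> q"
      then have nx: "\<And>b. normal E x b" using good unfolding G_def by blast
      have "\<exists>e>0. \<forall>y. \<bar>y - x\<bar> < e \<longrightarrow> K y = K x"
        unfolding K_def by (rule card_fibre_locally_constant[OF E fin range nx])
      then obtain e where "0 < e" "\<forall>y. \<bar>y - x\<bar> < e \<longrightarrow> K y = K x" by blast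
      moreover from this(2) have "\<forall>y. \<bar>y - x\<bar> < e \<longrightarrow> above (E y) k 0 = above (E x) k 0"
        unfolding Kab[symmetric] by metis
      ultimately show "\<exists>e>0. \<forall>y. \<bar>y - x\<bar> < e \<longrightarrow> above (E y) k 0 = above (E x) k 0" by blast
    qed
    then show ?thesis by (meson order.antisym order_refl)
  qed
  have "finite (K ` I)" if "I \<in> \<I>" for I
  proof (cases "I = {}")
    case False
    then obtain p where p: "p \<in> I" by blast
    have "K q = K p" if "q \<in> I" for q
    proof (cases p q rule: linorder_cases)
      case less
      show ?thesis by (rule const[OF \<open>I \<in> \<I>\<close> p that less, symmetric])
    next
      case greater
      show ?thesis by (rule const[OF \<open>I \<in> \<I>\<close> that p greater])
    qed simp
    then have "K ` I \<subseteq> {K p}" by auto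
    then show ?thesis using finite_subset by blast
  qed simp
  then have "finite (\<Union>I\<in>\<I>. K ` I)" using \<I>(1) by blast
  moreover have "finite (K ` {x. \<not> G x})" using finite_not_normal[OF E fin] by (simp add: G_def)
  moreover have "range K \<subseteq> (\<Union>I\<in>\<I>. K ` I) \<union> K ` {x. \<not> G x}" using \<I>(3) by blast
  ultimately have "finite (range K)" using finite_subset by blast
  then show ?thesis unfolding K_def[symmetric] by (meson Max_ge rangeI)
qed

section \<open>Injecting thin planar sets into the line\<close>

lemma dfn2_card_above:
  assumes E: "def2 M E" and fin: "\<And>x. finite {y. E x y}" and N: "\<And>x. card {y. E x y} \<le> N"
  shows "dfn2 M (\<lambda>x t. of_nat (card {y. E x y \<and> t < y}))"
proof -
  have le: "card {y. E x y \<and> t < y} < Suc N" for x t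
  proof -
    have "card {y. E x y \<and> t < y} \<le> card {y. E x y}" using fin by (intro card_mono) auto
    then show ?thesis using N[of x] by simp
  qed
  have *: "w = of_nat (card {y. E x y \<and> t < y}) \<longleftrightarrow>
     (\<exists>i<Suc N. above (E x) i t \<and> \<not> above (E x) (Suc i) t \<and> w = of_nat i)" for w :: 'a and x t
    unfolding above_iff_card[OF fin] using le[of x t] by (auto simp: not_less_eq_eq)
  show ?thesis unfolding dfn2_def DT_def *
    by (intro dints D_ex_less def2D[OF D_above[OF E]])
qed

text \<open>Such a set consists of finitely many partial graphs and finitely many vertical pieces. A
  point of a graph is recorded by its rank in the fibre and by x, a point of a vertical piece by the
  rank of the line and by y; every rank has its own unit interval, and the result is scaled into
  (0,1).\<close>

lemma thin_set_injects:
  assumes E: "def2 M E" and range: "\<And>x y. E x y \<Longrightarrow> 0 < x \<and> x < 1 \<and> 0 < y \<and> y < 1"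
    and fin: "finite {x. infinite {y. E x y}}"
  shows "\<exists>g. dfn2 M g \<and> (\<forall>x y. E x y \<longrightarrow> 0 < g x y \<and> g x y < 1) \<and>
    (\<forall>x y x' y'. E x y \<and> E x' y' \<and> g x y = g x' y' \<longrightarrow> x = x' \<and> y = y')"
proof -
  define I where "I x \<longleftrightarrow> infinite {y. E x y}" for x
  have I: "def1 M I" unfolding I_def by (rule D_infinite[OF E])
  have finI: "finite {x. I x}" using fin by (simp add: I_def)
  define E' where "E' x y \<longleftrightarrow> E x y \<and> \<not> I x" for x y
  have E': "def2 M E'" unfolding def2_def E'_def by (intro dints def2D[OF E] def1D[OF I])
  have fin': "finite {y. E' x y}" for x by (cases "I x") (auto simp: E'_def I_def)
  obtain N where N: "\<And>x. card {y. E' x y} \<le> N"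
    using uniform_finiteness[OF E' fin'] range by (auto simp: E'_def)
  define m where "m = card {x. I x}"
  have I2: "def2 M (\<lambda>_. I)" unfolding def2_def by (intro dints def1D[OF I])
  define \<rho> :: "'a \<Rightarrow> 'a \<Rightarrow> nat" where "\<rho> x y = card {z. E' x z \<and> y < z}" for x y
  define \<sigma> :: "'a \<Rightarrow> nat" where "\<sigma> x = card {z. I z \<and> x < z}" for x
  have d\<rho>: "dfn2 M (\<lambda>x y. of_nat (\<rho> x y))" unfolding \<rho>_def by (rule dfn2_card_above[OF E' fin' N])
  have "dfn2 M (\<lambda>(_::'a) x. of_nat (\<sigma> x))" unfolding \<sigma>_def
    by (rule dfn2_card_above[OF I2, of m]) (use finI in \<open>simp_all add: m_def\<close>)
  from dfn2D[OF this DT_const DT_var] have d\<sigma>: "dfn1 M (\<lambda>x. of_nat (\<sigma> x))" unfolding dfn1_def .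
  \<comment> \<open>Ranks \<open>\<rho>\<close> are at most N, so the offset \<open>Suc N\<close>
    separates the two kinds of points. The largest tag is N + 1 + m, which is why division by N + m
    + 2 leads into (0,1).\<close>
  define g0 where "g0 x y = (if I x then of_nat (Suc N + \<sigma> x) + y else of_nat (\<rho> x y) + x)" for x y
  define C where "C = N + m + 2"
  define g where "g x y = g0 x y / of_nat C" for x y
  have "dfn2 M g" unfolding dfn2_def g_def g0_def of_nat_add
    by (intro dints def1D[OF I] dfn2D[OF d\<rho>] dfn1D[OF d\<sigma>])
  moreover have r: "\<rho> x y \<le> N" for x y
    unfolding \<rho>_def by (rule order_trans[OF card_mono[OF fin'[of x]] N[of x]]) auto
  have s: "\<sigma> x \<le> m" for x
    unfolding \<sigma>_def m_def by (rule card_mono[OF finI]) auto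
  have bound: "of_nat i + t < (of_nat C :: 'a)" if "i \<le> N + m + 1" "t < 1" for i and t :: 'a
  proof -
    have "of_nat i + t < of_nat i + 1" using that by simp
    also have "\<dots> \<le> of_nat C" using of_nat_mono[of "Suc i" C, where 'a = 'a] that(1)
      by (simp add: add.commute C_def)
    finally show ?thesis .
  qed
  have pos: "0 < of_nat i + t" if "0 < t" for i and t :: 'a using that by (simp add: add_nonneg_pos)
  have "0 < g x y \<and> g x y < 1" if "E x y" for x y
  proof -
    have "0 < g0 x y" using range[OF that] unfolding g0_def by (auto intro: pos simp del: of_nat_add of_nat_Suc)
    moreover have "g0 x y < of_nat C"
      using range[OF that] r[of x y] s[of x] unfolding g0_def by (auto intro!: bound simp del: of_nat_add of_nat_Suc)
    moreover have "0 < (of_nat C :: 'a)" by (simp add: C_def del: of_nat_add of_nat_Suc)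
    ultimately show ?thesis unfolding g_def by (simp add: pos_divide_less_eq)
  qed
  moreover have "x = x' \<and> y = y'" if *: "E x y" "E x' y'" "g x y = g x' y'" for x y x' y'
  proof -
    have "(of_nat C :: 'a) \<noteq> 0" by (simp add: C_def del: of_nat_add of_nat_Suc)
    then have eq: "g0 x y = g0 x' y'" using *(3) unfolding g_def by simp
    note rs = range[OF *(1)] range[OF *(2)]
    show ?thesis
    proof (cases "I x"; cases "I x'")
      assume "I x" "I x'"
      then have "of_nat (Suc N + \<sigma> x) + y = of_nat (Suc N + \<sigma> x') + y'" using eq by (simp add: g0_def)
      from of_nat_add_unique[OF this] rs have "\<sigma> x = \<sigma> x'" "y = y'" by auto
      then show ?thesis using card_above_inj[of I x x'] finI \<open>I x\<close> \<open>I x'\<close> by (simp add: \<sigma>_def)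
    next
      assume "\<not> I x" "\<not> I x'"
      then have "of_nat (\<rho> x y) + x = of_nat (\<rho> x' y') + x'" using eq by (simp add: g0_def)
      from of_nat_add_unique[OF this] rs have "\<rho> x y = \<rho> x' y'" "x = x'" by auto
      moreover have "E' x y" "E' x' y'" using * \<open>\<not> I x\<close> \<open>\<not> I x'\<close> by (auto simp: E'_def)
      ultimately show ?thesis using card_above_inj[of "E' x" y y'] fin' by (simp add: \<rho>_def)
    next
      assume "I x" "\<not> I x'"
      then have "of_nat (Suc N + \<sigma> x) + y = of_nat (\<rho> x' y') + x'" using eq by (simp add: g0_def)
      from of_nat_add_unique(1)[OF this] rs r[of x' y'] show ?thesis by auto
    next
      assume "\<not> I x" "I x'"
      then have "of_nat (\<rho> x y) + x = of_nat (Suc N + \<sigma> x') + y'" using eq by (simp add: g0_def)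
      from of_nat_add_unique(1)[OF this] rs r[of x y] show ?thesis by auto
    qed
  qed
  ultimately show ?thesis by (intro exI[of _ g]) blast
qed

end

section \<open>One-dimensional definable sets\<close>

definition defl1 :: "('f, 'r, 'a::linordered_field) expansion \<Rightarrow> nat \<Rightarrow> ('a list \<Rightarrow> 'a \<Rightarrow> bool) \<Rightarrow> bool" where
  "defl1 M n G \<longleftrightarrow> D M (\<lambda>v. G (map v [0..<n]) (v n))"

lemma defl1D:
  assumes G: "defl1 M n G" and t: "\<And>i. i < n \<Longrightarrow> DT M (t i)" and s: "DT M s"
  shows "D M (\<lambda>v. G (map (\<lambda>i. t i v) [0..<n]) (s v))"
proof (rule D_app[OF s], rule D_list_app[of M "\<lambda>y v. G y (v 0)"])
  show "D M (\<lambda>v. G (map v [0..<n]) (v (0 + n)))" using G by (simp add: defl1_def)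
qed (rule DT_ren[OF t])

lemma defl1_snoc: "defl M (Suc n) (\<lambda>z. z \<in> X) \<Longrightarrow> defl1 M n (\<lambda>y t. y @ [t] \<in> X)"
  by (simp add: defl_def defl1_def)

lemma nth_map_self: "length x = n \<Longrightarrow> map (\<lambda>i. x ! i) [0..<n] = x"
  by (intro nth_equalityI) auto

lemma map_upt_snoc: "map v [0..<n + 1] = map v [0..<n] @ [v n]"
  by simp

lemma map_upt_eq: "length z = n \<Longrightarrow> map v [0..<n] = z \<longleftrightarrow> (\<forall>i<n. v i = z ! i)"
  by (auto simp: list_eq_iff_nth_eq)

lemma definable_singleton: "definable M (length z) {z}"
proof -
  have "D M (\<lambda>v. \<forall>i<length z. v i = z ! i)" by (intro dints)
  then show ?thesis by (simp add: definable_iff_defl defl_def map_upt_eq)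
qed

text \<open>Uniform finiteness is available for fibres inside (0,1), so unbounded coordinates are
  compressed first.\<close>

definition squash :: "'a::linordered_field \<Rightarrow> 'a" where
  "squash t = (1 + t / (1 + \<bar>t\<bar>)) / 2"

lemma squash_bounds: "0 < squash t" "squash t < 1"
proof -
  have p: "0 < 1 + \<bar>t\<bar>" by (simp add: add_pos_nonneg)
  have "- (1 + \<bar>t\<bar>) < t" "t < 1 + \<bar>t\<bar>" by (auto simp: abs_if)
  then have "- 1 < t / (1 + \<bar>t\<bar>)" "t / (1 + \<bar>t\<bar>) < 1"
    using p by (simp_all add: pos_less_divide_eq pos_divide_less_eq)
  then show "0 < squash t" "squash t < 1" unfolding squash_def by simp_all
qed

lemma inj_squash: "inj squash"
proof (rule injI)
  fix x y :: 'a assume "squash x = squash y"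
  then have "2 * squash x - 1 = 2 * squash y - 1" by simp
  then have eq: "x / (1 + \<bar>x\<bar>) = y / (1 + \<bar>y\<bar>)" unfolding squash_def by (simp del: diff_eq_eq)
  have p: "0 < 1 + \<bar>t\<bar>" for t :: 'a by (simp add: add_pos_nonneg)
  have "x * (1 + \<bar>y\<bar>) = y * (1 + \<bar>x\<bar>)" using eq p[of x] p[of y] by (simp add: frac_eq_eq)
  \<comment> \<open>With equal signs the mixed products of the cross-multiplied equation agree and
    cancel.\<close>
  moreover have "sgn x = sgn y" using arg_cong[OF eq, of sgn] p[of x] p[of y] by (simp add: sgn_divide)
  then have "x * \<bar>y\<bar> = y * \<bar>x\<bar>" unfolding abs_sgn[of x] abs_sgn[of y] by simp
  ultimately show "x = y" by (simp add: distrib_left)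
qed

lemma dfn1_squash: "dfn1 M squash"
  unfolding dfn1_def squash_def by (intro dints)

section \<open>Elementary facts on cells\<close>

lemma cell_length: "cell M d C \<Longrightarrow> x \<in> C \<Longrightarrow> length x = length d"
  by (induction arbitrary: x rule: cell.induct) auto

lemma cell_entries: "cell M d C \<Longrightarrow> k \<in> set d \<Longrightarrow> k \<le> 1"
  by (induction arbitrary: k rule: cell.induct) auto

lemma interval_between:
  fixes f g :: "'a::linordered_field option"
  assumes "\<forall>x\<in>set_option f. \<forall>y\<in>set_option g. x < y"
  shows "infinite {t. (\<forall>x\<in>set_option f. x < t) \<and> (\<forall>y\<in>set_option g. t < y)}"
proof -
  obtain u w where "u < w" "\<And>t. u < t \<Longrightarrow> t < w \<Longrightarrow> (\<forall>x\<in>set_option f. x < t) \<and> (\<forall>y\<in>set_option g. t < y)"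
  proof (cases f; cases g)
    assume "f = None" "g = None" then show ?thesis using that[of 0 1] by simp
  next
    fix y assume "f = None" "g = Some y" then show ?thesis using that[of "y - 1" y] by simp
  next
    fix x assume "f = Some x" "g = None" then show ?thesis using that[of x "x + 1"] by simp
  next
    fix x y assume "f = Some x" "g = Some y" then show ?thesis using that[of x y] assms by simp
  qed
  then have "{u<..<w} \<subseteq> {t. (\<forall>x\<in>set_option f. x < t) \<and> (\<forall>y\<in>set_option g. t < y)}" by auto
  then show ?thesis using infinite_Ioo[OF \<open>u < w\<close>] finite_subset by blast
qed

lemma band_fibre_infinite:
  fixes C :: "'a::linordered_field list set" and F G :: "('a list \<Rightarrow> 'a) option"
  assumes "\<forall>f\<in>set_option F. \<forall>g\<in>set_option G. \<forall>x\<in>C. f x < g x" "x \<in> C"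
  shows "infinite {t. (\<forall>f\<in>set_option F. f x < t) \<and> (\<forall>g\<in>set_option G. t < g x)}"
  using interval_between[of "map_option (\<lambda>f. f x) F" "map_option (\<lambda>g. g x) G"] assms
  by (simp add: option.set_map)

lemma cell_nonempty: "cell M d C \<Longrightarrow> C \<noteq> {}"
proof (induction rule: cell.induct)
  case (cell_band d C F G)
  then obtain x where x: "x \<in> C" by blast
  from band_fibre_infinite[OF cell_band(4) x]
  have "{t. (\<forall>f\<in>set_option F. f x < t) \<and> (\<forall>g\<in>set_option G. t < g x)} \<noteq> {}"
    using finite.emptyI by metis
  then show ?case using x by blast
qed auto

lemma cell_infinite: "cell M d C \<Longrightarrow> 1 \<le> sum_list d \<Longrightarrow> infinite C"
proof (induction rule: cell.induct)
  case (cell_graph d C f)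
  have "C \<subseteq> butlast ` {x @ [f x] | x. x \<in> C}" by force
  then show ?case using cell_graph finite_surj by auto
next
  case (cell_band d C F G)
  then obtain x where x: "x \<in> C" using cell_nonempty by blast
  have *: "{t. (\<forall>f\<in>set_option F. f x < t) \<and> (\<forall>g\<in>set_option G. t < g x)} \<subseteq>
    last ` {x @ [t] | x t. x \<in> C \<and> (\<forall>f\<in>set_option F. f x < t) \<and> (\<forall>g\<in>set_option G. t < g x)}"
    (is "_ \<subseteq> last ` ?B")
  proof
    fix t assume "t \<in> {t. (\<forall>f\<in>set_option F. f x < t) \<and> (\<forall>g\<in>set_option G. t < g x)}"
    then have "x @ [t] \<in> ?B" using x by blast
    then have "last (x @ [t]) \<in> last ` ?B" by (rule imageI)
    then show "t \<in> last ` ?B" by simp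
  qed
  show ?case
  proof
    assume "finite ?B"
    then have "finite (last ` ?B)" by (rule finite_imageI)
    from finite_subset[OF * this] band_fibre_infinite[OF cell_band(4) x] show False by contradiction
  qed
qed auto

lemma definable_curve:
  assumes "\<And>t. length (\<gamma> t) = n" "\<And>i. i < n \<Longrightarrow> dfn1 M (\<lambda>t. \<gamma> t ! i)"
  shows "definable M n {\<gamma> t | t. a < t \<and> t < b}"
proof -
  have "D M (\<lambda>v. \<exists>t. a < t \<and> t < b \<and> (\<forall>i<n. v i = \<gamma> t ! i))"
    by (intro dints dfn1D[OF assms(2)])
  moreover note map_upt_eq[OF assms(1)]
  ultimately show ?thesis unfolding definable_iff_defl defl_def using assms(1) by (auto simp: map_upt_eq[OF assms(1)] conj_ac)
qed

lemma definable_surface: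
  assumes "\<And>s t. length (\<gamma> s t) = n" "\<And>i. i < n \<Longrightarrow> dfn2 M (\<lambda>s t. \<gamma> s t ! i)"
  shows "definable M n {\<gamma> s t | s t. a < s \<and> s < b \<and> c < t \<and> t < d}"
proof -
  have "D M (\<lambda>v. \<exists>s t. a < s \<and> s < b \<and> c < t \<and> t < d \<and> (\<forall>i<n. v i = \<gamma> s t ! i))"
    by (intro dints dfn2D[OF assms(2)])
  moreover note map_upt_eq[OF assms(1)]
  ultimately show ?thesis unfolding definable_iff_defl defl_def using assms(1) by (auto simp: map_upt_eq[OF assms(1)] conj_ac)
qed

lemma const_cell_function:
  assumes "definable M n C" shows "cell_function M n C (\<lambda>_. c)"
proof -
  note C = assms[unfolded definable_iff_defl]
  have "defl1 M n (\<lambda>x s. x \<in> C \<and> s = c)"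
    unfolding defl1_def by (intro D_conj D_eq DT_var DT_const deflD[OF conjunct2[OF C]])
  then have "D M (\<lambda>v. map v [0..<n + 1] \<in> {x @ [c] | x. x \<in> C})"
    unfolding defl1_def map_upt_snoc by (rule back_subst[of "D M"]) auto
  then have "definable M (n + 1) {x @ [c] | x. x \<in> C}"
    unfolding definable_iff_defl defl_def using C by auto
  then show ?thesis using C unfolding cell_function_def definable_map_def list_continuous_on_def
    by (auto intro: zero_less_one)
qed

lemma singleton_cell: "cell M (replicate (length z) 0) {z}"
proof (induction z rule: rev_induct)
  case Nil
  then show ?case using cell_nil by simp
next
  case (snoc c z)
  from cell_graph[OF snoc, of "\<lambda>_. c"] const_cell_function[OF definable_singleton, of M z c]
  have "cell M (replicate (length z) 0 @ [0]) {x @ [c] | x. x \<in> {z}}" by simp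
  then show ?case by (simp add: replicate_append_same)
qed

lemma definable_projection:
  assumes "definable M (Suc n) X"
  shows "definable M n {y. length y = n \<and> (\<exists>t. y @ [t] \<in> X)}"
proof -
  have G: "defl1 M n (\<lambda>y t. y @ [t] \<in> X)" using defl1_snoc assms unfolding definable_iff_defl by blast
  have "D M (\<lambda>v. \<exists>t. map v [0..<n] @ [t] \<in> X)" by (intro dints defl1D[OF G])
  then show ?thesis unfolding definable_iff_defl defl_def by simp
qed

section \<open>Parametrised cells and the embedding of one-dimensional sets into the line\<close>

context ominimal
begin

text \<open>Definability is required of the graph over X only, since the values of \<open>e\<close>
  elsewhere are arbitrary.\<close>

definition injectable :: "nat \<Rightarrow> 'a list set \<Rightarrow> bool" where
  "injectable n X \<longleftrightarrow> (\<exists>e. defl1 M n (\<lambda>x s. x \<in> X \<and> s = e x) \<and> inj_on e X \<and> (\<forall>x\<in>X. 0 < e x \<and> e x < 1))"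

text \<open>All restrictions of a patch to smaller intervals or boxes are required to be cells, so that it
  can be shrunk until a further coordinate function becomes continuous.\<close>

definition patch1 :: "nat \<Rightarrow> ('a \<Rightarrow> 'a list) \<Rightarrow> 'a \<Rightarrow> 'a \<Rightarrow> bool" where
  "patch1 n \<gamma> a b \<longleftrightarrow> a < b \<and> (\<forall>t. length (\<gamma> t) = n) \<and> (\<forall>i<n. dfn1 M (\<lambda>t. \<gamma> t ! i)) \<and>
     (\<exists>j<n. \<forall>t. a < t \<and> t < b \<longrightarrow> \<gamma> t ! j = t) \<and>
     (\<exists>d. length d = n \<and> sum_list d = 1 \<and>
       (\<forall>a' b'. a \<le> a' \<and> a' < b' \<and> b' \<le> b \<longrightarrow> cell M d {\<gamma> t | t. a' < t \<and> t < b'}))"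

definition patch2 :: "nat \<Rightarrow> ('a \<Rightarrow> 'a \<Rightarrow> 'a list) \<Rightarrow> 'a \<Rightarrow> 'a \<Rightarrow> 'a \<Rightarrow> 'a \<Rightarrow> bool" where
  "patch2 n \<gamma> a b c d \<longleftrightarrow> a < b \<and> c < d \<and> (\<forall>s t. length (\<gamma> s t) = n) \<and> (\<forall>i<n. dfn2 M (\<lambda>s t. \<gamma> s t ! i)) \<and>
     (\<exists>i<n. \<exists>j<n. \<forall>s t. a < s \<and> s < b \<and> c < t \<and> t < d \<longrightarrow> \<gamma> s t ! i = s \<and> \<gamma> s t ! j = t) \<and>
     (\<exists>\<delta>. length \<delta> = n \<and> sum_list \<delta> = 2 \<and>
       (\<forall>a' b' c' d'. a \<le> a' \<and> a' < b' \<and> b' \<le> b \<and> c \<le> c' \<and> c' < d' \<and> d' \<le> d \<longrightarrow>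
          cell M \<delta> {\<gamma> s t | s t. a' < s \<and> s < b' \<and> c' < t \<and> t < d'}))"

lemma dfn_snoc1:
  assumes "\<And>t. length (\<gamma> t) = n" "\<And>i. i < n \<Longrightarrow> dfn1 M (\<lambda>t. \<gamma> t ! i)" "dfn1 M f" "i < Suc n"
  shows "dfn1 M (\<lambda>t. (\<gamma> t @ [f t]) ! i)"
  using assms by (cases "i = n") (auto simp: nth_append)

lemma dfn_snoc2:
  assumes "\<And>s t. length (\<gamma> s t) = n" "\<And>i. i < n \<Longrightarrow> dfn2 M (\<lambda>s t. \<gamma> s t ! i)" "dfn2 M f" "i < Suc n"
  shows "dfn2 M (\<lambda>s t. (\<gamma> s t @ [f s t]) ! i)"
  using assms by (cases "i = n") (auto simp: nth_append)

text \<open>The coordinate j returns the parameter, so f becomes a function of the point, as the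
  construction of cells demands; shrinking the interval to where f is continuous makes its graph a
  cell.\<close>

lemma patch1_extend:
  assumes p: "patch1 n \<gamma> a b" and f: "dfn1 M f"
  shows "\<exists>a' b'. a \<le> a' \<and> a' < b' \<and> b' \<le> b \<and> patch1 (Suc n) (\<lambda>t. \<gamma> t @ [f t]) a' b'"
proof -
  obtain j d where ab: "a < b" and len: "\<And>t. length (\<gamma> t) = n" and dfn: "\<And>i. i < n \<Longrightarrow> dfn1 M (\<lambda>t. \<gamma> t ! i)"
    and j: "j < n" "\<And>t. a < t \<Longrightarrow> t < b \<Longrightarrow> \<gamma> t ! j = t" and d: "length d = n" "sum_list d = 1"
    and cell: "\<And>a' b'. a \<le> a' \<Longrightarrow> a' < b' \<Longrightarrow> b' \<le> b \<Longrightarrow> cell M d {\<gamma> t | t. a' < t \<and> t < b'}"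
    using p unfolding patch1_def by blast
  obtain a1 b1 where 1: "a \<le> a1" "a1 < b1" "b1 \<le> b" "\<And>x. a1 < x \<Longrightarrow> x < b1 \<Longrightarrow> cont f x"
    using continuous_somewhere[OF f ab] by metis
  have "cell M (d @ [0]) {\<gamma> t @ [f t] | t. a' < t \<and> t < b'}" if a': "a1 \<le> a'" "a' < b'" "b' \<le> b1" for a' b'
  proof -
    let ?C = "{\<gamma> t | t. a' < t \<and> t < b'}" and ?F = "\<lambda>z. f (z ! j)"
    have C: "\<And>x. x \<in> ?C \<Longrightarrow> \<exists>t. x = \<gamma> t \<and> a' < t \<and> t < b' \<and> x ! j = t \<and> length x = n"
      using j(2) 1 a' len by fastforce
    have eq: "{x @ [?F x] | x. x \<in> ?C} = {\<gamma> t @ [f t] | t. a' < t \<and> t < b'}"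
    proof -
      have "\<gamma> t ! j = t" if "a' < t" "t < b'" for t using j(2)[of t] 1 a' that by auto
      then show ?thesis by (auto; metis)
    qed
    have "cell_function M (length d) ?C ?F"
      unfolding cell_function_def definable_map_def
    proof (intro conjI)
      have "definable M (Suc n) {\<gamma> t @ [f t] | t. a' < t \<and> t < b'}"
        by (rule definable_curve) (use len dfn_snoc1[OF len dfn f] in auto)
      then show "definable M (length d + 1) {x @ [?F x] | x. x \<in> ?C}" unfolding eq using d by simp
      show "list_continuous_on ?C ?F"
        unfolding list_continuous_on_def
      proof (intro ballI allI impI)
        fix x e assume x: "x \<in> ?C" and e: "(0::'a) < e"
        from C[OF x] have t: "a' < x ! j" "x ! j < b'" "length x = n" by auto
        then have "cont f (x ! j)" using 1(4) a' by auto
        then obtain h where "0 < h" "\<And>y. \<bar>y - x ! j\<bar> < h \<Longrightarrow> \<bar>f y - f (x ! j)\<bar> < e"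
          unfolding cont_def using e by blast
        then show "\<exists>h>0. \<forall>y\<in>?C. (\<forall>i<length x. \<bar>y ! i - x ! i\<bar> < h) \<longrightarrow> \<bar>f (y ! j) - f (x ! j)\<bar> < e"
          using j(1) t(3) by blast
      qed
    qed (use C d in auto)
    from cell_graph[OF cell this] show ?thesis unfolding eq using 1 a' by auto
  qed
  moreover have "\<exists>j<Suc n. \<forall>t. a1 < t \<and> t < b1 \<longrightarrow> (\<gamma> t @ [f t]) ! j = t"
    using j 1 len by (intro exI[of _ j]) (auto simp: nth_append)
  ultimately have "patch1 (Suc n) (\<lambda>t. \<gamma> t @ [f t]) a1 b1"
    unfolding patch1_def using 1(2) len d dfn_snoc1[OF len dfn f]
    by (intro conjI exI[of _ "d @ [0]"]) auto
  then show ?thesis using 1 by blast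
qed

lemma patch2_extend:
  assumes p: "patch2 n \<gamma> a b c d" and f: "dfn2 M f"
  shows "\<exists>a' b' c' d'. a \<le> a' \<and> a' < b' \<and> b' \<le> b \<and> c \<le> c' \<and> c' < d' \<and> d' \<le> d \<and>
    patch2 (Suc n) (\<lambda>s t. \<gamma> s t @ [f s t]) a' b' c' d'"
proof -
  obtain i j \<delta> where ab: "a < b" "c < d" and len: "\<And>s t. length (\<gamma> s t) = n"
    and dfn: "\<And>i. i < n \<Longrightarrow> dfn2 M (\<lambda>s t. \<gamma> s t ! i)"
    and j: "i < n" "j < n" "\<And>s t. a < s \<Longrightarrow> s < b \<Longrightarrow> c < t \<Longrightarrow> t < d \<Longrightarrow> \<gamma> s t ! i = s \<and> \<gamma> s t ! j = t"
    and d: "length \<delta> = n" "sum_list \<delta> = 2"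
    and cell: "\<And>a' b' c' d'. a \<le> a' \<Longrightarrow> a' < b' \<Longrightarrow> b' \<le> b \<Longrightarrow> c \<le> c' \<Longrightarrow> c' < d' \<Longrightarrow> d' \<le> d \<Longrightarrow>
       cell M \<delta> {\<gamma> s t | s t. a' < s \<and> s < b' \<and> c' < t \<and> t < d'}"
    using p unfolding patch2_def by blast
  obtain a1 b1 c1 d1 where 1: "a \<le> a1" "a1 < b1" "b1 \<le> b" "c \<le> c1" "c1 < d1" "d1 \<le> d"
    "\<And>x y. a1 < x \<and> x < b1 \<and> c1 < y \<and> y < d1 \<Longrightarrow> cont2 f x y"
    using continuous_on_subbox[OF f ab] by blast
  have "cell M (\<delta> @ [0]) {\<gamma> s t @ [f s t] | s t. a' < s \<and> s < b' \<and> c' < t \<and> t < d'}"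
    if a': "a1 \<le> a'" "a' < b'" "b' \<le> b1" "c1 \<le> c'" "c' < d'" "d' \<le> d1" for a' b' c' d'
  proof -
    let ?C = "{\<gamma> s t | s t. a' < s \<and> s < b' \<and> c' < t \<and> t < d'}" and ?F = "\<lambda>z. f (z ! i) (z ! j)"
    have ij: "\<gamma> s t ! i = s \<and> \<gamma> s t ! j = t" if "a' < s" "s < b'" "c' < t" "t < d'" for s t
      using j(3)[of s t] 1 a' that by auto
    have C: "\<And>x. x \<in> ?C \<Longrightarrow> a' < x ! i \<and> x ! i < b' \<and> c' < x ! j \<and> x ! j < d' \<and> length x = n"
      using ij len by auto
    have eq: "{x @ [?F x] | x. x \<in> ?C} = {\<gamma> s t @ [f s t] | s t. a' < s \<and> s < b' \<and> c' < t \<and> t < d'}"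
      using ij by (auto; metis)
    have "cell_function M (length \<delta>) ?C ?F"
      unfolding cell_function_def definable_map_def
    proof (intro conjI)
      have "definable M (Suc n) {\<gamma> s t @ [f s t] | s t. a' < s \<and> s < b' \<and> c' < t \<and> t < d'}"
        by (rule definable_surface) (use len dfn_snoc2[OF len dfn f] in auto)
      then show "definable M (length \<delta> + 1) {x @ [?F x] | x. x \<in> ?C}" unfolding eq using d by simp
      show "list_continuous_on ?C ?F"
        unfolding list_continuous_on_def
      proof (intro ballI allI impI)
        fix x e assume x: "x \<in> ?C" and e: "(0::'a) < e"
        note t = C[OF x]
        then have "cont2 f (x ! i) (x ! j)" using 1(7) a' by auto
        then obtain h where "0 < h"
          "\<And>y z. \<bar>y - x ! i\<bar> < h \<Longrightarrow> \<bar>z - x ! j\<bar> < h \<Longrightarrow> \<bar>f y z - f (x ! i) (x ! j)\<bar> < e"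
          unfolding cont2_def using e by blast
        then show "\<exists>h>0. \<forall>y\<in>?C. (\<forall>i<length x. \<bar>y ! i - x ! i\<bar> < h) \<longrightarrow> \<bar>f (y ! i) (y ! j) - f (x ! i) (x ! j)\<bar> < e"
          using j(1,2) t by blast
      qed
    qed (use C d in auto)
    from cell_graph[OF cell this] show ?thesis unfolding eq using 1 a' by auto
  qed
  moreover have "\<exists>i<Suc n. \<exists>j<Suc n. \<forall>s t. a1 < s \<and> s < b1 \<and> c1 < t \<and> t < d1 \<longrightarrow>
      (\<gamma> s t @ [f s t]) ! i = s \<and> (\<gamma> s t @ [f s t]) ! j = t"
    using j 1 len by (intro exI[of _ i] exI[of _ j] conjI) (auto simp: nth_append)
  ultimately have "patch2 (Suc n) (\<lambda>s t. \<gamma> s t @ [f s t]) a1 b1 c1 d1"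
    unfolding patch2_def using 1(2,5) len d dfn_snoc2[OF len dfn f]
    by (intro conjI exI[of _ "\<delta> @ [0]"]) auto
  then show ?thesis using 1 by blast
qed

lemma patch1_times_interval:
  assumes p: "patch1 n \<gamma> a b" and "c < d"
  shows "patch2 (Suc n) (\<lambda>s t. \<gamma> s @ [t]) a b c d"
proof -
  obtain j \<delta> where ab: "a < b" and len: "\<And>t. length (\<gamma> t) = n" and dfn: "\<And>i. i < n \<Longrightarrow> dfn1 M (\<lambda>t. \<gamma> t ! i)"
    and j: "j < n" "\<And>t. a < t \<Longrightarrow> t < b \<Longrightarrow> \<gamma> t ! j = t" and d: "length \<delta> = n" "sum_list \<delta> = 1"
    and cell: "\<And>a' b'. a \<le> a' \<Longrightarrow> a' < b' \<Longrightarrow> b' \<le> b \<Longrightarrow> cell M \<delta> {\<gamma> t | t. a' < t \<and> t < b'}"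
    using p unfolding patch1_def by blast
  have "cell M (\<delta> @ [1]) {\<gamma> s @ [t] | s t. a' < s \<and> s < b' \<and> c' < t \<and> t < d'}"
    if a': "a \<le> a'" "a' < b'" "b' \<le> b" "c \<le> c'" "c' < d'" "d' \<le> d" for a' b' c' d'
  proof -
    let ?C = "{\<gamma> t | t. a' < t \<and> t < b'}"
    have "definable M n ?C" by (rule definable_curve[OF len dfn])
    then have cf: "cell_function M (length \<delta>) ?C (\<lambda>_. k)" for k using const_cell_function d by simp
    have "cell M (\<delta> @ [1]) {x @ [t] | x t. x \<in> ?C \<and> (\<forall>f\<in>set_option (Some (\<lambda>_. c')). f x < t) \<and>
       (\<forall>g\<in>set_option (Some (\<lambda>_. d')). t < g x)}"
      by (rule cell_band[OF cell[OF a'(1-3)]]) (use cf a' in auto)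
    also have "{x @ [t] | x t. x \<in> ?C \<and> (\<forall>f\<in>set_option (Some (\<lambda>_. c')). f x < t) \<and>
       (\<forall>g\<in>set_option (Some (\<lambda>_. d')). t < g x)} = {\<gamma> s @ [t] | s t. a' < s \<and> s < b' \<and> c' < t \<and> t < d'}"
      by auto
    finally show ?thesis .
  qed
  moreover have "dfn2 M (\<lambda>s t. (\<gamma> s @ [t]) ! i)" if "i < Suc n" for i
  proof (rule dfn_snoc2[of "\<lambda>s t. \<gamma> s" n "\<lambda>s t. t"])
    show "dfn2 M (\<lambda>s t. \<gamma> s ! i)" if "i < n" for i unfolding dfn2_def by (intro dfn1D[OF dfn[OF that]] dints)
    show "dfn2 M (\<lambda>(s::'a) t. t)" unfolding dfn2_def by (intro dints)
  qed (use len that in auto)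
  moreover have "\<exists>i<Suc n. \<exists>j<Suc n. \<forall>s t. a < s \<and> s < b \<and> c < t \<and> t < d \<longrightarrow>
      (\<gamma> s @ [t]) ! i = s \<and> (\<gamma> s @ [t]) ! j = t"
    using j len by (intro exI[of _ j] exI[of _ n] conjI) (auto simp: nth_append)
  ultimately show ?thesis
    unfolding patch2_def using ab \<open>c < d\<close> len d
    by (intro conjI exI[of _ "\<delta> @ [1]"]) auto
qed

text \<open>Over a patch in an infinite projection the last coordinate is chosen definably, and
  shrinking restores continuity. A finite projection leaves one infinite fibre, which contains a
  vertical interval.\<close>

lemma infinite_contains_patch1:
  assumes "definable M n X" "infinite X"
  shows "\<exists>\<gamma> a b. patch1 n \<gamma> a b \<and> (\<forall>t. a < t \<and> t < b \<longrightarrow> \<gamma> t \<in> X)"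
  using assms
proof (induction n arbitrary: X)
  case 0
  then have "X \<subseteq> {[]}" unfolding definable_iff_defl by auto
  then show ?case using 0 finite_subset by blast
next
  case (Suc n)
  note X = Suc.prems(1)[unfolded definable_iff_defl]
  have G: "defl1 M n (\<lambda>y t. y @ [t] \<in> X)" using X defl1_snoc by blast
  define Z where "Z = {y. length y = n \<and> (\<exists>t. y @ [t] \<in> X)}"
  have Z: "definable M n Z" unfolding Z_def by (rule definable_projection[OF Suc.prems(1)])
  show ?case
  proof (cases "finite Z")
    case False
    from Suc.IH[OF Z this] obtain \<gamma> a b where
      p: "patch1 n \<gamma> a b" and inZ: "\<And>t. a < t \<Longrightarrow> t < b \<Longrightarrow> \<gamma> t \<in> Z" by blast
    have len: "\<And>t. length (\<gamma> t) = n" and dfn: "\<And>i. i < n \<Longrightarrow> dfn1 M (\<lambda>t. \<gamma> t ! i)"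
      using p unfolding patch1_def by auto
    define f where "f t = choice (\<lambda>s. \<gamma> t @ [s] \<in> X)" for t
    have S: "def2 M (\<lambda>t s. \<gamma> t @ [s] \<in> X)"
    proof -
      have "D M (\<lambda>v. map (\<lambda>i. \<gamma> (v 0) ! i) [0..<n] @ [v 1] \<in> X)"
        by (intro defl1D[OF G] dints dfn1D[OF dfn])
      then show ?thesis unfolding def2_def by (simp add: nth_map_self[OF len])
    qed
    have f: "dfn1 M f" unfolding dfn1_def f_def by (intro dints def2D[OF S])
    have "\<gamma> t @ [f t] \<in> X" if "a < t" "t < b" for t
    proof -
      have "\<exists>s. \<gamma> t @ [s] \<in> X" using inZ[OF that] by (simp add: Z_def)
      moreover have "def1 M (\<lambda>s. \<gamma> t @ [s] \<in> X)" unfolding def1_def by (intro dints def2D[OF S])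
      ultimately show ?thesis unfolding f_def using choice_works[of "\<lambda>s. \<gamma> t @ [s] \<in> X"] by blast
    qed
    moreover obtain a' b' where "a \<le> a'" "b' \<le> b" "patch1 (Suc n) (\<lambda>t. \<gamma> t @ [f t]) a' b'"
      using patch1_extend[OF p f] by blast
    ultimately show ?thesis by (intro exI[of _ "\<lambda>t. \<gamma> t @ [f t]"] exI[of _ a'] exI[of _ b']) force
  next
    case True
    have "X \<subseteq> (\<Union>z\<in>Z. (\<lambda>t. z @ [t]) ` {t. z @ [t] \<in> X})"
    proof
      fix x assume x: "x \<in> X"
      then have "length x = Suc n" using X by blast
      then have "x = butlast x @ [last x]" "length (butlast x) = n" by (auto intro!: append_butlast_last_id[symmetric])
      then have "butlast x @ [last x] \<in> X" "length (butlast x) = n" using x by simp_all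
      then have "butlast x \<in> Z" "butlast x @ [last x] \<in> X" unfolding Z_def by blast+
      then show "x \<in> (\<Union>z\<in>Z. (\<lambda>t. z @ [t]) ` {t. z @ [t] \<in> X})"
        using \<open>x = butlast x @ [last x]\<close> by blast
    qed
    then have "infinite (\<Union>z\<in>Z. (\<lambda>t. z @ [t]) ` {t. z @ [t] \<in> X})" using Suc.prems(2) finite_subset by blast
    then obtain z where z: "z \<in> Z" "infinite {t. z @ [t] \<in> X}" using True by blast
    have len: "length z = n" using z(1) by (simp add: Z_def)
    have "def1 M (\<lambda>t. z @ [t] \<in> X)"
    proof -
      have "D M (\<lambda>v. map (\<lambda>i. z ! i) [0..<n] @ [v 0] \<in> X)" by (intro defl1D[OF G] dints)
      then show ?thesis unfolding def1_def by (simp add: nth_map_self[OF len])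
    qed
    from iffD1[OF infinite_iff_interval[OF this] z(2)]
    obtain a b where ab: "a < b" "\<And>t. a < t \<Longrightarrow> t < b \<Longrightarrow> z @ [t] \<in> X" by blast
    have "cell M (replicate n 0 @ [1]) {z @ [t] | t. a' < t \<and> t < b'}" if "a' < b'" for a' b'
    proof -
      have c: "cell M (replicate n 0) {z}" using singleton_cell[of M z] len by simp
      have "definable M n {z}" using definable_singleton[of M z] by (simp add: len)
      then have cf: "cell_function M (length (replicate n (0::nat))) {z} (\<lambda>_. k)" for k using const_cell_function by simp
      have "cell M (replicate n 0 @ [1]) {x @ [t] | x t. x \<in> {z} \<and> (\<forall>f\<in>set_option (Some (\<lambda>_. a')). f x < t) \<and>
         (\<forall>g\<in>set_option (Some (\<lambda>_. b')). t < g x)}"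
        by (rule cell_band[OF c]) (use cf that in auto)
      then show ?thesis by simp
    qed
    moreover have "dfn1 M (\<lambda>t. (z @ [t]) ! i)" if "i < Suc n" for i
      by (rule dfn_snoc1[of "\<lambda>t. z" n "\<lambda>t. t"]) (use that len in \<open>auto simp: dfn1_def intro: dints\<close>)
    ultimately have "patch1 (Suc n) (\<lambda>t. z @ [t]) a b"
      unfolding patch1_def using ab(1) len
      by (intro conjI exI[of _ "replicate n 0 @ [1]"]) (auto simp: sum_list_replicate nth_append intro!: exI[of _ n])
    then show ?thesis using ab(2) by (intro exI[of _ "\<lambda>t. z @ [t]"] exI[of _ a] exI[of _ b]) auto
  qed
qed

text \<open>A patch in the projection lifts by definable choice. If the projection injects into
  (0,1) instead, X turns into a planar relation \<open>E\<close>. With finitely many infinite fibres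
  it is thin and injects; otherwise it contains a box, whose first side pulls back to an infinite
  subset of the projection, and a patch there times the second side lies in X.\<close>

lemma injectable_or_patch2:
  assumes "definable M n X" "\<not> injectable n X"
  shows "\<exists>\<gamma> a b c d. patch2 n \<gamma> a b c d \<and> (\<forall>s t. a < s \<and> s < b \<and> c < t \<and> t < d \<longrightarrow> \<gamma> s t \<in> X)"
  using assms
proof (induction n arbitrary: X)
  case 0
  note X = 0(1)[unfolded definable_iff_defl]
  have "injectable 0 X" unfolding injectable_def
  proof (intro exI[of _ "\<lambda>_. 1 / 2"] conjI)
    show "defl1 M 0 (\<lambda>x s. x \<in> X \<and> s = 1 / 2)"
      unfolding defl1_def by (intro D_conj deflD[OF conjunct2[OF X]] dints)
    show "inj_on (\<lambda>_. 1 / 2) X" using X by (intro inj_onI) (metis length_0_conv)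
  qed auto
  then show ?case using 0(2) by blast
next
  case (Suc n)
  note X = Suc.prems(1)[unfolded definable_iff_defl]
  have G: "defl1 M n (\<lambda>y t. y @ [t] \<in> X)" using X defl1_snoc by blast
  define Y where "Y = {y. length y = n \<and> (\<exists>t. y @ [t] \<in> X)}"
  have Y: "definable M n Y" unfolding Y_def by (rule definable_projection[OF Suc.prems(1)])
  show ?case
  proof (cases "injectable n Y")
    case False
    from Suc.IH[OF Y this] obtain \<gamma> a b c d where
      p: "patch2 n \<gamma> a b c d" and inY: "\<And>s t. a < s \<Longrightarrow> s < b \<Longrightarrow> c < t \<Longrightarrow> t < d \<Longrightarrow> \<gamma> s t \<in> Y" by blast
    have len: "\<And>s t. length (\<gamma> s t) = n" and dfn: "\<And>i. i < n \<Longrightarrow> dfn2 M (\<lambda>s t. \<gamma> s t ! i)"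
      using p unfolding patch2_def by auto
    define f where "f s t = choice (\<lambda>u. \<gamma> s t @ [u] \<in> X)" for s t
    have S: "def3 M (\<lambda>s t u. \<gamma> s t @ [u] \<in> X)"
    proof -
      have "D M (\<lambda>v. map (\<lambda>i. \<gamma> (v 0) (v 1) ! i) [0..<n] @ [v 2] \<in> X)"
        by (intro defl1D[OF G] dints dfn2D[OF dfn])
      then show ?thesis unfolding def3_def by (simp add: nth_map_self[OF len])
    qed
    have f: "dfn2 M f" unfolding dfn2_def f_def by (intro dints def3D[OF S])
    have fX: "\<gamma> s t @ [f s t] \<in> X" if "a < s" "s < b" "c < t" "t < d" for s t
    proof -
      have "\<exists>u. \<gamma> s t @ [u] \<in> X" using inY[OF that] by (simp add: Y_def)
      moreover have "def1 M (\<lambda>u. \<gamma> s t @ [u] \<in> X)" unfolding def1_def by (intro dints def3D[OF S])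
      ultimately show ?thesis unfolding f_def using choice_works[of "\<lambda>u. \<gamma> s t @ [u] \<in> X"] by blast
    qed
    obtain a' b' c' d' where 1: "a \<le> a'" "b' \<le> b" "c \<le> c'" "d' \<le> d"
      "patch2 (Suc n) (\<lambda>s t. \<gamma> s t @ [f s t]) a' b' c' d'"
      using patch2_extend[OF p f] by blast
    have "\<forall>s t. a' < s \<and> s < b' \<and> c' < t \<and> t < d' \<longrightarrow> \<gamma> s t @ [f s t] \<in> X" using fX 1 by auto
    with 1(5) show ?thesis by blast
  next
    case True
    then obtain e where e: "defl1 M n (\<lambda>x s. x \<in> Y \<and> s = e x)" "inj_on e Y" "\<And>x. x \<in> Y \<Longrightarrow> 0 < e x \<and> e x < 1"
      unfolding injectable_def by blast
    define E where "E s t \<longleftrightarrow> (\<exists>y. length y = n \<and> ((y \<in> Y \<and> s = e y) \<and> y @ [t] \<in> X))" for s t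
    have E: "def2 M E" unfolding def2_def E_def by (rule D_list_ex) (intro D_conj defl1D[OF e(1)] defl1D[OF G] dints)
    define E' where "E' s u \<longleftrightarrow> (\<exists>t. E s t \<and> u = squash t)" for s u
    have E': "def2 M E'" unfolding def2_def E'_def by (intro dints def2D[OF E] dfn1D[OF dfn1_squash])
    have EX: "E (e y) t \<longleftrightarrow> y @ [t] \<in> X" if "y \<in> Y" for y t
    proof
      assume "E (e y) t"
      then obtain y' where "y' \<in> Y" "e y = e y'" "y' @ [t] \<in> X" unfolding E_def by blast
      then show "y @ [t] \<in> X" using inj_onD[OF e(2)] that by metis
    qed (use that in \<open>auto simp: E_def Y_def\<close>)
    show ?thesis
    proof (cases "finite {s. infinite {u. E' s u}}")
      case True
      have "0 < x \<and> x < 1 \<and> 0 < y \<and> y < 1" if "E' x y" for x y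
        using that e(3) squash_bounds unfolding E'_def E_def by auto
      from thin_set_injects[OF E' this True] obtain g where
        g: "dfn2 M g" "\<And>x y. E' x y \<Longrightarrow> 0 < g x y \<and> g x y < 1"
          "\<And>x y x' y'. E' x y \<Longrightarrow> E' x' y' \<Longrightarrow> g x y = g x' y' \<Longrightarrow> x = x' \<and> y = y'" by blast
      define e' where "e' z = g (e (butlast z)) (squash (last z))" for z
      have XE: "butlast z \<in> Y \<and> z = butlast z @ [last z] \<and> E' (e (butlast z)) (squash (last z))" if "z \<in> X" for z
      proof -
        have "length z = Suc n" using X that by blast
        then have z: "z = butlast z @ [last z]" "length (butlast z) = n" by (auto intro!: append_butlast_last_id[symmetric])
        then have "butlast z @ [last z] \<in> X" using that by simp
        then have y: "butlast z \<in> Y" using z(2) unfolding Y_def by blast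
        then have "E (e (butlast z)) (last z)" using EX \<open>butlast z @ [last z] \<in> X\<close> by blast
        then show ?thesis using z(1) y unfolding E'_def by blast
      qed
      have "injectable (Suc n) X" unfolding injectable_def
      proof (intro exI[of _ e'] conjI ballI)
        have "D M (\<lambda>v. (\<exists>s. (map v [0..<n] \<in> Y \<and> s = e (map v [0..<n])) \<and> v (Suc n) = g s (squash (v n))) \<and>
            map v [0..<n] @ [v n] \<in> X)"
          by (intro D_conj D_ex defl1D[OF e(1)] D_eq dfn2D[OF g(1)] dfn1D[OF dfn1_squash] defl1D[OF G] DT_var)
        moreover have "map v [0..<n] \<in> Y" if "map v [0..<n] @ [v n] \<in> X" for v
          using XE[OF that] by simp
        ultimately show "defl1 M (Suc n) (\<lambda>x s. x \<in> X \<and> s = e' x)"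
          unfolding defl1_def by (elim back_subst[of "D M"]) (auto simp: e'_def fun_eq_iff)
        show "inj_on e' X"
        proof (rule inj_onI)
          fix x y assume xy: "x \<in> X" "y \<in> X" "e' x = e' y"
          then have "e (butlast x) = e (butlast y) \<and> squash (last x) = squash (last y)"
            using g(3) XE[OF xy(1)] XE[OF xy(2)] unfolding e'_def by blast
          then have "butlast x = butlast y" "last x = last y"
            using inj_onD[OF e(2)] XE[OF xy(1)] XE[OF xy(2)] injD[OF inj_squash] by blast+
          then show "x = y" using XE[OF xy(1)] XE[OF xy(2)] by metis
        qed
        fix x assume "x \<in> X"
        then show "0 < e' x" "e' x < 1" using g(2) XE unfolding e'_def by blast+
      qed
      then show ?thesis using Suc.prems(2) by blast
    next
      case False
      have "infinite {t. E s t}" if "infinite {u. E' s u}" for s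
      proof -
        have "{u. E' s u} = squash ` {t. E s t}" unfolding E'_def by auto
        then show ?thesis using that by auto
      qed
      then have "{s. infinite {u. E' s u}} \<subseteq> {s. infinite {t. E s t}}" by blast
      then have "infinite {s. infinite {t. E s t}}" using False finite_subset by blast
      from iffD1[OF infinite_iff_interval[OF D_infinite[OF E]] this]
      obtain s0 s1 where "s0 < s1" "\<And>s. s0 < s \<Longrightarrow> s < s1 \<Longrightarrow> infinite {t. E s t}" by blast
      from box_in_infinite_fibres[OF E this] obtain a b c d where
        box: "a < b" "c < d" "\<And>s t. a < s \<Longrightarrow> s < b \<Longrightarrow> c < t \<Longrightarrow> t < d \<Longrightarrow> E s t" by blast
      define Y0 where "Y0 = {y. y \<in> Y \<and> a < e y \<and> e y < b}"
      have "D M (\<lambda>v. \<exists>s. (map v [0..<n] \<in> Y \<and> s = e (map v [0..<n])) \<and> a < s \<and> s < b)"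
        by (intro D_conj D_ex defl1D[OF e(1)] dints)
      then have dY0: "definable M n Y0" unfolding definable_iff_defl defl_def
        using Y[unfolded definable_iff_defl] by (auto simp: Y0_def)
      obtain t0 where t0: "c < t0" "t0 < d" using dense[OF box(2)] by blast
      have "{a<..<b} \<subseteq> e ` Y0"
      proof
        fix s assume s: "s \<in> {a<..<b}"
        then have "E s t0" using box(3) t0 by auto
        then obtain y where "y \<in> Y" "s = e y" unfolding E_def by blast
        then show "s \<in> e ` Y0" using s by (auto simp: Y0_def)
      qed
      then have "infinite Y0" using infinite_Ioo[OF box(1)] finite_surj by blast
      from infinite_contains_patch1[OF dY0 this] obtain \<gamma> a' b' where
        p: "patch1 n \<gamma> a' b'" and inY0: "\<And>t. a' < t \<Longrightarrow> t < b' \<Longrightarrow> \<gamma> t \<in> Y0" by blast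
      have "\<gamma> s @ [t] \<in> X" if "a' < s" "s < b'" "c < t" "t < d" for s t
      proof -
        have y: "\<gamma> s \<in> Y" "a < e (\<gamma> s)" "e (\<gamma> s) < b" using inY0[OF that(1,2)] by (auto simp: Y0_def)
        then show ?thesis using EX[OF y(1)] box(3) that by blast
      qed
      then show ?thesis using patch1_times_interval[OF p box(2)] by blast
    qed
  qed
qed

lemma one_dimensional_injectable:
  assumes "definable M n X" "o_dim M X \<le> 1"
  shows "injectable n X"
proof (rule ccontr)
  assume "\<not> injectable n X"
  from injectable_or_patch2[OF assms(1) this] obtain \<gamma> a b c d where
    p: "patch2 n \<gamma> a b c d" and inX: "\<And>s t. a < s \<and> s < b \<and> c < t \<and> t < d \<Longrightarrow> \<gamma> s t \<in> X" by blast
  then obtain \<delta> where "sum_list \<delta> = 2" "cell M \<delta> {\<gamma> s t | s t. a < s \<and> s < b \<and> c < t \<and> t < d}"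
    unfolding patch2_def by blast
  moreover have "{\<gamma> s t | s t. a < s \<and> s < b \<and> c < t \<and> t < d} \<subseteq> X" using inX by blast
  ultimately have "ereal (real 2) \<le> o_dim M X"
    unfolding o_dim_def by (intro Sup_upper) (metis (mono_tags, lifting) mem_Collect_eq)
  then show False using assms(2) by (metis ereal_less_eq(3) numeral_le_one_iff of_nat_numeral one_ereal_def order_trans semiring_norm(69))
qed

end

section \<open>Definable filters of a one-dimensional lattice\<close>

definition right_germ :: "'a::linordered_field \<Rightarrow> ('a \<Rightarrow> bool) \<Rightarrow> bool" where
  "right_germ c P \<longleftrightarrow> (\<exists>d>c. \<forall>t. c < t \<and> t < d \<longrightarrow> P t)"

definition left_germ :: "'a::linordered_field \<Rightarrow> ('a \<Rightarrow> bool) \<Rightarrow> bool" where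
  "left_germ c P \<longleftrightarrow> (\<exists>d<c. \<forall>t. d < t \<and> t < c \<longrightarrow> P t)"

text \<open>The closure properties shared by evaluation at a point and the two one-sided germs, so
  that all kinds of codes are treated at once.\<close>

definition germ_operator :: "(('a \<Rightarrow> bool) \<Rightarrow> bool) \<Rightarrow> bool" where
  "germ_operator G \<longleftrightarrow> (\<forall>P. G P \<longrightarrow> (\<exists>t. P t)) \<and> (\<forall>P Q. G P \<longrightarrow> (\<forall>t. P t \<longrightarrow> Q t) \<longrightarrow> G Q) \<and>
     (\<forall>P Q. G P \<longrightarrow> G Q \<longrightarrow> G (\<lambda>t. P t \<and> Q t))"

lemma germ_operatorD:
  assumes "germ_operator G"
  shows "G P \<Longrightarrow> \<exists>t. P t" "G P \<Longrightarrow> (\<And>t. P t \<Longrightarrow> Q t) \<Longrightarrow> G Q" "G P \<Longrightarrow> G Q \<Longrightarrow> G (\<lambda>t. P t \<and> Q t)"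
  using assms unfolding germ_operator_def by blast+

lemma germ_operator_right: "germ_operator (right_germ c)"
  unfolding germ_operator_def
proof (intro conjI allI impI)
  fix P Q assume "right_germ c P" "right_germ c Q"
  then obtain d d' where "d > c" "\<forall>t. c < t \<and> t < d \<longrightarrow> P t" "d' > c" "\<forall>t. c < t \<and> t < d' \<longrightarrow> Q t"
    unfolding right_germ_def by blast
  then show "right_germ c (\<lambda>t. P t \<and> Q t)" unfolding right_germ_def by (intro exI[of _ "min d d'"]) auto
qed (unfold right_germ_def, use dense in blast, blast)

lemma germ_operator_left: "germ_operator (left_germ c)"
  unfolding germ_operator_def
proof (intro conjI allI impI)
  fix P Q assume "left_germ c P" "left_germ c Q"
  then obtain d d' where "d < c" "\<forall>t. d < t \<and> t < c \<longrightarrow> P t" "d' < c" "\<forall>t. d' < t \<and> t < c \<longrightarrow> Q t"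
    unfolding left_germ_def by blast
  then show "left_germ c (\<lambda>t. P t \<and> Q t)" unfolding left_germ_def by (intro exI[of _ "max d d'"]) auto
qed (unfold left_germ_def, use dense in blast, blast)

text \<open>Definability is assumed of the order; joins and meets therefore enter definable
  predicates through their characterisation by \<open>le\<close>.\<close>

locale unit_interval_lattice = ominimal M
  for M :: "('f, 'r, 'a::linordered_field) expansion" +
  fixes S :: "'a set" and le :: "'a \<Rightarrow> 'a \<Rightarrow> bool" and jn mt :: "'a \<Rightarrow> 'a \<Rightarrow> 'a" and bt tp :: 'a
  assumes le_in: "le x y \<Longrightarrow> x \<in> S \<and> y \<in> S"
    and def_le: "def2 M le"
    and bounds: "x \<in> S \<Longrightarrow> 0 < x \<and> x < 1"
    and le_rfl: "x \<in> S \<Longrightarrow> le x x"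
    and le_asym: "le x y \<Longrightarrow> le y x \<Longrightarrow> x = y"
    and le_tr: "le x y \<Longrightarrow> le y z \<Longrightarrow> le x z"
    and jn_in: "x \<in> S \<Longrightarrow> y \<in> S \<Longrightarrow> jn x y \<in> S"
    and jn_l: "x \<in> S \<Longrightarrow> y \<in> S \<Longrightarrow> le x (jn x y)"
    and jn_r: "x \<in> S \<Longrightarrow> y \<in> S \<Longrightarrow> le y (jn x y)"
    and jn_least: "le x z \<Longrightarrow> le y z \<Longrightarrow> le (jn x y) z"
    and mt_in: "x \<in> S \<Longrightarrow> y \<in> S \<Longrightarrow> mt x y \<in> S"
    and mt_l: "x \<in> S \<Longrightarrow> y \<in> S \<Longrightarrow> le (mt x y) x"
    and mt_r: "x \<in> S \<Longrightarrow> y \<in> S \<Longrightarrow> le (mt x y) y"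
    and mt_greatest: "le z x \<Longrightarrow> le z y \<Longrightarrow> le z (mt x y)"
    and distr: "x \<in> S \<Longrightarrow> y \<in> S \<Longrightarrow> z \<in> S \<Longrightarrow> mt x (jn y z) = jn (mt x y) (mt x z)"
    and bt_in: "bt \<in> S" and bt_le: "x \<in> S \<Longrightarrow> le bt x"
    and tp_in: "tp \<in> S" and tp_ge: "x \<in> S \<Longrightarrow> le x tp"
begin

lemma def_S: "def1 M (\<lambda>x. x \<in> S)"
proof -
  have "def1 M (\<lambda>x. le x x)" unfolding def1_def by (intro dints def2D[OF def_le])
  moreover have "(\<lambda>x. le x x) = (\<lambda>x. x \<in> S)" using le_in le_rfl by blast
  ultimately show ?thesis by simp
qed

lemma le_mt_iff: "x \<in> S \<Longrightarrow> y \<in> S \<Longrightarrow> le w (mt x y) \<longleftrightarrow> le w x \<and> le w y"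
  using mt_l mt_r mt_greatest le_tr by blast

lemma jn_mono: "le x x' \<Longrightarrow> le y y' \<Longrightarrow> le (jn x y) (jn x' y')"
  using jn_l jn_r jn_least le_tr le_in by meson

text \<open>Distributivity as a case distinction: an element below a join is the join of its meets
  with the two parts.\<close>

lemma le_of_le_jn:
  assumes "le w (jn x y)" "le (mt w x) z" "le (mt w y) z" "x \<in> S" "y \<in> S"
  shows "le w z"
proof -
  have w: "w \<in> S" using assms(1) le_in by blast
  have "le w (mt w (jn x y))" using assms(1) w le_rfl mt_greatest by blast
  also have "mt w (jn x y) = jn (mt w x) (mt w y)" using distr w assms by blast
  finally have "le w (jn (mt w x) (mt w y))" .
  moreover have "le (jn (mt w x) (mt w y)) z" using assms jn_least by blast
  ultimately show ?thesis by (rule le_tr)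
qed

section \<open>Definable filters and their congruences\<close>

definition dfilter :: "'a set \<Rightarrow> bool" where
  "dfilter f \<longleftrightarrow> def1 M (\<lambda>x. x \<in> f) \<and> f \<subseteq> S \<and> tp \<in> f \<and> (\<forall>x\<in>f. \<forall>y. le x y \<longrightarrow> y \<in> f) \<and>
     (\<forall>x\<in>f. \<forall>y\<in>f. mt x y \<in> f)"

lemma dfilterD:
  assumes "dfilter f"
  shows "def1 M (\<lambda>x. x \<in> f)" "x \<in> f \<Longrightarrow> x \<in> S" "tp \<in> f" "x \<in> f \<Longrightarrow> le x y \<Longrightarrow> y \<in> f"
    "x \<in> f \<Longrightarrow> y \<in> f \<Longrightarrow> mt x y \<in> f"
  using assms unfolding dfilter_def by blast+

definition up :: "'a \<Rightarrow> 'a set" where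
  "up x = {y. le x y}"

lemma dfilter_up: "x \<in> S \<Longrightarrow> dfilter (up x)"
  unfolding dfilter_def up_def
proof (intro conjI)
  show "def1 M (\<lambda>y. y \<in> {y. le x y})" unfolding mem_Collect_eq def1_def by (intro dints def2D[OF def_le])
qed (use le_in tp_ge le_tr mt_greatest in auto)

text \<open>Stands for membership of the join in f, phrased with common upper bounds so that
  definability follows from that of \<open>le\<close> and f.\<close>

definition ujn :: "'a set \<Rightarrow> 'a \<Rightarrow> 'a \<Rightarrow> bool" where
  "ujn f a b \<longleftrightarrow> (\<forall>z. le a z \<and> le b z \<longrightarrow> z \<in> f)"

lemma ujn_iff:
  assumes "dfilter f" "a \<in> S" "b \<in> S" shows "ujn f a b \<longleftrightarrow> jn a b \<in> f"
  unfolding ujn_def using dfilterD(4)[OF assms(1)] jn_l jn_r jn_least assms(2,3) by blast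

lemma def_ujn: "dfilter f \<Longrightarrow> def2 M (ujn f)"
  unfolding ujn_def def2_def by (intro dints def2D[OF def_le] def1D[OF dfilterD(1)])

text \<open>The congruence that collapses the filter \<open>f\<close> to the top element.\<close>

definition eqv :: "'a set \<Rightarrow> 'a \<Rightarrow> 'a \<Rightarrow> bool" where
  "eqv f a b \<longleftrightarrow> (\<exists>x. x \<in> f \<and> (\<forall>w. le w x \<longrightarrow> (le w a \<longleftrightarrow> le w b)))"

lemma def_eqv: "dfilter f \<Longrightarrow> def2 M (eqv f)"
  unfolding eqv_def def2_def by (intro dints def2D[OF def_le] def1D[OF dfilterD(1)])

lemma eqv_refl: "dfilter f \<Longrightarrow> eqv f a a"
  unfolding eqv_def using dfilterD(3) by blast

lemma eqv_sym: "eqv f a b \<Longrightarrow> eqv f b a"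
  unfolding eqv_def by blast

lemma eqv_trans:
  assumes f: "dfilter f" and "eqv f a b" "eqv f b c" shows "eqv f a c"
proof -
  obtain x y where x: "x \<in> f" "\<And>w. le w x \<Longrightarrow> le w a \<longleftrightarrow> le w b" and y: "y \<in> f" "\<And>w. le w y \<Longrightarrow> le w b \<longleftrightarrow> le w c"
    using assms(2,3) unfolding eqv_def by blast
  have "mt x y \<in> f" using dfilterD(5)[OF f] x y by blast
  moreover have "le w (mt x y) \<Longrightarrow> le w a \<longleftrightarrow> le w c" for w
    using x(2)[of w] y(2)[of w] le_mt_iff[of x y w] dfilterD(2)[OF f] x(1) y(1) by blast
  ultimately show ?thesis unfolding eqv_def by blast
qed

text \<open>The meet w of \<open>jn a b\<close> with the witnesses x and y of the two congruences
  lies in f. It splits into a part below a and x and a part below b and y, and these parts are below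
  a' and b'.\<close>

lemma jn_eqv_mem:
  assumes f: "dfilter f" and S: "a \<in> S" "b \<in> S" "a' \<in> S" "b' \<in> S"
    and "eqv f a a'" "eqv f b b'" "jn a b \<in> f"
  shows "jn a' b' \<in> f"
proof -
  obtain x y where x: "x \<in> f" "\<And>w. le w x \<Longrightarrow> le w a \<longleftrightarrow> le w a'" and y: "y \<in> f" "\<And>w. le w y \<Longrightarrow> le w b \<longleftrightarrow> le w b'"
    using assms(6,7) unfolding eqv_def by blast
  define w where "w = mt (jn a b) (mt x y)"
  have xyS: "x \<in> S" "y \<in> S" "mt x y \<in> S" "jn a b \<in> S" using dfilterD(2)[OF f] x(1) y(1) mt_in jn_in S by blast+
  have wf: "w \<in> f" unfolding w_def using dfilterD(5)[OF f] x(1) y(1) assms(8) by blast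
  have w: "le w (jn a b)" "le w x" "le w y" "w \<in> S"
    unfolding w_def using mt_l mt_r le_tr xyS mt_in by meson+
  have "le w (jn a' b')"
  proof (rule le_of_le_jn[OF w(1) _ _ S(1,2)])
    have "le (mt w a) x" "le (mt w a) a" using mt_l[OF w(4) S(1)] mt_r[OF w(4) S(1)] w(2) le_tr by blast+
    then show "le (mt w a) (jn a' b')" using x(2) jn_l[OF S(3,4)] le_tr by blast
    have "le (mt w b) y" "le (mt w b) b" using mt_l[OF w(4) S(2)] mt_r[OF w(4) S(2)] w(3) le_tr by blast+
    then show "le (mt w b) (jn a' b')" using y(2) jn_r[OF S(3,4)] le_tr by blast
  qed
  then show ?thesis using dfilterD(4)[OF f wf] by blast
qed

lemma jn_self: "a \<in> S \<Longrightarrow> jn a a = a"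
  using jn_l jn_least le_asym le_rfl by blast

lemma eqv_mem:
  assumes f: "dfilter f" and S: "a \<in> S" "b \<in> S" and "eqv f a b" "a \<in> f" shows "b \<in> f"
  using jn_eqv_mem[OF f S(1,1,2,2) assms(4,4)] assms(5) S by (simp add: jn_self)

text \<open>Cancellation: modulo f both mixed joins are top, so a is the join of a meet a' and a
  meet b, and the latter equals a' meet b'; hence a is below a', and conversely.\<close>

lemma eqv_of_eqv_mt:
  assumes f: "dfilter f" and S: "a \<in> S" "b \<in> S" "a' \<in> S" "b' \<in> S"
    and "eqv f (mt a b) (mt a' b')" "jn a b' \<in> f" "jn a' b \<in> f"
  shows "eqv f a a'"
proof -
  obtain x where x: "x \<in> f" "\<And>w. le w x \<Longrightarrow> le w (mt a b) \<longleftrightarrow> le w (mt a' b')"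
    using assms(6) unfolding eqv_def by blast
  define y where "y = mt x (mt (jn a b') (jn a' b))"
  have xS: "x \<in> S" "jn a b' \<in> S" "jn a' b \<in> S" using dfilterD(2)[OF f] x(1) jn_in S by blast+
  have yf: "y \<in> f" unfolding y_def using dfilterD(5)[OF f] x(1) assms(7,8) by blast
  have y: "le w y \<Longrightarrow> le w x \<and> le w (jn a b') \<and> le w (jn a' b)" for w
    unfolding y_def using le_mt_iff xS mt_in by blast
  have "le w a'" if w: "le w y" "le w a" for w
  proof (rule le_of_le_jn[of w a' b])
    have wS: "w \<in> S" using w le_in by blast
    show "le (mt w a') a'" using mt_r wS S by blast
    have "le (mt w b) (mt a b)" "le (mt w b) x"
      using le_mt_iff S wS mt_l mt_r le_tr w y[OF w(1)] by meson+
    then have "le (mt w b) (mt a' b')" using x(2) by blast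
    then show "le (mt w b) a'" using le_mt_iff S by blast
  qed (use y[OF w(1)] S in auto)
  moreover have "le w a" if w: "le w y" "le w a'" for w
  proof (rule le_of_le_jn[of w a b'])
    have wS: "w \<in> S" using w le_in by blast
    show "le (mt w a) a" using mt_r wS S by blast
    have "le (mt w b') (mt a' b')" "le (mt w b') x"
      using le_mt_iff S wS mt_l mt_r le_tr w y[OF w(1)] by meson+
    then have "le (mt w b') (mt a b)" using x(2) by blast
    then show "le (mt w b') a" using le_mt_iff S by blast
  qed (use y[OF w(1)] S in auto)
  ultimately show ?thesis unfolding eqv_def using yf by blast
qed

lemma mt_comm: "x \<in> S \<Longrightarrow> y \<in> S \<Longrightarrow> mt x y = mt y x"
  using le_asym le_mt_iff mt_l mt_r by meson

lemma jn_comm: "x \<in> S \<Longrightarrow> y \<in> S \<Longrightarrow> jn x y = jn y x"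
  using le_asym jn_least jn_l jn_r by meson

text \<open>Modulo the congruence, an infinite set of elements that pairwise join into \<open>f\<close> yields a box
  of such pairs \<open>(a, b)\<close>, on which \<open>(a, b) \<mapsto> mt a b\<close> is injective.\<close>

lemma no_infinite_clique:
  assumes f: "dfilter f" and Q: "infinite Q" "Q \<subseteq> S - f"
    and clique: "\<And>a b. a \<in> Q \<Longrightarrow> b \<in> Q \<Longrightarrow> a \<noteq> b \<Longrightarrow> jn a b \<in> f"
  shows False
proof -
  define rep where "rep a = choice (\<lambda>b. b \<in> S \<and> eqv f a b)" for a
  have drep: "dfn1 M rep" unfolding dfn1_def rep_def by (intro dints def1D[OF def_S] def2D[OF def_eqv[OF f]])
  have rep: "rep a \<in> S \<and> eqv f a (rep a)" if "a \<in> S" for a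
  proof -
    have "def1 M (\<lambda>b. b \<in> S \<and> eqv f a b)" unfolding def1_def
      by (intro dints def1D[OF def_S] def2D[OF def_eqv[OF f]])
    from choice_works[OF this, of a] that eqv_refl[OF f] show ?thesis unfolding rep_def by blast
  qed
  have rep_eq: "rep a = rep b" if "eqv f a b" for a b
  proof -
    have "eqv f a c \<longleftrightarrow> eqv f b c" for c using that eqv_sym eqv_trans[OF f] by blast
    then show ?thesis unfolding rep_def by simp
  qed
  define T where "T a \<longleftrightarrow> a \<in> S \<and> \<not> a \<in> f \<and> rep a = a" for a
  have T: "def1 M T" unfolding def1_def T_def by (intro dints def1D[OF def_S] def1D[OF dfilterD(1)[OF f]] dfn1D[OF drep])
  define E where "E a b \<longleftrightarrow> T a \<and> T b \<and> ujn f a b" for a b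
  have E: "def2 M E" unfolding def2_def E_def by (intro dints def1D[OF T] def2D[OF def_ujn[OF f]])
  have Trep: "T (rep a)" if "a \<in> Q" for a
  proof -
    have a: "a \<in> S" "a \<notin> f" using that Q(2) by auto
    have "rep a \<notin> f" using eqv_mem[OF f, of "rep a" a] rep[OF a(1)] a eqv_sym by blast
    moreover have "rep (rep a) = rep a" using rep_eq[of a "rep a"] rep[OF a(1)] by simp
    ultimately show ?thesis unfolding T_def using rep[OF a(1)] by blast
  qed
  have inj: "inj_on rep Q"
  proof (rule inj_onI, rule ccontr)
    fix a b assume ab: "a \<in> Q" "b \<in> Q" "rep a = rep b" "a \<noteq> b"
    then have S: "a \<in> S" "b \<in> S" "a \<notin> f" using Q(2) by auto
    have "eqv f b (rep a)" "eqv f (rep a) a" using rep[OF S(1)] rep[OF S(2)] ab(3) eqv_sym by auto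
    then have "eqv f b a" by (rule eqv_trans[OF f])
    then have "jn a a \<in> f" using jn_eqv_mem[OF f S(1,2,1,1) eqv_refl[OF f]] clique ab by blast
    then show False using S jn_self by simp
  qed
  have Erep: "E (rep a) (rep b)" if ab: "a \<in> Q" "b \<in> Q" "a \<noteq> b" for a b
  proof -
    have S: "a \<in> S" "b \<in> S" using ab Q(2) by auto
    have "jn (rep a) (rep b) \<in> f"
      using jn_eqv_mem[OF f S] rep[OF S(1)] rep[OF S(2)] clique[OF ab] by blast
    then show ?thesis using Trep ab ujn_iff[OF f] rep S unfolding E_def by blast
  qed
  \<comment> \<open>Nothing makes Q definable; what is kept of it is that infinitely many fibres of
    the definable relation \<open>E\<close> are infinite.\<close>
  have "rep ` Q \<subseteq> {x. infinite {y. E x y}}"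
  proof
    fix x assume "x \<in> rep ` Q"
    then obtain a where a: "a \<in> Q" "x = rep a" by blast
    have "rep ` (Q - {a}) \<subseteq> {y. E x y}" using Erep a by auto
    moreover have "infinite (rep ` (Q - {a}))"
      using Q(1) finite_imageD[OF _ inj_on_subset[OF inj, of "Q - {a}"]] by auto
    ultimately show "x \<in> {x. infinite {y. E x y}}" using finite_subset by blast
  qed
  moreover have "infinite (rep ` Q)" using Q(1) inj finite_imageD by blast
  ultimately have "infinite {x. infinite {y. E x y}}" using finite_subset by blast
  from iffD1[OF infinite_iff_interval[OF D_infinite[OF E]] this]
  obtain s0 s1 where "s0 < s1" "\<And>s. s0 < s \<Longrightarrow> s < s1 \<Longrightarrow> infinite {t. E s t}" by blast
  from box_in_infinite_fibres[OF E this] obtain a b c d where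
    box: "a < b" "c < d" "\<And>s t. a < s \<Longrightarrow> s < b \<Longrightarrow> c < t \<Longrightarrow> t < d \<Longrightarrow> E s t" by blast
  \<comment> \<open>A choice from the class of the meet, so equal values mean congruent meets. The
    meet is described by its lower bounds to stay definable.\<close>
  define g where "g x y = choice (\<lambda>u. \<exists>z. (\<forall>w. le w z \<longleftrightarrow> le w x \<and> le w y) \<and> eqv f z u)" for x y
  have g: "dfn2 M g" unfolding dfn2_def g_def by (intro dints def2D[OF def_le] def2D[OF def_eqv[OF f]])
  have g_eqv: "eqv f (mt x y) (g x y)" if "x \<in> S" "y \<in> S" for x y
  proof -
    have z: "z = mt x y" if "\<forall>w. le w z \<longleftrightarrow> le w x \<and> le w y" for z
    proof (rule le_asym)
      show "le (mt x y) z" using that mt_l mt_r \<open>x \<in> S\<close> \<open>y \<in> S\<close> by blast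
      then have "le z z" using le_in le_rfl by blast
      then show "le z (mt x y)" using that le_mt_iff \<open>x \<in> S\<close> \<open>y \<in> S\<close> by blast
    qed
    have "def1 M (\<lambda>u. \<exists>z. (\<forall>w. le w z \<longleftrightarrow> le w x \<and> le w y) \<and> eqv f z u)"
      unfolding def1_def by (intro dints def2D[OF def_le] def2D[OF def_eqv[OF f]])
    moreover have "\<exists>z. (\<forall>w. le w z \<longleftrightarrow> le w x \<and> le w y) \<and> eqv f z (mt x y)"
      using le_mt_iff[OF that] eqv_refl[OF f] by blast
    ultimately have "\<exists>z. (\<forall>w. le w z \<longleftrightarrow> le w x \<and> le w y) \<and> eqv f z (g x y)"
      unfolding g_def using choice_works[of "\<lambda>u. \<exists>z. (\<forall>w. le w z \<longleftrightarrow> le w x \<and> le w y) \<and> eqv f z u"] by blast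
    then show ?thesis using z by blast
  qed
  show False
  proof (rule no_box_injection[OF g box(1,2)])
    fix x y x' y'
    assume xy: "a < x" "x < b" "c < y" "y < d" "a < x'" "x' < b" "c < y'" "y' < d" and eq: "g x y = g x' y'"
    \<comment> \<open>The box also contains the mixed pairs, which supply the two joins that
      cancellation requires.\<close>
    have "E x y" "E x y'" "E x' y" "E x' y'" using box(3) xy by blast+
    then have T: "x \<in> S" "y \<in> S" "x' \<in> S" "y' \<in> S" "rep x = x" "rep y = y" "rep x' = x'" "rep y' = y'"
      and j: "ujn f x y'" "ujn f x' y"
      unfolding E_def T_def by blast+
    have j: "jn x y' \<in> f" "jn x' y \<in> f" using j ujn_iff[OF f] T by blast+
    have "eqv f (mt x y) (mt x' y')"
      using g_eqv[of x y] g_eqv[of x' y'] T eq eqv_sym eqv_trans[OF f] by metis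
    moreover from this have "eqv f (mt y x) (mt y' x')" using mt_comm T by metis
    ultimately have "eqv f x x'" "eqv f y y'"
      using eqv_of_eqv_mt[OF f, of x y x' y'] eqv_of_eqv_mt[OF f, of y x y' x'] j T jn_comm by metis+
    then show "x = x' \<and> y = y'" using rep_eq T by metis
  qed
qed

section \<open>Prime decomposition of definable filters\<close>

definition prime_filter :: "'a set \<Rightarrow> bool" where
  "prime_filter p \<longleftrightarrow> dfilter p \<and> bt \<notin> p \<and> (\<forall>x\<in>S. \<forall>y\<in>S. jn x y \<in> p \<longrightarrow> x \<in> p \<or> y \<in> p)"

text \<open>Modulo f: c is not top, and the top element is join-irreducible among the elements above
  c.\<close>

definition irreducible_for :: "'a set \<Rightarrow> 'a \<Rightarrow> bool" where
  "irreducible_for f c \<longleftrightarrow> c \<in> S \<and> c \<notin> f \<and> (\<forall>b b'. le c b \<and> le c b' \<and> b \<notin> f \<and> b' \<notin> f \<longrightarrow> jn b b' \<notin> f)"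

text \<open>Otherwise splitting above a never ends. Each split continues in its first half and
  discards the second. All later elements lie above the retained half, so a discarded half joins
  every later one into f, and the discarded halves form an infinite clique.\<close>

lemma irreducible_above:
  assumes f: "dfilter f" and a: "a \<in> S" "a \<notin> f"
  shows "\<exists>c. le a c \<and> irreducible_for f c"
proof (rule ccontr)
  assume no: "\<nexists>c. le a c \<and> irreducible_for f c"
  define P where "P p \<longleftrightarrow> le a (fst p) \<and> le a (snd p) \<and> fst p \<notin> f \<and> snd p \<notin> f" for p :: "'a \<times> 'a"
  define R where "R p q \<longleftrightarrow> le (fst p) (fst q) \<and> le (fst p) (snd q) \<and> jn (fst q) (snd q) \<in> f" for p q :: "'a \<times> 'a"
  have "\<exists>s. \<forall>n. P (s n) \<and> R (s n) (s (Suc n))"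
  proof (rule dependent_nat_choice)
    show "\<exists>p. P p" using a le_rfl by (intro exI[of _ "(a, a)"]) (simp add: P_def)
    fix p :: "'a \<times> 'a" and n :: nat assume p: "P p"
    then have "\<not> irreducible_for f (fst p)" using no by (auto simp: P_def)
    then obtain b b' where b: "le (fst p) b" "le (fst p) b'" "b \<notin> f" "b' \<notin> f" "jn b b' \<in> f"
      using p le_in unfolding irreducible_for_def P_def by blast
    then have "P (b, b') \<and> R p (b, b')" using p le_tr unfolding P_def R_def by auto
    then show "\<exists>q. P q \<and> R p q" by blast
  qed
  then obtain s where P: "\<And>n. P (s n)" and R: "\<And>n. R (s n) (s (Suc n))" by blast
  have chain: "le (fst (s m)) (fst (s n))" if "m \<le> n" for m n
    using that
  proof (induction n rule: dec_induct)
    case base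
    show ?case using P[of m] le_in le_rfl unfolding P_def by blast
  next
    case (step n)
    then show ?case using R[of n] le_tr unfolding R_def by blast
  qed
  define b where "b n = snd (s (Suc n))" for n
  have bS: "b n \<in> S - f" for n using P[of "Suc n"] le_in unfolding P_def b_def by blast
  have clique: "jn (b m) (b n) \<in> f" if "m < n" for m n
  proof -
    have "le (fst (s (Suc m))) (b n)"
      using chain[of "Suc m" n] that R[of n] le_tr unfolding R_def b_def by (metis Suc_leI)
    moreover have "jn (fst (s (Suc m))) (b m) \<in> f" using R[of m] unfolding R_def b_def by blast
    ultimately have "jn (b n) (b m) \<in> f" using dfilterD(4)[OF f] jn_mono le_rfl bS by blast
    then show ?thesis using jn_comm bS by (metis DiffD1)
  qed
  have "b m \<noteq> b n" if "m < n" for m n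
    using clique[OF that] bS[of n] jn_self by auto
  then have "inj b" by (metis injI linorder_neqE_nat)
  then have "infinite (range b)" using finite_imageD infinite_UNIV_nat by blast
  moreover have "jn x y \<in> f" if xy: "x \<in> range b" "y \<in> range b" "x \<noteq> y" for x y
  proof -
    obtain m n where mn: "x = b m" "y = b n" "m \<noteq> n" using xy by blast
    show ?thesis
    proof (cases "m < n")
      case True
      then show ?thesis using clique mn by blast
    next
      case False
      then have "jn (b n) (b m) \<in> f" using clique[of n m] mn by simp
      then show ?thesis using jn_comm[of "b m" "b n"] bS mn by auto
    qed
  qed
  ultimately show False using no_infinite_clique[OF f, of "range b"] bS by blast
qed

text \<open>Closure under meets is distributivity: (x join c) meet (y join c) is below (x meet y)
  join c.\<close>

lemma dfilter_residual:
  assumes f: "dfilter f" and c: "c \<in> S"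
  shows "dfilter {y \<in> S. jn y c \<in> f}"
proof -
  have eq: "(\<lambda>y. y \<in> {y \<in> S. jn y c \<in> f}) = (\<lambda>y. y \<in> S \<and> ujn f y c)"
    using ujn_iff[OF f _ c] by auto
  have "def1 M (\<lambda>y. y \<in> {y \<in> S. jn y c \<in> f})"
    unfolding eq def1_def by (intro dints def1D[OF def_S] def2D[OF def_ujn[OF f]])
  moreover have "jn tp c \<in> f" using dfilterD(3,4)[OF f] jn_l tp_in c by blast
  moreover have "jn y c \<in> f" if "x \<in> S" "jn x c \<in> f" "le x y" for x y
    using dfilterD(4)[OF f that(2)] jn_mono[OF that(3) le_rfl[OF c]] by blast
  moreover have "jn (mt x y) c \<in> f" if xy: "x \<in> S" "y \<in> S" "jn x c \<in> f" "jn y c \<in> f" for x y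
  proof (rule dfilterD(4)[OF f dfilterD(5)[OF f xy(3,4)]])
    let ?w = "mt (jn x c) (jn y c)"
    note jS = jn_in[OF xy(1) c] jn_in[OF xy(2) c]
    note w = mt_in[OF jS] mt_l[OF jS] mt_r[OF jS]
    have m: "mt x y \<in> S" using xy mt_in by blast
    have c': "le c (jn (mt x y) c)" using jn_r m c by blast
    show "le ?w (jn (mt x y) c)"
    proof (rule le_of_le_jn[OF w(2) _ _ xy(1) c])
      show "le (mt ?w c) (jn (mt x y) c)" using mt_r[OF w(1) c] c' le_tr by blast
      have u: "mt ?w x \<in> S" "le (mt ?w x) (jn y c)" "le (mt ?w x) x"
        by (rule mt_in[OF w(1) xy(1)], rule le_tr[OF mt_l[OF w(1) xy(1)] w(3)], rule mt_r[OF w(1) xy(1)])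
      show "le (mt ?w x) (jn (mt x y) c)"
      proof (rule le_of_le_jn[OF u(2) _ _ xy(2) c])
        show "le (mt (mt ?w x) c) (jn (mt x y) c)" using mt_r[OF u(1) c] c' le_tr by blast
        have "le (mt (mt ?w x) y) (mt x y)" using le_mt_iff[OF xy(1,2)] mt_l[OF u(1) xy(2)] mt_r[OF u(1) xy(2)] u(3) le_tr by blast
        then show "le (mt (mt ?w x) y) (jn (mt x y) c)" using jn_l[OF m c] le_tr by blast
      qed
    qed
  qed
  ultimately show ?thesis unfolding dfilter_def using tp_in mt_in le_in by auto
qed

text \<open>If neither x join c nor y join c is in f, then both lie above c outside f, and
  irreducibility keeps their join, which is above x join y join c, outside f as well. Since the join
  of \<open>bt\<close> and c is c, the filter is proper.\<close>

lemma prime_residual: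
  assumes f: "dfilter f" and c: "irreducible_for f c"
  shows "prime_filter {y \<in> S. jn y c \<in> f}"
proof -
  have cS: "c \<in> S" "c \<notin> f" using c unfolding irreducible_for_def by auto
  have "jn bt c = c" using le_asym jn_least jn_r bt_le le_rfl cS bt_in by meson
  moreover have "jn x c \<in> f \<or> jn y c \<in> f" if xy: "x \<in> S" "y \<in> S" "jn (jn x y) c \<in> f" for x y
  proof (rule ccontr)
    assume "\<not> (jn x c \<in> f \<or> jn y c \<in> f)"
    then have "jn (jn x c) (jn y c) \<notin> f" using c jn_r xy cS unfolding irreducible_for_def by blast
    moreover have "le (jn (jn x y) c) (jn (jn x c) (jn y c))"
    proof (rule jn_least)
      have S: "jn x c \<in> S" "jn y c \<in> S" using xy cS jn_in by blast+
      show "le (jn x y) (jn (jn x c) (jn y c))" using jn_mono[OF jn_l[OF xy(1) cS(1)] jn_l[OF xy(2) cS(1)]] .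
      show "le c (jn (jn x c) (jn y c))" using jn_r[OF xy(1) cS(1)] jn_l[OF S] le_tr by blast
    qed
    ultimately show False using dfilterD(4)[OF f xy(3)] by blast
  qed
  ultimately show ?thesis unfolding prime_filter_def using dfilter_residual[OF f cS(1)] cS(2) by auto
qed

text \<open>If y lay in all residuals but not in f, an irreducible c above y would join every member
  of C into f. Maximality puts c into C, and then c = c join c is in f. The factor S covers the
  improper filter, for which C is empty.\<close>

lemma prime_decomposition:
  assumes f: "dfilter f"
  shows "\<exists>\<P>. finite \<P> \<and> (\<forall>p\<in>\<P>. prime_filter p) \<and> f = S \<inter> \<Inter>\<P>"
proof -
  define \<C> where "\<C> = {C. (\<forall>c\<in>C. irreducible_for f c) \<and> (\<forall>c\<in>C. \<forall>c'\<in>C. c \<noteq> c' \<longrightarrow> jn c c' \<in> f)}"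
  have "\<exists>C\<in>\<C>. \<forall>X\<in>\<C>. C \<subseteq> X \<longrightarrow> X = C"
  proof (rule subset_Zorn')
    fix K assume K: "subset.chain \<C> K"
    show "\<Union>K \<in> \<C>" unfolding \<C>_def
    proof (intro CollectI conjI ballI impI)
      fix c assume "c \<in> \<Union>K"
      then show "irreducible_for f c" using K unfolding subset.chain_def \<C>_def by blast
    next
      fix c c' assume "c \<in> \<Union>K" "c' \<in> \<Union>K" and ne: "c \<noteq> c'"
      then obtain X Y where X: "X \<in> K" "c \<in> X" and Y: "Y \<in> K" "c' \<in> Y" by blast
      have "X \<subseteq> Y \<or> Y \<subseteq> X" using K X(1) Y(1) unfolding subset.chain_def by blast
      then obtain Z where Z: "Z \<in> K" "c \<in> Z" "c' \<in> Z" using X Y by blast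
      then have "Z \<in> \<C>" using K unfolding subset.chain_def by blast
      then show "jn c c' \<in> f" using Z ne unfolding \<C>_def by blast
    qed
  qed
  then obtain C where "C \<in> \<C>" and max: "\<And>X. X \<in> \<C> \<Longrightarrow> C \<subseteq> X \<Longrightarrow> X = C" by blast
  then have C: "\<And>c. c \<in> C \<Longrightarrow> irreducible_for f c"
    "\<And>c c'. c \<in> C \<Longrightarrow> c' \<in> C \<Longrightarrow> c \<noteq> c' \<Longrightarrow> jn c c' \<in> f"
    unfolding \<C>_def by blast+
  have CS: "c \<in> S" "c \<notin> f" if "c \<in> C" for c using C(1)[OF that] unfolding irreducible_for_def by auto
  have "finite C" using no_infinite_clique[OF f, of C] C(2) CS by blast
  define \<P> where "\<P> = (\<lambda>c. {y \<in> S. jn y c \<in> f}) ` C"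
  have "f = S \<inter> \<Inter>\<P>"
  proof (intro equalityI subsetI)
    fix y assume y: "y \<in> f"
    then have "y \<in> S" using dfilterD(2)[OF f] by blast
    then show "y \<in> S \<inter> \<Inter>\<P>" using dfilterD(4)[OF f y] jn_l CS unfolding \<P>_def by auto
  next
    fix y assume "y \<in> S \<inter> \<Inter>\<P>"
    then have y: "y \<in> S" "\<And>c. c \<in> C \<Longrightarrow> jn y c \<in> f" unfolding \<P>_def by auto
    show "y \<in> f"
    proof (rule ccontr)
      assume "y \<notin> f"
      then obtain c where c: "le y c" "irreducible_for f c" using irreducible_above[OF f y(1)] by blast
      have cS: "c \<in> S" "c \<notin> f" using c(2) unfolding irreducible_for_def by auto
      have j: "jn c c' \<in> f" if "c' \<in> C" for c'
        using dfilterD(4)[OF f y(2)[OF that]] jn_mono[OF c(1) le_rfl[OF CS(1)[OF that]]] by blast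
      have "jn c' c \<in> f" if "c' \<in> C" for c' using j[OF that] jn_comm[OF cS(1) CS(1)[OF that]] by simp
      then have "insert c C \<in> \<C>" using C c(2) j unfolding \<C>_def by blast
      then have "c \<in> C" using max by blast
      then show False using j[of c] jn_self cS by simp
    qed
  qed
  moreover have "finite \<P>" "\<forall>p\<in>\<P>. prime_filter p"
    unfolding \<P>_def using \<open>finite C\<close> prime_residual[OF f] C(1) by auto
  ultimately show ?thesis by blast
qed

section \<open>Codes of definable filters\<close>

text \<open>A code \<open>k\<close> in \<open>S\<close> stands for the principal filter of \<open>k\<close>, a code \<open>c + 2\<close> (\<open>c + 4\<close>) with
  \<open>0 \<le> c \<le> 1\<close> for the filter generated by the points immediately to the right (left) of \<open>c\<close>.\<close>

definition coded :: "'a \<Rightarrow> 'a \<Rightarrow> bool" where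
  "coded k y \<longleftrightarrow> le k y \<or>
     (2 \<le> k \<and> k \<le> 3 \<and> right_germ (k - 2) (\<lambda>t. le t y)) \<or>
     (4 \<le> k \<and> k \<le> 5 \<and> left_germ (k - 4) (\<lambda>t. le t y))"

lemma def_coded: "def2 M coded"
  unfolding def2_def coded_def right_germ_def left_germ_def by (intro dints def2D[OF def_le])

lemma coded_left: "coded c y \<longleftrightarrow> le c y" if "c < 2"
  using that unfolding coded_def by (auto dest: order_trans)

lemma coded_ge2:
  assumes "0 \<le> c" "c \<le> 1"
  shows "coded (c + 2) y \<longleftrightarrow> right_germ c (\<lambda>t. le t y)" "coded (c + 4) y \<longleftrightarrow> left_germ c (\<lambda>t. le t y)"
proof -
  have "\<not> le (c + k) y" if "1 \<le> k" for k
  proof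
    assume "le (c + k) y"
    then have "c + k < 1" using bounds le_in by blast
    then show False using assms(1) that by simp
  qed
  from this[of 2] this[of 4] assms
  show "coded (c + 2) y \<longleftrightarrow> right_germ c (\<lambda>t. le t y)" "coded (c + 4) y \<longleftrightarrow> left_germ c (\<lambda>t. le t y)"
    unfolding coded_def by simp_all
qed

text \<open>Coded sets are upward closed, so the hypothesis just says that the coded set is not
  empty.\<close>

lemma dfilter_coded:
  assumes tp: "coded k tp" shows "dfilter {y. coded k y}"
proof -
  have d: "def1 M (\<lambda>y. y \<in> {y. coded k y})"
    unfolding mem_Collect_eq def1_def by (intro dints def2D[OF def_coded])
  have "\<exists>G. germ_operator G \<and> (\<forall>y. coded k y \<longleftrightarrow> G (\<lambda>t. le t y))"
  proof -
    consider "k < 2" | "2 \<le> k" "k \<le> 3" | "4 \<le> k" "k \<le> 5"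
    proof -
      have "k < 2" if "le k tp" using bounds[of k] le_in[OF that] by (auto intro: less_trans[of k 1])
      then show ?thesis using tp that unfolding coded_def by blast
    qed
    then show ?thesis
    proof cases
      case 1
      then show ?thesis
        by (intro exI[of _ "\<lambda>P. P k"]) (auto simp: coded_left germ_operator_def)
    next
      case 2
      then show ?thesis using coded_ge2(1)[of "k - 2"] germ_operator_right by auto
    next
      case 3
      then show ?thesis using coded_ge2(2)[of "k - 4"] germ_operator_left by auto
    qed
  qed
  then obtain G where G: "germ_operator G" "\<And>y. coded k y \<longleftrightarrow> G (\<lambda>t. le t y)" by blast
  have sub: "y \<in> S" if "coded k y" for y
    using germ_operatorD(1)[OF G(1)] that le_in unfolding G(2) by blast
  have up: "coded k z" if "coded k y" "le y z" for y z
    using germ_operatorD(2)[OF G(1), of "\<lambda>t. le t y" "\<lambda>t. le t z"] that le_tr unfolding G(2) by blast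
  have mtc: "coded k (mt x y)" if "coded k x" "coded k y" for x y
    using germ_operatorD(2)[OF G(1) germ_operatorD(3)[OF G(1)], of "\<lambda>t. le t x" "\<lambda>t. le t y" "\<lambda>t. le t (mt x y)"]
      that mt_greatest unfolding G(2) by blast
  show ?thesis unfolding dfilter_def using d sub up mtc assms by blast
qed

text \<open>With \<open>c\<close> the infimum over \<open>y \<in> f\<close> of the suprema of the sets \<open>{t \<in> f. le t y}\<close>, each of
  these sets meets every neighbourhood of \<open>c\<close>.\<close>

lemma dfilter_is_coded:
  assumes f: "dfilter f" shows "\<exists>k. {y. coded k y} = f"
proof -
  note F = dfilterD[OF f]
  define Dn where "Dn y t \<longleftrightarrow> t \<in> f \<and> le t y" for y t
  have Dn: "def2 M Dn" unfolding def2_def Dn_def by (intro dints def1D[OF F(1)] def2D[OF def_le])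
  define U where "U u \<longleftrightarrow> (\<exists>y. y \<in> f \<and> (\<forall>t. Dn y t \<longrightarrow> t < u))" for u
  have U: "def1 M U" unfolding def1_def U_def by (intro dints def1D[OF F(1)] def2D[OF Dn])
  have U1: "U 1" unfolding U_def Dn_def using F(2,3) bounds by blast
  have U0: "0 \<le> u" if u: "U u" for u
  proof -
    obtain y where y: "y \<in> f" "\<forall>t. Dn y t \<longrightarrow> t < u" using u unfolding U_def by blast
    then have "y < u" "0 < y" using F(2) le_rfl bounds unfolding Dn_def by blast+
    then show ?thesis by simp
  qed
  define c where "c = dinf U"
  have c: "U y \<Longrightarrow> c \<le> y" "c < u \<Longrightarrow> \<exists>z<u. U z" for y u
    using dinf_props[of U, OF U U1] U0 unfolding c_def by blast+
  have c01: "0 \<le> c" "c \<le> 1"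
  proof -
    show "0 \<le> c"
    proof (rule ccontr)
      assume "\<not> 0 \<le> c"
      then show False using c(2)[of 0] U0 by force
    qed
  qed (use c(1)[OF U1] in auto)
  have near: "\<exists>t. Dn y t \<and> c - e \<le> t \<and> t < c + e" if y: "y \<in> f" and e: "0 < e" for y e
  proof -
    obtain u where u: "u < c + e" "U u" using c(2)[of "c + e"] e by auto
    then obtain y0 where y0: "y0 \<in> f" "\<And>t. Dn y0 t \<Longrightarrow> t < u" unfolding U_def by blast
    have z: "mt y y0 \<in> f" using F(5) y y0 by blast
    have "\<not> U (c - e)" using c(1)[of "c - e"] e by auto
    then obtain t where t: "Dn (mt y y0) t" "\<not> t < c - e" using z unfolding U_def by blast
    then have "Dn y t" "Dn y0 t" using le_mt_iff[OF F(2)[OF y] F(2)[OF y0(1)]] unfolding Dn_def by blast+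
    then show ?thesis using t(2) y0(2)[of t] u(1) by force
  qed
  show ?thesis
  proof (cases "\<forall>y\<in>f. Dn y c")
    case True
    \<comment> \<open>Here c belongs to f and lies below all its members, so f is the principal
      filter of c.\<close>
    have "coded c y \<longleftrightarrow> y \<in> f" for y
    proof
      assume "coded c y"
      moreover have "\<not> 2 \<le> c" "\<not> 4 \<le> c" using c01(2) by (auto dest: order_trans)
      ultimately have "le c y" unfolding coded_def by blast
      then show "y \<in> f" using True F(3,4) unfolding Dn_def by blast
    next
      assume "y \<in> f"
      then show "coded c y" using True unfolding Dn_def coded_def by blast
    qed
    then show ?thesis by blast
  next
    case False
    then obtain y1 where y1: "y1 \<in> f" "\<not> Dn y1 c" by blast
    \<comment> \<open>Failing members for c itself, for the right and for the left have a meet z in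
      f; \<open>Dn z\<close> then avoids a whole neighbourhood of c, against
      \<open>near\<close>.\<close>
    have "(\<forall>y\<in>f. right_germ c (Dn y)) \<or> (\<forall>y\<in>f. left_germ c (Dn y))"
    proof (rule ccontr)
      assume "\<not> ?thesis"
      then obtain y2 y3 where y2: "y2 \<in> f" "\<not> right_germ c (Dn y2)" and y3: "y3 \<in> f" "\<not> left_germ c (Dn y3)" by blast
      have dy: "def1 M (Dn y)" for y unfolding def1_def by (intro dints def2D[OF Dn])
      obtain d2 where d2: "d2 > c" "\<forall>t. c < t \<and> t < d2 \<longrightarrow> \<not> Dn y2 t"
        using germ_right[OF dy, of c] y2(2) unfolding right_germ_def by blast
      obtain d3 where d3: "d3 < c" "\<forall>t. d3 < t \<and> t < c \<longrightarrow> \<not> Dn y3 t"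
        using germ_left[OF dy, of c] y3(2) unfolding left_germ_def by blast
      define z where "z = mt y1 (mt y2 y3)"
      have m: "mt y2 y3 \<in> f" "z \<in> f" unfolding z_def using F(5) y1 y2 y3 by blast+
      have zD: "Dn z t \<Longrightarrow> Dn y1 t \<and> Dn y2 t \<and> Dn y3 t" for t
        unfolding z_def Dn_def using le_mt_iff F(2) y1(1) y2(1) y3(1) m(1) by blast
      obtain e where e: "0 < e" "e < min (d2 - c) (c - d3)" using dense[of 0 "min (d2 - c) (c - d3)"] d2(1) d3(1) by auto
      obtain t where t: "Dn z t" "c - e \<le> t" "t < c + e" using near[OF m(2) e(1)] by blast
      have "d3 < t" "t < d2" using t e(2) by auto
      then show False using zD[OF t(1)] y1(2) d2(2) d3(2) by (metis linorder_neqE)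
    qed
    moreover
    have "G (\<lambda>t. le t y) \<longleftrightarrow> y \<in> f" if G: "germ_operator G" "\<forall>y\<in>f. G (Dn y)" for G y
    proof
      assume "G (\<lambda>t. le t y)"
      \<comment> \<open>Taking the top element in \<open>Dn\<close> just records that t is in
        f.\<close>
      then obtain t where "le t y" "Dn tp t"
        using germ_operatorD(1)[OF G(1) germ_operatorD(3)[OF G(1)], of "\<lambda>t. le t y" "Dn tp"] G(2) F(3) by blast
      then show "y \<in> f" using F(4) unfolding Dn_def by blast
    next
      assume "y \<in> f"
      from bspec[OF G(2) this] show "G (\<lambda>t. le t y)"
        by (rule germ_operatorD(2)[OF G(1)]) (simp add: Dn_def)
    qed
    from this[OF germ_operator_right[of c]] this[OF germ_operator_left[of c]] calculation
    have "(\<forall>y. coded (c + 2) y \<longleftrightarrow> y \<in> f) \<or> (\<forall>y. coded (c + 4) y \<longleftrightarrow> y \<in> f)"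
      unfolding coded_ge2[OF c01] by blast
    then show ?thesis by blast
  qed
qed

text \<open>Different numbers can code the same filter, for instance when both germs at a point
  generate it. The choice leaves one code for each filter, which makes the order on codes
  antisymmetric.\<close>

definition code :: "'a set \<Rightarrow> 'a" where
  "code f = choice (\<lambda>k. \<forall>y. coded k y \<longleftrightarrow> y \<in> f)"

lemma coded_code:
  assumes "dfilter f" shows "{y. coded (code f) y} = f"
proof -
  have "def1 M (\<lambda>k. \<forall>y. coded k y \<longleftrightarrow> y \<in> f)"
    unfolding def1_def by (intro dints def2D[OF def_coded] def1D[OF dfilterD(1)[OF assms]])
  moreover obtain k where "\<forall>y. coded k y \<longleftrightarrow> y \<in> f" using dfilter_is_coded[OF assms] by blast
  ultimately have "\<forall>y. coded (code f) y \<longleftrightarrow> y \<in> f"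
    unfolding code_def using choice_works[of "\<lambda>k. \<forall>y. coded k y \<longleftrightarrow> y \<in> f"] by blast
  then show ?thesis by blast
qed

lemma code_inject: "dfilter f \<Longrightarrow> dfilter g \<Longrightarrow> code f = code g \<longleftrightarrow> f = g"
  using coded_code by metis

section \<open>Intersections and sums of definable filters\<close>

lemma dfilter_Int: "dfilter f \<Longrightarrow> dfilter g \<Longrightarrow> dfilter (f \<inter> g)"
  unfolding dfilter_def
  by (auto simp: def1_def intro!: D_conj)

definition gen :: "'a set \<Rightarrow> 'a set \<Rightarrow> 'a set" where
  "gen f g = {z. \<exists>x y. x \<in> f \<and> y \<in> g \<and> le (mt x y) z}"

lemma dfilter_gen:
  assumes f: "dfilter f" and g: "dfilter g" shows "dfilter (gen f g)"
proof -
  note F = dfilterD[OF f] and G = dfilterD[OF g]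
  \<comment> \<open>Restated through \<open>le\<close>, whose definability is given.\<close>
  have eq: "z \<in> gen f g \<longleftrightarrow> z \<in> S \<and> (\<exists>x y. x \<in> f \<and> y \<in> g \<and> (\<forall>w. le w x \<and> le w y \<longrightarrow> le w z))" for z
  proof -
    have "le (mt x y) z \<longleftrightarrow> z \<in> S \<and> (\<forall>w. le w x \<and> le w y \<longrightarrow> le w z)" if "x \<in> f" "y \<in> g" for x y
      using le_mt_iff[OF F(2)[OF that(1)] G(2)[OF that(2)]] mt_l mt_r F(2)[OF that(1)] G(2)[OF that(2)] le_in le_tr
      by meson
    then show ?thesis unfolding gen_def by blast
  qed
  have d: "def1 M (\<lambda>z. z \<in> gen f g)" unfolding eq def1_def
    by (intro dints def1D[OF def_S] def1D[OF F(1)] def1D[OF G(1)] def2D[OF def_le])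
  have mtc: "mt z z' \<in> gen f g" if zz': "z \<in> gen f g" "z' \<in> gen f g" for z z'
  proof -
    obtain x y x' y' where z: "x \<in> f" "y \<in> g" "le (mt x y) z" and z': "x' \<in> f" "y' \<in> g" "le (mt x' y') z'"
      using zz' unfolding gen_def by blast
    have S: "x \<in> S" "y \<in> S" "x' \<in> S" "y' \<in> S" "z \<in> S" "z' \<in> S" using z z' F(2) G(2) le_in by blast+
    note m = mt_in[OF S(1,3)] mt_in[OF S(2,4)]
    have "le w z \<and> le w z'" if "le w (mt (mt x x') (mt y y'))" for w
    proof -
      have "le w x" "le w x'" "le w y" "le w y'"
        using that le_mt_iff[OF m] le_mt_iff[OF S(1,3)] le_mt_iff[OF S(2,4)] by blast+
      then have "le w (mt x y)" "le w (mt x' y')" using mt_greatest by blast+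
      then show ?thesis using z(3) z'(3) le_tr by blast
    qed
    moreover have "mt (mt x x') (mt y y') \<in> S" by (rule mt_in[OF m])
    ultimately have "le (mt (mt x x') (mt y y')) (mt z z')" using le_rfl mt_greatest by blast
    then show ?thesis unfolding gen_def using F(5)[OF z(1) z'(1)] G(5)[OF z(2) z'(2)] by blast
  qed
  show ?thesis unfolding dfilter_def
  proof (intro conjI ballI allI impI)
    show "def1 M (\<lambda>x. x \<in> gen f g)" by (rule d)
    show "gen f g \<subseteq> S" unfolding gen_def using le_in by blast
    show "tp \<in> gen f g" unfolding gen_def using F(3) G(3) tp_ge mt_in tp_in by blast
    show "y \<in> gen f g" if "x \<in> gen f g" "le x y" for x y
      using that le_tr unfolding gen_def by blast
    show "mt x y \<in> gen f g" if "x \<in> gen f g" "y \<in> gen f g" for x y by (rule mtc[OF that])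
  qed
qed

lemma gen_upper: "dfilter f \<Longrightarrow> dfilter g \<Longrightarrow> f \<subseteq> gen f g \<and> g \<subseteq> gen f g"
  unfolding gen_def using dfilterD(2,3) mt_l mt_r tp_in by blast

lemma gen_least:
  assumes "dfilter h" "f \<subseteq> h" "g \<subseteq> h" shows "gen f g \<subseteq> h"
  unfolding gen_def using dfilterD(4,5)[OF assms(1)] assms(2,3) by blast

text \<open>If x meet y and x' meet y' are below z, then so is (x meet x') meet (y join y') by
  distributivity, and y join y' lies in both g and h.\<close>

lemma gen_Int_distrib:
  assumes "dfilter f" "dfilter g" "dfilter h"
  shows "gen f (g \<inter> h) = gen f g \<inter> gen f h"
proof (intro equalityI subsetI)
  fix z assume "z \<in> gen f g \<inter> gen f h"
  then obtain x y x' y' where z: "x \<in> f" "y \<in> g" "le (mt x y) z" and z': "x' \<in> f" "y' \<in> h" "le (mt x' y') z"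
    unfolding gen_def by blast
  have S: "x \<in> S" "y \<in> S" "x' \<in> S" "y' \<in> S" using z z' dfilterD(2) assms by blast+
  have S': "mt x x' \<in> S" "jn y y' \<in> S" using S mt_in jn_in by blast+
  let ?w = "mt (mt x x') (jn y y')"
  have w: "?w \<in> S" "le ?w (jn y y')" "le ?w x" "le ?w x'"
    by (rule mt_in[OF S'], rule mt_r[OF S'], rule le_tr[OF mt_l[OF S'] mt_l[OF S(1,3)]],
      rule le_tr[OF mt_l[OF S'] mt_r[OF S(1,3)]])
  have "le ?w z"
  proof (rule le_of_le_jn[OF w(2) _ _ S(2,4)])
    have "le (mt ?w y) (mt x y)" using le_mt_iff[OF S(1,2)] mt_l[OF w(1) S(2)] mt_r[OF w(1) S(2)] w(3) le_tr by blast
    then show "le (mt ?w y) z" using z(3) le_tr by blast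
    have "le (mt ?w y') (mt x' y')" using le_mt_iff[OF S(3,4)] mt_l[OF w(1) S(4)] mt_r[OF w(1) S(4)] w(4) le_tr by blast
    then show "le (mt ?w y') z" using z'(3) le_tr by blast
  qed
  moreover have "mt x x' \<in> f" by (rule dfilterD(5)[OF assms(1) z(1) z'(1)])
  moreover have "jn y y' \<in> g \<inter> h"
    using dfilterD(4)[OF assms(2) z(2) jn_l[OF S(2,4)]] dfilterD(4)[OF assms(3) z'(2) jn_r[OF S(2,4)]] by blast
  ultimately show "z \<in> gen f (g \<inter> h)" unfolding gen_def by blast
qed (auto simp: gen_def)

lemma up_mt: "x \<in> S \<Longrightarrow> y \<in> S \<Longrightarrow> up (mt x y) = gen (up x) (up y)"
proof (intro equalityI subsetI)
  fix z assume xy: "x \<in> S" "y \<in> S" "z \<in> gen (up x) (up y)"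
  then obtain x' y' where "le x x'" "le y y'" "le (mt x' y') z" unfolding gen_def up_def by blast
  moreover from this have "le (mt x y) (mt x' y')" using mt_greatest mt_l mt_r le_tr xy by meson
  ultimately show "z \<in> up (mt x y)" unfolding up_def using le_tr by blast
qed (auto simp: gen_def up_def intro: le_rfl)

lemma up_jn: "x \<in> S \<Longrightarrow> y \<in> S \<Longrightarrow> up (jn x y) = up x \<inter> up y"
  unfolding up_def using jn_l jn_r jn_least le_tr by blast

lemma up_inject: "x \<in> S \<Longrightarrow> y \<in> S \<Longrightarrow> up x = up y \<Longrightarrow> x = y"
  unfolding up_def using le_rfl le_asym by blast

lemma up_bt: "up bt = S"
  unfolding up_def using bt_le le_in by blast

lemma up_tp: "up tp \<subseteq> f" if "dfilter f"
  unfolding up_def using dfilterD(3,4)[OF that] by blast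

lemma prime_filter_Int:
  assumes p: "prime_filter p" and "dfilter f" "dfilter g" "p = f \<inter> g"
  shows "p = f \<or> p = g"
proof (rule ccontr)
  assume "\<not> ?thesis"
  then obtain x y where xy: "x \<in> f" "x \<notin> p" "y \<in> g" "y \<notin> p" using assms(4) by blast
  then have S: "x \<in> S" "y \<in> S" using dfilterD(2) assms(2,3) by blast+
  then have "jn x y \<in> f \<inter> g" using dfilterD(4)[OF assms(2) xy(1)] dfilterD(4)[OF assms(3) xy(3)] jn_l jn_r by blast
  then show False using p xy S assms(4) unfolding prime_filter_def by blast
qed

end

section \<open>The lattice of definable filters\<close>

context unit_interval_lattice
begin

definition filter_of :: "'a list \<Rightarrow> 'a set" where
  "filter_of x = {y. coded (hd x) y}"

definition filter_lattice :: "'a list gorder" (\<open>\<G>\<close>) where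
  "\<G> = \<lparr>carrier = {[code f] | f. dfilter f}, eq = (=), gorder.le = (\<lambda>x y. filter_of y \<subseteq> filter_of x)\<rparr>"

lemma carrier_G: "carrier \<G> = {[code f] | f. dfilter f}"
  by (simp add: filter_lattice_def)

lemma in_G: "dfilter f \<Longrightarrow> [code f] \<in> carrier \<G>"
  unfolding carrier_G by blast

lemma filter_of_code: "dfilter f \<Longrightarrow> filter_of [code f] = f"
  by (simp add: filter_of_def coded_code)

lemma le_G: "dfilter f \<Longrightarrow> dfilter g \<Longrightarrow> [code f] \<sqsubseteq>\<^bsub>\<G>\<^esub> [code g] \<longleftrightarrow> g \<subseteq> f"
  by (simp add: filter_lattice_def filter_of_code)

lemma partial_order_G: "partial_order \<G>"
proof
  fix x y assume "x \<sqsubseteq>\<^bsub>\<G>\<^esub> y" "y \<sqsubseteq>\<^bsub>\<G>\<^esub> x" "x \<in> carrier \<G>" "y \<in> carrier \<G>"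
  moreover from this obtain f g where "x = [code f]" "y = [code g]" "dfilter f" "dfilter g"
    unfolding carrier_G by blast
  ultimately have "f = g" using le_G by blast
  then show "x .=\<^bsub>\<G>\<^esub> y" using \<open>x = [code f]\<close> \<open>y = [code g]\<close> by (simp add: filter_lattice_def)
qed (auto simp: filter_lattice_def)

lemma least_G:
  assumes "dfilter f" "dfilter g"
  shows "least \<G> [code (f \<inter> g)] (Upper \<G> {[code f], [code g]})"
  unfolding least_def
proof (intro conjI ballI)
  have fg: "dfilter (f \<inter> g)" using dfilter_Int assms .
  show "[code (f \<inter> g)] \<in> Upper \<G> {[code f], [code g]}"
    unfolding Upper_def using in_G[OF fg] le_G[OF assms(1) fg] le_G[OF assms(2) fg] by auto
  fix x assume "x \<in> Upper \<G> {[code f], [code g]}"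
  then have x: "x \<in> carrier \<G>" "[code f] \<sqsubseteq>\<^bsub>\<G>\<^esub> x" "[code g] \<sqsubseteq>\<^bsub>\<G>\<^esub> x"
    unfolding Upper_def using in_G assms by blast+
  then obtain h where h: "x = [code h]" "dfilter h" unfolding carrier_G by blast
  then show "[code (f \<inter> g)] \<sqsubseteq>\<^bsub>\<G>\<^esub> x" using x(2,3) le_G assms fg by simp
qed (auto simp: Upper_def)

lemma greatest_G:
  assumes "dfilter f" "dfilter g"
  shows "greatest \<G> [code (gen f g)] (Lower \<G> {[code f], [code g]})"
  unfolding greatest_def
proof (intro conjI ballI)
  have fg: "dfilter (gen f g)" using dfilter_gen assms .
  show "[code (gen f g)] \<in> Lower \<G> {[code f], [code g]}"
    unfolding Lower_def using in_G[OF fg] le_G[OF fg assms(1)] le_G[OF fg assms(2)] gen_upper[OF assms] by auto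
  fix x assume "x \<in> Lower \<G> {[code f], [code g]}"
  then have x: "x \<in> carrier \<G>" "x \<sqsubseteq>\<^bsub>\<G>\<^esub> [code f]" "x \<sqsubseteq>\<^bsub>\<G>\<^esub> [code g]"
    unfolding Lower_def using in_G assms by blast+
  then obtain h where h: "x = [code h]" "dfilter h" unfolding carrier_G by blast
  then show "x \<sqsubseteq>\<^bsub>\<G>\<^esub> [code (gen f g)]" using x(2,3) le_G assms fg gen_least[OF h(2)] by simp
qed (auto simp: Lower_def)

lemma dfilter_S: "dfilter S"
  using dfilter_up[OF bt_in] by (simp add: up_bt)

lemma least_bottom_G: "least \<G> [code S] (carrier \<G>)"
  unfolding least_def
proof (intro conjI ballI)
  fix x assume "x \<in> carrier \<G>"
  then obtain h where "x = [code h]" "dfilter h" unfolding carrier_G by blast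
  then show "[code S] \<sqsubseteq>\<^bsub>\<G>\<^esub> x" using le_G[OF dfilter_S] dfilterD(2) by blast
qed (use in_G[OF dfilter_S] in auto)

lemma greatest_top_G: "greatest \<G> [code (up tp)] (carrier \<G>)"
  unfolding greatest_def
proof (intro conjI ballI)
  fix x assume "x \<in> carrier \<G>"
  then obtain h where "x = [code h]" "dfilter h" unfolding carrier_G by blast
  then show "x \<sqsubseteq>\<^bsub>\<G>\<^esub> [code (up tp)]" using le_G[OF _ dfilter_up[OF tp_in]] up_tp by blast
qed (use in_G[OF dfilter_up[OF tp_in]] in auto)

lemma bounded_lattice_G: "Lattice.bounded_lattice \<G>"
proof -
  interpret partial_order \<G> by (rule partial_order_G)
  show ?thesis
  proof
    fix x y assume "x \<in> carrier \<G>" "y \<in> carrier \<G>"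
    then obtain f g where fg: "x = [code f]" "y = [code g]" "dfilter f" "dfilter g" unfolding carrier_G by blast
    show "\<exists>s. least \<G> s (Upper \<G> {x, y})" using least_G[OF fg(3,4)] fg(1,2) by blast
    show "\<exists>s. greatest \<G> s (Lower \<G> {x, y})" using greatest_G[OF fg(3,4)] fg(1,2) by blast
  next
    show "\<exists>x. least \<G> x (carrier \<G>)" using least_bottom_G by blast
    show "\<exists>x. greatest \<G> x (carrier \<G>)" using greatest_top_G by blast
  qed
qed

lemma join_G:
  assumes "dfilter f" "dfilter g" shows "[code f] \<squnion>\<^bsub>\<G>\<^esub> [code g] = [code (f \<inter> g)]"
proof -
  interpret Lattice.bounded_lattice \<G> by (rule bounded_lattice_G)
  show ?thesis
    by (rule joinI[OF _ in_G[OF assms(1)] in_G[OF assms(2)]]) (rule least_unique[OF _ least_G[OF assms]])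
qed

lemma meet_G:
  assumes "dfilter f" "dfilter g" shows "[code f] \<sqinter>\<^bsub>\<G>\<^esub> [code g] = [code (gen f g)]"
proof -
  interpret Lattice.bounded_lattice \<G> by (rule bounded_lattice_G)
  show ?thesis
    by (rule meetI[OF _ in_G[OF assms(1)] in_G[OF assms(2)]]) (rule greatest_unique[OF _ greatest_G[OF assms]])
qed

lemma bottom_G: "\<bottom>\<^bsub>\<G>\<^esub> = [code S]"
proof -
  interpret Lattice.bounded_lattice \<G> by (rule bounded_lattice_G)
  show ?thesis by (rule least_unique[OF bottom_least least_bottom_G])
qed

lemma top_G: "\<top>\<^bsub>\<G>\<^esub> = [code (up tp)]"
proof -
  interpret Lattice.bounded_lattice \<G> by (rule bounded_lattice_G)
  show ?thesis by (rule greatest_unique[OF top_greatest greatest_top_G])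
qed

lemma bdl_G: "bounded_distributive_lattice \<G>"
proof -
  interpret Lattice.bounded_lattice \<G> by (rule bounded_lattice_G)
  show ?thesis
  proof
    fix x y z assume "x \<in> carrier \<G>" "y \<in> carrier \<G>" "z \<in> carrier \<G>"
    then obtain f g h where f: "x = [code f]" "y = [code g]" "z = [code h]" "dfilter f" "dfilter g" "dfilter h"
      unfolding carrier_G by blast
    show "x \<sqinter>\<^bsub>\<G>\<^esub> (y \<squnion>\<^bsub>\<G>\<^esub> z) = x \<sqinter>\<^bsub>\<G>\<^esub> y \<squnion>\<^bsub>\<G>\<^esub> (x \<sqinter>\<^bsub>\<G>\<^esub> z)"
      unfolding f(1-3) using f(4-) by (simp add: join_G meet_G dfilter_Int dfilter_gen gen_Int_distrib)
  qed
qed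

section \<open>Definability and join-irreducible generation of the filter lattice\<close>

lemma definable_G: "definable_bdl M 1 \<G>"
proof -
  \<comment> \<open>A number in normal form: it equals the code chosen for the set that it codes.
    This describes the carrier without a quantifier over filters.\<close>
  define C where "C k \<longleftrightarrow> coded k tp \<and> k = choice (\<lambda>l. \<forall>y. coded l y \<longleftrightarrow> coded k y)" for k
  have C: "def1 M C" unfolding def1_def C_def by (intro dints def2D[OF def_coded])
  have C_iff: "C k \<longleftrightarrow> (\<exists>f. dfilter f \<and> k = code f)" for k
  proof
    assume "C k"
    then have "dfilter {y. coded k y}" "k = code {y. coded k y}"
      unfolding C_def code_def using dfilter_coded by simp_all
    then show "\<exists>f. dfilter f \<and> k = code f" by blast
  next
    assume "\<exists>f. dfilter f \<and> k = code f"
    then obtain f where f: "dfilter f" "k = code f" by blast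
    have k: "coded k y \<longleftrightarrow> y \<in> f" for y using coded_code[OF f(1)] f(2) by blast
    show "C k" unfolding C_def k using dfilterD(3)[OF f(1)] f(2) unfolding code_def by simp
  qed
  have car: "carrier \<G> = {[k] | k. C k}" unfolding carrier_G C_iff by blast
  have "definable M 1 (carrier \<G>)"
    unfolding definable_iff_defl defl_def car using C unfolding def1_def by auto
  moreover have "definable M (1 + 1) {x @ y | x y. x \<in> carrier \<G> \<and> y \<in> carrier \<G> \<and> x \<sqsubseteq>\<^bsub>\<G>\<^esub> y}"
  proof -
    have "D M (\<lambda>v. C (v 0) \<and> C (v 1) \<and> (\<forall>y. coded (v 1) y \<longrightarrow> coded (v 0) y))"
      by (intro dints def1D[OF C] def2D[OF def_coded])
    moreover have "map v [0..<1 + 1] \<in> {x @ y | x y. x \<in> carrier \<G> \<and> y \<in> carrier \<G> \<and> x \<sqsubseteq>\<^bsub>\<G>\<^esub> y} \<longleftrightarrow>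
        C (v 0) \<and> C (v 1) \<and> (\<forall>y. coded (v 1) y \<longrightarrow> coded (v 0) y)" for v :: "nat \<Rightarrow> 'a"
    proof -
      have leq: "[s] \<sqsubseteq>\<^bsub>\<G>\<^esub> [t] \<longleftrightarrow> (\<forall>y. coded t y \<longrightarrow> coded s y)" for s t
        by (auto simp: filter_lattice_def filter_of_def)
      have "{x @ y | x y. x \<in> carrier \<G> \<and> y \<in> carrier \<G> \<and> x \<sqsubseteq>\<^bsub>\<G>\<^esub> y} =
          {[s, t] | s t. C s \<and> C t \<and> [s] \<sqsubseteq>\<^bsub>\<G>\<^esub> [t]}" (is "?A = ?B")
      proof (intro equalityI subsetI)
        fix z assume "z \<in> ?A"
        then obtain s t where "z = [s] @ [t]" "C s" "C t" "[s] \<sqsubseteq>\<^bsub>\<G>\<^esub> [t]" unfolding car by blast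
        then show "z \<in> ?B" by simp
      next
        fix z assume "z \<in> ?B"
        then obtain s t where z: "z = [s, t]" "C s" "C t" "[s] \<sqsubseteq>\<^bsub>\<G>\<^esub> [t]" by blast
        then have "[s] @ [t] \<in> ?A" unfolding car by blast
        then show "z \<in> ?A" using z(1) by simp
      qed
      then show ?thesis by (simp add: leq)
    qed
    ultimately show ?thesis unfolding definable_iff_defl defl_def by (auto simp: car)
  qed
  ultimately show ?thesis unfolding definable_bdl_def definable_order_def using bdl_G by blast
qed

lemma join_irreducible_prime:
  assumes p: "prime_filter p" shows "join_irreducible \<G> [code p]"
  unfolding join_irreducible_def
proof (intro conjI ballI impI)
  have dp: "dfilter p" and "bt \<notin> p" using p unfolding prime_filter_def by auto
  show "[code p] \<in> carrier \<G>" by (rule in_G[OF dp])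
  show "[code p] \<noteq> \<bottom>\<^bsub>\<G>\<^esub>" using \<open>bt \<notin> p\<close> bt_in code_inject[OF dp dfilter_S] unfolding bottom_G by auto
  fix a b assume "a \<in> carrier \<G>" "b \<in> carrier \<G>" and eq: "[code p] = a \<squnion>\<^bsub>\<G>\<^esub> b"
  then obtain f g where f: "a = [code f]" "b = [code g]" "dfilter f" "dfilter g" unfolding carrier_G by blast
  then have "p = f \<inter> g" using eq join_G code_inject[OF dp dfilter_Int] by auto
  then have "p = f \<or> p = g" using prime_filter_Int[OF p] f by blast
  then show "[code p] = a \<or> [code p] = b" using f by auto
qed

lemma jig_G: "jig \<G>"
  unfolding jig_def
proof
  fix x assume "x \<in> carrier \<G>"
  then obtain f where f: "x = [code f]" "dfilter f" unfolding carrier_G by blast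
  obtain \<P> where \<P>: "finite \<P>" "\<And>p. p \<in> \<P> \<Longrightarrow> prime_filter p" "f = S \<inter> \<Inter>\<P>"
    using prime_decomposition[OF f(2)] by blast
  obtain ps where ps: "set ps = \<P>" using finite_list[OF \<P>(1)] by blast
  \<comment> \<open>Starting the intersection with S matches the bottom element at the end of
    \<open>foldr\<close>, so the empty list represents the improper filter.\<close>
  have "dfilter (S \<inter> \<Inter>(set qs)) \<and> foldr (join \<G>) (map (\<lambda>p. [code p]) qs) \<bottom>\<^bsub>\<G>\<^esub> = [code (S \<inter> \<Inter>(set qs))]"
    if "\<And>p. p \<in> set qs \<Longrightarrow> dfilter p" for qs
    using that
  proof (induction qs)
    case Nil
    then show ?case by (simp add: dfilter_S bottom_G)
  next
    case (Cons p qs)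
    then have "dfilter p" "dfilter (S \<inter> \<Inter>(set qs))" by auto
    moreover have "S \<inter> \<Inter>(set (p # qs)) = p \<inter> (S \<inter> \<Inter>(set qs))" by auto
    ultimately show ?case using Cons by (simp add: dfilter_Int join_G)
  qed
  from this[of ps] have "foldr (join \<G>) (map (\<lambda>p. [code p]) ps) \<bottom>\<^bsub>\<G>\<^esub> = x"
    using ps \<P>(2,3) f(1) unfolding prime_filter_def by simp
  then show "\<exists>js. (\<forall>i\<in>set js. join_irreducible \<G> i) \<and> x = foldr (join \<G>) js \<bottom>\<^bsub>\<G>\<^esub>"
    using join_irreducible_prime \<P>(2) ps by (intro exI[of _ "map (\<lambda>p. [code p]) ps"]) auto
qed

end

section \<open>Transport to the given lattice\<close>

lemma infinite_of_o_dim: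
  assumes "o_dim M X = 1" shows "infinite X"
proof
  assume fin: "finite X"
  have "o_dim M X \<le> 0" unfolding o_dim_def
  proof (rule Sup_least)
    fix r assume "r \<in> {ereal (real (sum_list d)) | d. \<exists>C. cell M d C \<and> C \<subseteq> X}"
    then obtain d C where d: "r = ereal (real (sum_list d))" "cell M d C" "C \<subseteq> X" by blast
    have "\<not> 1 \<le> sum_list d" using cell_infinite[OF d(2)] finite_subset[OF d(3) fin] by blast
    then have "sum_list d = 0" by linarith
    then show "r \<le> 0" using d(1) by (simp only: of_nat_0 zero_ereal_def order_refl)
  qed
  then show False using assms by simp
qed

text \<open>When \<open>D_list_ex\<close> is nested, the inner point comes first in the assignment
  and the outer one is shifted behind it; appending them in the original order swaps the two
  blocks.\<close>

lemma D_append: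
  fixes M :: "('f, 'r, 'a::linordered_field) expansion"
  assumes "definable M (n + n) Z"
  shows "D M (\<lambda>v. map (\<lambda>i. v (i + n)) [0..<n] @ map v [0..<n] \<in> Z)"
proof -
  have "D M (\<lambda>v. map v [0..<n + n] \<in> Z)" using assms unfolding definable_iff_defl defl_def by blast
  from D_ren[OF this, of "\<lambda>i. if i < n then i + n else i - n"]
  have "D M (\<lambda>v. map (\<lambda>i. v (if i < n then i + n else i - n)) [0..<n + n] \<in> Z)" .
  moreover have "map (\<lambda>i. v (if i < n then i + n else i - n)) [0..<n + n] =
      map (\<lambda>i. v (i + n)) [0..<n] @ map v [0..<n]" for v :: "nat \<Rightarrow> 'a"
    by (rule nth_equalityI) (auto simp: nth_append)
  ultimately show ?thesis by simp
qed

context ominimal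
begin

lemma o_dim_line:
  assumes "definable M 1 X" "infinite X"
  shows "o_dim M X = 1"
proof (rule antisym)
  show "o_dim M X \<le> 1" unfolding o_dim_def
  proof (rule Sup_least)
    fix r assume "r \<in> {ereal (real (sum_list d)) | d. \<exists>C. cell M d C \<and> C \<subseteq> X}"
    then obtain d C where d: "r = ereal (real (sum_list d))" "cell M d C" "C \<subseteq> X" by blast
    obtain x where "x \<in> C" using cell_nonempty[OF d(2)] by blast
    then have "length d = 1" using cell_length[OF d(2)] d(3) assms(1) unfolding definable_iff_defl by fastforce
    then obtain k where k: "d = [k]" by (auto simp: length_Suc_conv)
    then have "k \<le> 1" using cell_entries[OF d(2)] by simp
    then show "r \<le> 1" using d(1) k by simp
  qed
  have "def1 M (\<lambda>t. [t] \<in> X)" using assms(1) unfolding definable_iff_defl defl_def def1_def by simp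
  moreover have "X = (\<lambda>t. [t]) ` {t. [t] \<in> X}"
    using assms(1) unfolding definable_iff_defl by (auto simp: length_Suc_conv)
  then have "infinite {t. [t] \<in> X}" using assms(2) finite_imageI by metis
  ultimately obtain a b where ab: "a < b" "\<And>t. a < t \<Longrightarrow> t < b \<Longrightarrow> [t] \<in> X"
    using iffD1[OF infinite_iff_interval] by blast
  have cf: "cell_function M (length []) {[]} (\<lambda>_. k)" for k
    using const_cell_function[OF definable_singleton, of M "[]"] by simp
  have "cell M ([] @ [1]) {x @ [t] | x t. x \<in> {[]} \<and> (\<forall>f\<in>set_option (Some (\<lambda>_. a)). f x < t) \<and>
     (\<forall>g\<in>set_option (Some (\<lambda>_. b)). t < g x)}"
    by (rule cell_band[OF cell_nil]) (use cf ab in auto)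
  moreover have "{x @ [t] | x t. x \<in> {[]} \<and> (\<forall>f\<in>set_option (Some (\<lambda>_. a)). f x < t) \<and>
     (\<forall>g\<in>set_option (Some (\<lambda>_. b)). t < g x)} \<subseteq> X" using ab by auto
  ultimately have "\<exists>C. cell M [1] C \<and> C \<subseteq> X" by auto
  then have "ereal (real (sum_list [1])) \<le> o_dim M X" unfolding o_dim_def by (intro Sup_upper) blast
  then show "1 \<le> o_dim M X" by (simp add: one_ereal_def)
qed

text \<open>The order on the image is definable by quantifying over preimages in the carrier, and
  injectivity of e makes it isomorphic to the given one; all laws are then read off from H.\<close>

lemma unit_interval_lattice_transport:
  assumes H: "definable_bdl M n H" and e: "defl1 M n (\<lambda>x s. x \<in> carrier H \<and> s = e x)"
    and inj: "inj_on e (carrier H)" and bnd: "\<And>x. x \<in> carrier H \<Longrightarrow> 0 < e x \<and> e x < 1"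
  shows "unit_interval_lattice M (e ` carrier H)
    (\<lambda>s t. \<exists>x\<in>carrier H. \<exists>y\<in>carrier H. s = e x \<and> t = e y \<and> x \<sqsubseteq>\<^bsub>H\<^esub> y)
    (\<lambda>s t. e (inv_into (carrier H) e s \<squnion>\<^bsub>H\<^esub> inv_into (carrier H) e t))
    (\<lambda>s t. e (inv_into (carrier H) e s \<sqinter>\<^bsub>H\<^esub> inv_into (carrier H) e t))
    (e \<bottom>\<^bsub>H\<^esub>) (e \<top>\<^bsub>H\<^esub>)"
    (is "unit_interval_lattice M _ ?le ?jn ?mt _ _")
proof -
  interpret H: bounded_distributive_lattice H using H unfolding definable_bdl_def by blast
  have inv: "inv_into (carrier H) e (e x) = x" if "x \<in> carrier H" for x using inj that by simp
  have le: "?le (e x) (e y) \<longleftrightarrow> x \<sqsubseteq>\<^bsub>H\<^esub> y" if "x \<in> carrier H" "y \<in> carrier H" for x y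
    using inj_onD[OF inj] that by blast
  have leE: "\<exists>x\<in>carrier H. \<exists>y\<in>carrier H. s = e x \<and> t = e y \<and> x \<sqsubseteq>\<^bsub>H\<^esub> y" if "?le s t" for s t
    using that .
  have eq: "x = y" if "e x = e y" "x \<in> carrier H" "y \<in> carrier H" for x y using inj_onD[OF inj] that by blast
  note H_def = H[unfolded definable_bdl_def definable_order_def]
  have len: "\<And>x. x \<in> carrier H \<Longrightarrow> length x = n" using H_def unfolding definable_iff_defl by blast
  show ?thesis
  proof
    show "def2 M ?le"
    proof -
      let ?Z = "{x @ y | x y. x \<in> carrier H \<and> y \<in> carrier H \<and> x \<sqsubseteq>\<^bsub>H\<^esub> y}"
      have Z: "definable M (n + n) ?Z" using H_def by blast
      have "D M (\<lambda>v. \<exists>x. length x = n \<and> ((x \<in> carrier H \<and> v 0 = e x) \<and>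
          (\<exists>y. length y = n \<and> ((y \<in> carrier H \<and> v 1 = e y) \<and> x @ y \<in> ?Z))))"
        by (rule D_list_ex, rule D_conj[OF defl1D[OF e DT_var DT_var]], rule D_list_ex,
          rule D_conj[OF defl1D[OF e DT_var DT_var]], rule D_append[OF Z])
      moreover have "(\<exists>x. length x = n \<and> ((x \<in> carrier H \<and> s = e x) \<and>
          (\<exists>y. length y = n \<and> ((y \<in> carrier H \<and> t = e y) \<and> x @ y \<in> ?Z)))) \<longleftrightarrow> ?le s t" for s t
      proof -
        have "x @ y \<in> ?Z \<longleftrightarrow> x \<sqsubseteq>\<^bsub>H\<^esub> y" if "x \<in> carrier H" "y \<in> carrier H" for x y
          using that len by auto
        then show ?thesis using len by blast
      qed
      ultimately show ?thesis unfolding def2_def by simp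
    qed
  next
    fix s assume "s \<in> e ` carrier H"
    then obtain x where x: "s = e x" "x \<in> carrier H" by blast
    show "0 < s \<and> s < 1" using x bnd by blast
    show "?le s s" "?le (e \<bottom>\<^bsub>H\<^esub>) s" "?le s (e \<top>\<^bsub>H\<^esub>)" unfolding x(1) using x(2) le by simp_all
  next
    fix s t assume "?le s t" "?le t s"
    then show "s = t" using eq H.le_antisym by metis
  next
    fix s t u assume "?le s t" "?le t u"
    then show "?le s u" using eq H.le_trans by metis
  next
    fix s t assume "s \<in> e ` carrier H" "t \<in> e ` carrier H"
    then obtain x y where x: "s = e x" "x \<in> carrier H" "t = e y" "y \<in> carrier H" by blast
    show "?jn s t \<in> e ` carrier H" "?mt s t \<in> e ` carrier H" using x by (simp_all add: inv)
    show "?le s (?jn s t)" "?le t (?jn s t)" "?le (?mt s t) s" "?le (?mt s t) t"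
      unfolding x(1,3) inv[OF x(2)] inv[OF x(4)] using x(2,4) le H.join_left H.join_right H.meet_left H.meet_right by simp_all
  next
    fix s t u assume "?le s u" "?le t u"
    then obtain x y z where x: "s = e x" "t = e y" "u = e z" "x \<in> carrier H" "y \<in> carrier H" "z \<in> carrier H"
      "x \<sqsubseteq>\<^bsub>H\<^esub> z" "y \<sqsubseteq>\<^bsub>H\<^esub> z" using eq by metis
    show "?le (?jn s t) u" unfolding x(1-3) inv[OF x(4)] inv[OF x(5)] using x le H.join_le by simp
  next
    fix s t u assume "?le u s" "?le u t"
    then obtain x y z where x: "s = e x" "t = e y" "u = e z" "x \<in> carrier H" "y \<in> carrier H" "z \<in> carrier H"
      "z \<sqsubseteq>\<^bsub>H\<^esub> x" "z \<sqsubseteq>\<^bsub>H\<^esub> y" using eq by metis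
    show "?le u (?mt s t)" unfolding x(1-3) inv[OF x(4)] inv[OF x(5)] using x le H.meet_le by simp
  next
    fix s t u assume "s \<in> e ` carrier H" "t \<in> e ` carrier H" "u \<in> e ` carrier H"
    then obtain x y z where x: "s = e x" "t = e y" "u = e z" "x \<in> carrier H" "y \<in> carrier H" "z \<in> carrier H" by blast
    show "?mt s (?jn t u) = ?jn (?mt s t) (?mt s u)"
      unfolding x(1-3) using x(4-6) by (simp add: inv H.meet_join_distrib)
  qed auto
qed

end

theorem theorem3p16:
  fixes R :: "('f, 'r, 'a::linordered_field) expansion"
    and n :: nat
    and H :: "'a list gorder"
  assumes "real_closed TYPE('a)"
    and "o_minimal R"
    and "definable_bdl R n H"
    and "o_dim R (carrier H) = 1"
  shows "\<exists>(m::nat) (G::'a list gorder) (h::'a list \<Rightarrow> 'a list).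
           definable_bdl R m G \<and> jig G \<and> o_dim R (carrier G) = 1 \<and>
           definable_bdl_embedding R n H m G h"
proof -
  interpret ominimal R by standard (rule assms(2))
  have dH: "definable R n (carrier H)"
    using assms(3) unfolding definable_bdl_def definable_order_def by blast
  from one_dimensional_injectable[OF this] assms(4) obtain e where
    e: "defl1 R n (\<lambda>x s. x \<in> carrier H \<and> s = e x)" and inj: "inj_on e (carrier H)"
    and bnd: "\<And>x. x \<in> carrier H \<Longrightarrow> 0 < e x \<and> e x < 1"
    unfolding injectable_def by auto
  define leq where "leq s t \<longleftrightarrow> (\<exists>x\<in>carrier H. \<exists>y\<in>carrier H. s = e x \<and> t = e y \<and> x \<sqsubseteq>\<^bsub>H\<^esub> y)" for s t
  define jn where "jn s t = e (inv_into (carrier H) e s \<squnion>\<^bsub>H\<^esub> inv_into (carrier H) e t)" for s t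
  define mt where "mt s t = e (inv_into (carrier H) e s \<sqinter>\<^bsub>H\<^esub> inv_into (carrier H) e t)" for s t
  interpret U: unit_interval_lattice R "e ` carrier H" leq jn mt "e \<bottom>\<^bsub>H\<^esub>" "e \<top>\<^bsub>H\<^esub>"
    using unit_interval_lattice_transport[OF assms(3) e inj bnd]
    unfolding leq_def[abs_def] jn_def[abs_def] mt_def[abs_def] .
  interpret H: bounded_distributive_lattice H using assms(3) unfolding definable_bdl_def by blast
  have inv: "inv_into (carrier H) e (e x) = x" if "x \<in> carrier H" for x using inj that by simp
  define h where "h x = [U.code (U.up (e x))]" for x
  have up: "U.dfilter (U.up (e x))" if "x \<in> carrier H" for x using U.dfilter_up that by blast
  have "definable_bdl_embedding R n H 1 U.filter_lattice h"
    unfolding definable_bdl_embedding_def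
  proof (intro conjI ballI)
    show "h \<in> carrier H \<rightarrow> carrier U.filter_lattice" unfolding h_def using U.in_G up by blast
    \<comment> \<open>The value of h depends on x through s = e x alone, and the set of codes of the
      principal filter of s is definable in s, so the choice from it is too.\<close>
    have "D R (\<lambda>v. \<exists>s. (map v [0..<n] \<in> carrier H \<and> s = e (map v [0..<n])) \<and>
        v n = choice (\<lambda>k. \<forall>y. U.coded k y \<longleftrightarrow> leq s y))"
      by (intro D_ex D_conj defl1D[OF e] dints def2D[OF U.def_coded] def2D[OF U.def_le])
    then have "D R (\<lambda>v. map v [0..<n + 1] \<in> {x @ h x | x. x \<in> carrier H})"
      by (rule back_subst[of "D R"]) (auto simp: h_def U.code_def U.up_def fun_eq_iff)
    then have "definable R (n + 1) {x @ h x | x. x \<in> carrier H}"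
      unfolding definable_iff_defl defl_def using dH[unfolded definable_iff_defl] by (auto simp: h_def)
    then show "definable_map R n 1 (carrier H) h"
      unfolding definable_map_def using dH[unfolded definable_iff_defl] by (auto simp: h_def)
    show "inj_on h (carrier H)"
    proof (rule inj_onI)
      fix x y assume xy: "x \<in> carrier H" "y \<in> carrier H" "h x = h y"
      then have "U.up (e x) = U.up (e y)" using U.code_inject up unfolding h_def by simp
      then have "e x = e y" using U.up_inject xy by blast
      then show "x = y" using inj_onD[OF inj] xy by blast
    qed
    fix x y assume xy: "x \<in> carrier H" "y \<in> carrier H"
    have "e (x \<sqinter>\<^bsub>H\<^esub> y) = mt (e x) (e y)" "e (x \<squnion>\<^bsub>H\<^esub> y) = jn (e x) (e y)"
      unfolding mt_def jn_def using inv xy by simp_all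
    then show "h (x \<sqinter>\<^bsub>H\<^esub> y) = h x \<sqinter>\<^bsub>U.filter_lattice\<^esub> h y" "h (x \<squnion>\<^bsub>H\<^esub> y) = h x \<squnion>\<^bsub>U.filter_lattice\<^esub> h y"
      unfolding h_def using xy up by (simp_all add: U.meet_G U.join_G U.up_mt U.up_jn)
  next
    show "h \<bottom>\<^bsub>H\<^esub> = \<bottom>\<^bsub>U.filter_lattice\<^esub>" unfolding h_def U.bottom_G U.up_bt ..
    show "h \<top>\<^bsub>H\<^esub> = \<top>\<^bsub>U.filter_lattice\<^esub>" unfolding h_def U.top_G ..
  qed
  moreover have "o_dim R (carrier U.filter_lattice) = 1"
  proof (rule o_dim_line)
    show "definable R 1 (carrier U.filter_lattice)"
      using U.definable_G unfolding definable_bdl_def definable_order_def by blast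
    \<comment> \<open>A finite set contains only cells of dimension 0, so H is infinite, and by
      injectivity its image is an infinite subset of the line.\<close>
    have "infinite (h ` carrier H)"
      using calculation infinite_of_o_dim[OF assms(4)] finite_imageD
      unfolding definable_bdl_embedding_def by blast
    moreover have "h ` carrier H \<subseteq> carrier U.filter_lattice"
      unfolding h_def using U.in_G up by blast
    ultimately show "infinite (carrier U.filter_lattice)" using finite_subset by blast
  qed
  ultimately show ?thesis using U.definable_G U.jig_G by blast
qed

end
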